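(* For all positive integers $m$ and $n$, the number $$\frac{4^{n}}{\pi^{2m}}\sum_{\ell=1}^{m}(-1)^{\ell-1}\binom{2m-1}{2\ell-1}\int_0^\infty [\pi I_0(t)]^{2(m-\ell)}[K_0(t)]^{2(m+\ell-1)}(2t)^{2(n+m-2)}\,dt$$ is a positive integer.
   Context: $I_0$ and $K_0$ are the modified Bessel functions of order zero, given for $t>0$ by $I_0(t)=\frac1\pi\int_0^\pi e^{t\cos\theta}\,d\theta$ and $K_0(t)=\int_0^\infty e^{-t\cosh u}\,du$. $\binom{N}{j}=\frac{N!}{j!(N-j)!}$ is the binomial coefficient. *)

theory Defs
  imports "HOL-Analysis.Analysis"
begin

definition bessel_I0 :: "real \<Rightarrow> real" where
  "bessel_I0 t = (1 / pi) * (LINT \<theta>:{0..pi}|lborel. exp (t * cos \<theta>))"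

text \<open>Meaningful only for \<open>t > 0\<close>; the integral diverges otherwise.\<close>
definition bessel_K0 :: "real \<Rightarrow> real" where
  "bessel_K0 t = (LINT u:{0<..}|lborel. exp (- t * cosh u))"

end

theory Submission
  imports Defs "HOL-Probability.Probability" "HOL-Complex_Analysis.Complex_Analysis" "HOL-Real_Asymp.Real_Asymp"
begin

text \<open>
  Put \<open>N = 2m - 1\<close>. By the binomial theorem the alternating sum of integrands is
  \<open>(-1)\<^sup>m\<^sup>-\<^sup>1 Re (K\<^sub>0 (K\<^sub>0 + \<i> \<pi> I\<^sub>0))\<^sup>N\<close> times a power of \<open>2t\<close>, and \<open>K\<^sub>0 (K\<^sub>0 + \<i> \<pi> I\<^sub>0)\<close> is the
  boundary value on the positive real axis of \<open>f(z) = K\<^sub>0(z) K\<^sub>0(-z)\<close>, holomorphic in the upper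
  half plane with \<open>f(-cnj z) = cnj (f z)\<close>. Closing the contour in the upper half plane expresses the
  integral by the coefficient of \<open>1/z\<close> in the expansion of \<open>z\<^bsup>2(n+m-2)\<^esup> f(z)\<^sup>N\<close> at infinity. Here
  \<open>f(z) \<sim> (\<i> \<pi> / 2z) \<Sum>\<^sub>k d\<^sub>k (4z)\<^bsup>-2k\<^esup>\<close> with \<open>d\<^sub>k = binom(2k, k) ((2k-1)!!)\<^sup>2\<close>, because the product of
  two solutions of Bessel's equation solves a third-order equation that yields a two-term recurrence;
  the integer is the coefficient of \<open>x\<^bsup>n-1\<^esup>\<close> in \<open>(\<Sum>\<^sub>k d\<^sub>k x\<^sup>k)\<^sup>N\<close>.

  Instead of the Bessel functions we continue
  \<open>V(\<eta>) = \<^bold>E (1 + \<eta> X\<^sup>2)\<^bsup>-1/2\<^esup>\<close> for a standard normal \<open>X\<close>, since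
  \<open>K\<^sub>0(z) = (\<pi>/2z)\<^bsup>1/2\<^esup> e\<^bsup>-z\<^esup> V(1/4z)\<close>: its asymptotic expansion, and its boundary values on the
  cut \<open>\<eta> < 0\<close> (which involve \<open>I\<^sub>0\<close>), can be read off directly from the integral.
\<close>

unbundle no vec_syntax

subsection \<open>The formal series of the product\<close>

text \<open>On the positive axis the boundary value itself is not integrable at infinity; only its
  real part is. So the contour cannot simply be closed by a vanishing arc: the odd powers in the
  expansion at infinity are removed through their even primitives, which agree at \<open>R\<close>
  and \<open>-R\<close>, and only the logarithm survives. The analytic obstacle is uniformity at the
  cut. As z approaches the real point t from above, the integrand of V(-1/(4z)) develops inverse
  square root singularities at x = 2 sqrt t and x = -2 sqrt t. The global bounds are therefore made
  to depend on the modulus of \<open>\<eta>\<close> only, by a majorant with two movable peaks whose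
  Gaussian moments are bounded uniformly in the position of the peaks. From it come the boundedness
  of V, the asymptotic expansion to every order right up to the cut, the bound by |z|^(-1/2) near
  the origin, and all the bounds for \<open>bessel_K0\<close>.\<close>

definition K0_coeff :: "nat \<Rightarrow> complex" where
  "K0_coeff j = ((- 1 / 2) gchoose j) * (fact (2 * j) / (2 ^ j * fact j))"

lemma K0_coeff_0 [simp]: "K0_coeff 0 = 1"
  by (simp add: K0_coeff_def)

text \<open>\<open>K0_coeff j\<close> is the Taylor coefficient of (1 + w)^(-1/2) times the Gaussian
  moment E X^(2j), as in the termwise expectation of V. Consecutive binomials contribute (-1/2 -
  j)/(j + 1), consecutive moments 2j + 1.\<close>

lemma K0_coeff_Suc:
  "2 * of_nat (Suc j) * K0_coeff (Suc j) = - (2 * of_nat j + 1)\<^sup>2 * K0_coeff j"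
proof -
  have g: "of_nat (Suc j) * ((- 1 / 2 :: complex) gchoose Suc j) = (- 1 / 2 - of_nat j) * ((- 1 / 2) gchoose j)"
    using gbinomial_mult_1[of "- 1 / 2 :: complex" j] by (simp add: algebra_simps)
  have nz: "1 + of_nat j \<noteq> (0::complex)" using of_nat_neq_0[of j] by simp
  have f: "fact (2 * Suc j) / (2 ^ Suc j * fact (Suc j)) = (2 * of_nat j + 1) * (fact (2 * j) / (2 ^ j * fact j) :: complex)"
  proof -
    have nz2: "2 * of_nat j + 2 \<noteq> (0::complex)"
    proof -
      have "2 * of_nat j + 2 = 2 * (1 + of_nat j :: complex)" by (simp add: algebra_simps)
      thus ?thesis using nz by (simp only: mult_eq_0_iff) simp
    qed
    have "fact (2 * Suc j) = (2 * of_nat j + 2) * ((2 * of_nat j + 1) * fact (2 * j) :: complex)"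
      by (simp add: algebra_simps)
    moreover have "2 ^ Suc j * fact (Suc j) = (2 * of_nat j + 2) * (2 ^ j * fact j :: complex)"
      by (simp add: algebra_simps)
    ultimately show ?thesis using nz2 by (metis mult_divide_mult_cancel_left times_divide_eq_right)
  qed
  have "2 * of_nat (Suc j) * K0_coeff (Suc j) =
     2 * (of_nat (Suc j) * ((- 1 / 2 :: complex) gchoose Suc j)) * (fact (2 * Suc j) / (2 ^ Suc j * fact (Suc j)))"
    by (simp only: K0_coeff_def mult_ac)
  also have "\<dots> = 2 * ((- 1 / 2 - of_nat j) * ((- 1 / 2) gchoose j)) * ((2 * of_nat j + 1) * (fact (2 * j) / (2 ^ j * fact j)))"
    by (simp only: g f)
  also have "\<dots> = - (2 * of_nat j + 1)\<^sup>2 * K0_coeff j"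
    by (simp add: K0_coeff_def power2_eq_square algebra_simps)
  finally show ?thesis .
qed

text \<open>The Euler operator x d/dx acts diagonally on coefficients, and x^2 D^2, x^3 D^3 are its
  falling factorials. Differential equations thus become recurrences.\<close>

lemma fps_X_mult_deriv_nth:
  fixes f :: "'a :: comm_ring_1 fps"
  shows "(fps_X ^ 2 * fps_deriv (fps_deriv f)) $ k = of_nat k * (of_nat k - 1) * f $ k"
    and "(fps_X * fps_deriv f) $ k = of_nat k * f $ k"
    and "(fps_X ^ 3 * fps_deriv (fps_deriv (fps_deriv f))) $ k = of_nat k * (of_nat k - 1) * (of_nat k - 2) * f $ k"
proof -
  show 1: "(fps_X * fps_deriv f) $ k = of_nat k * f $ k" for k and f :: "'a fps"
    by (cases k) (auto simp: fps_X_mult_nth)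
  have "fps_X ^ 2 * fps_deriv (fps_deriv f) = fps_X * fps_deriv (fps_X * fps_deriv f) - fps_X * fps_deriv f" for f :: "'a fps"
    by (simp add: algebra_simps power2_eq_square)
  thus 2: "(fps_X ^ 2 * fps_deriv (fps_deriv f)) $ k = of_nat k * (of_nat k - 1) * f $ k" for k and f :: "'a fps"
    by (simp only: fps_sub_nth 1) (simp add: algebra_simps)
  have 3: "fps_X ^ 3 * fps_deriv (fps_deriv (fps_deriv f)) =
        fps_X * fps_deriv (fps_X ^ 2 * fps_deriv (fps_deriv f)) -
        (fps_X ^ 2 * fps_deriv (fps_deriv f) + fps_X ^ 2 * fps_deriv (fps_deriv f))"
    by (simp add: algebra_simps power2_eq_square power3_eq_cube)
  show "(fps_X ^ 3 * fps_deriv (fps_deriv (fps_deriv f))) $ k = of_nat k * (of_nat k - 1) * (of_nat k - 2) * f $ k"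
    unfolding 3 fps_sub_nth fps_add_nth 1 2 by (simp add: algebra_simps)
qed

text \<open>Pure elimination: \<open>a1\<close>, \<open>a2\<close>, \<open>a3\<close> stand for the
  derivatives of \<open>a\<close>, likewise for \<open>b\<close>, and the last two assumptions are
  the differentiated equations. The conclusion is the third-order equation of the product a b. Its
  sums are left as the product rule delivers them, so that the lemma applies verbatim later.\<close>

lemma product_of_solutions_identity:
  fixes x :: "'a :: idom"
  assumes "4 * x\<^sup>2 * a2 + 8 * x * a1 + a + 2 * a1 = 0"
    and "4 * x\<^sup>2 * b2 + 8 * x * b1 + b - 2 * b1 = 0"
    and "4 * x\<^sup>2 * a3 + 16 * x * a2 + (8 * a1 + a1) + 2 * a2 = 0"
    and "4 * x\<^sup>2 * b3 + 16 * x * b2 + (8 * b1 + b1) - 2 * b2 = 0"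
  shows "x * (8 * (x ^ 3 * (a3 * b + (a2 * b1 + a2 * b1 + a2 * b1) + (a1 * b2 + a1 * b2 + a1 * b2) + a * b3)) +
     48 * (x\<^sup>2 * (a2 * b + (a1 * b1 + a1 * b1) + a * b2)) + 56 * (x * (a1 * b + a * b1)) + 8 * (a * b)) = 2 * (a1 * b + a * b1)"
proof -
  have x34: "x ^ 4 = x * x * x * x" "x ^ 3 = x * x * x" "x\<^sup>2 = x * x" by (simp_all add: numeral_eq_Suc)
  have 1: "4 * x\<^sup>2 * a2 = - (8 * x * a1 + a + 2 * a1)" and 2: "4 * x\<^sup>2 * b2 = - (8 * x * b1 + b - 2 * b1)"
    using assms(1,2) by (simp_all add: algebra_simps eq_neg_iff_add_eq_0)
  \<comment> \<open>Multiplying the differentiated equation by 2 x^2 lets \<open>a2\<close> occur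
    only as 4 x^2 \<open>a2\<close>, so it can be substituted without dividing by x.\<close>
  have "8 * x ^ 4 * a3 = 2 * x\<^sup>2 * (4 * x\<^sup>2 * a3 + 16 * x * a2 + (8 * a1 + a1) + 2 * a2) -
       (8 * x + 1) * (4 * x\<^sup>2 * a2) - 18 * x\<^sup>2 * a1"
    unfolding x34 by (simp add: algebra_simps)
  hence 3: "8 * x ^ 4 * a3 = (8 * x + 1) * (8 * x * a1 + a + 2 * a1) - 18 * x\<^sup>2 * a1"
    unfolding assms(3) 1 by (simp add: algebra_simps)
  have "8 * x ^ 4 * b3 = 2 * x\<^sup>2 * (4 * x\<^sup>2 * b3 + 16 * x * b2 + (8 * b1 + b1) - 2 * b2) -
       (8 * x - 1) * (4 * x\<^sup>2 * b2) - 18 * x\<^sup>2 * b1"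
    unfolding x34 by (simp add: algebra_simps)
  hence 4: "8 * x ^ 4 * b3 = (8 * x - 1) * (8 * x * b1 + b - 2 * b1) - 18 * x\<^sup>2 * b1"
    unfolding assms(4) 2 by (simp add: algebra_simps)
  have "x * (8 * (x ^ 3 * (a3 * b + (a2 * b1 + a2 * b1 + a2 * b1) + (a1 * b2 + a1 * b2 + a1 * b2) + a * b3)) +
     48 * (x\<^sup>2 * (a2 * b + (a1 * b1 + a1 * b1) + a * b2)) + 56 * (x * (a1 * b + a * b1)) + 8 * (a * b)) =
     (8 * x ^ 4 * a3) * b + 6 * x\<^sup>2 * ((4 * x\<^sup>2 * a2) * b1) + 6 * x\<^sup>2 * (a1 * (4 * x\<^sup>2 * b2)) + a * (8 * x ^ 4 * b3)
     + 12 * x * ((4 * x\<^sup>2 * a2) * b + 8 * x\<^sup>2 * a1 * b1 + a * (4 * x\<^sup>2 * b2))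
     + 56 * x ^ 2 * (a1 * b + a * b1) + 8 * x * (a * b)"
    by algebra
  also have "\<dots> = 2 * (a1 * b + a * b1)"
    unfolding 1 2 3 4 by algebra
  finally show ?thesis .
qed

text \<open>
  The two series belong to \<open>K\<^sub>0(z)\<close> and \<open>K\<^sub>0(-z)\<close>, which solve the same second-order equation;
  the recurrence is the third-order equation of their product.
\<close>
lemma K0_product_recurrence:
  defines "P \<equiv> Abs_fps K0_coeff * Abs_fps (\<lambda>j. (- 1) ^ j * K0_coeff j)"
  shows "of_nat (k + 2) * P $ (k + 2) = 4 * (of_nat k + 1) ^ 3 * P $ k"
proof -
  define x :: "complex fps" where "x = fps_X"
  define a where "a = Abs_fps K0_coeff"
  define b where "b = Abs_fps (\<lambda>j. (- 1) ^ j * K0_coeff j)"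
  define a1 where "a1 = fps_deriv a"
  define a2 where "a2 = fps_deriv a1"
  define a3 where "a3 = fps_deriv a2"
  define b1 where "b1 = fps_deriv b"
  define b2 where "b2 = fps_deriv b1"
  define b3 where "b3 = fps_deriv b2"
  note d = a1_def a2_def a3_def b1_def b2_def b3_def
  \<comment> \<open>This is \<open>K0_coeff_Suc\<close> in differential form; \<open>eb\<close> is
    its image under x -> -x.\<close>
  have ea: "4 * x\<^sup>2 * a2 + 8 * x * a1 + a + 2 * a1 = 0"
  proof (rule fps_ext)
    fix k
    have "(4 * x\<^sup>2 * a2 + 8 * x * a1 + a + 2 * a1) $ k =
       4 * (x\<^sup>2 * a2) $ k + 8 * (x * a1) $ k + a $ k + 2 * a1 $ k"
      by (simp add: mult.assoc numeral_fps_const)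
    also have "\<dots> = (2 * of_nat k + 1)\<^sup>2 * K0_coeff k + 2 * of_nat (Suc k) * K0_coeff (Suc k)"
      unfolding d x_def fps_X_mult_deriv_nth by (simp add: a_def power2_eq_square algebra_simps)
    also have "\<dots> = 0" unfolding K0_coeff_Suc by simp
    finally show "(4 * x\<^sup>2 * a2 + 8 * x * a1 + a + 2 * a1) $ k = 0 $ k" by simp
  qed
  have eb: "4 * x\<^sup>2 * b2 + 8 * x * b1 + b - 2 * b1 = 0"
  proof (rule fps_ext)
    fix k
    have "(4 * x\<^sup>2 * b2 + 8 * x * b1 + b - 2 * b1) $ k =
       4 * (x\<^sup>2 * b2) $ k + 8 * (x * b1) $ k + b $ k - 2 * b1 $ k"
      by (simp add: mult.assoc numeral_fps_const)
    also have "\<dots> = (-1) ^ k * ((2 * of_nat k + 1)\<^sup>2 * K0_coeff k + 2 * of_nat (Suc k) * K0_coeff (Suc k))"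
      unfolding d x_def fps_X_mult_deriv_nth by (simp add: b_def power2_eq_square algebra_simps)
    also have "\<dots> = 0" unfolding K0_coeff_Suc by simp
    finally show "(4 * x\<^sup>2 * b2 + 8 * x * b1 + b - 2 * b1) $ k = 0 $ k" by simp
  qed
  have dx: "fps_deriv x = 1" by (simp add: x_def)
  have "fps_deriv (4 * x\<^sup>2 * a2 + 8 * x * a1 + a + 2 * a1) = 4 * x\<^sup>2 * a3 + 16 * x * a2 + (8 * a1 + a1) + 2 * a2"
    by (simp add: power2_eq_square dx d algebra_simps numeral_fps_const)
  hence ea': "4 * x\<^sup>2 * a3 + 16 * x * a2 + (8 * a1 + a1) + 2 * a2 = 0" unfolding ea by simp
  have "fps_deriv (4 * x\<^sup>2 * b2 + 8 * x * b1 + b - 2 * b1) = 4 * x\<^sup>2 * b3 + 16 * x * b2 + (8 * b1 + b1) - 2 * b2"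
    by (simp add: power2_eq_square dx d algebra_simps numeral_fps_const)
  hence eb': "4 * x\<^sup>2 * b3 + 16 * x * b2 + (8 * b1 + b1) - 2 * b2 = 0" unfolding eb by simp
  have P: "P = a * b" by (simp add: P_def a_def b_def)
  have P1: "fps_deriv P = a1 * b + a * b1" by (simp add: P d algebra_simps)
  have P2: "fps_deriv (a1 * b + a * b1) = a2 * b + (a1 * b1 + a1 * b1) + a * b2" by (simp add: d algebra_simps)
  have P3: "fps_deriv (a2 * b + (a1 * b1 + a1 * b1) + a * b2) =
      a3 * b + (a2 * b1 + a2 * b1 + a2 * b1) + (a1 * b2 + a1 * b2 + a1 * b2) + a * b3"
    by (simp add: d algebra_simps)
  have eq: "x * (8 * (x ^ 3 * fps_deriv (fps_deriv (fps_deriv P))) + 48 * (x ^ 2 * fps_deriv (fps_deriv P))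
       + 56 * (x * fps_deriv P) + 8 * P) = 2 * fps_deriv P"
    unfolding P1 P2 P3 unfolding P by (rule product_of_solutions_identity[OF ea eb ea' eb'])
  have "(x * (8 * (x ^ 3 * fps_deriv (fps_deriv (fps_deriv P))) + 48 * (x ^ 2 * fps_deriv (fps_deriv P))
       + 56 * (x * fps_deriv P) + 8 * P)) $ Suc k =
      8 * (x ^ 3 * fps_deriv (fps_deriv (fps_deriv P))) $ k + 48 * (x ^ 2 * fps_deriv (fps_deriv P)) $ k
       + 56 * (x * fps_deriv P) $ k + 8 * P $ k"
    by (simp add: x_def numeral_fps_const)
  \<comment> \<open>Since k(k-1)(k-2) + 6k(k-1) + 7k + 1 = (k+1)^3, the left side is 8 x (x d/dx +
    1)^3 applied to P. This perfect cube produces the two-term recurrence.\<close>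
  also have "\<dots> = 8 * (of_nat k + 1) ^ 3 * P $ k"
    unfolding x_def fps_X_mult_deriv_nth by (simp add: algebra_simps power3_eq_cube)
  finally have e: "8 * (of_nat k + 1) ^ 3 * P $ k = (2 * fps_deriv P) $ Suc k"
    unfolding eq by (rule sym)
  have "(2 * fps_deriv P) $ Suc k = 2 * (of_nat (k + 2) * P $ (k + 2))"
    by (simp add: numeral_fps_const)
  with e have "8 * ((of_nat k + 1) ^ 3 * P $ k) = 2 * (of_nat (k + 2) * P $ (k + 2))"
    by (simp only: mult.assoc)
  moreover have "v = 4 * u" if "8 * u = 2 * v" for u v :: complex
    using that by simp
  ultimately show ?thesis unfolding mult.assoc by blast
qed

text \<open>Indexed by the power of \<open>\<eta>\<close>, so the d_j of the overview is the entry
  at 2j.\<close>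

definition K0_product_coeff :: "nat \<Rightarrow> nat" where
  "K0_product_coeff k = (if even k then (k choose (k div 2)) * (\<Prod>i<k div 2. 2 * i + 1)\<^sup>2 else 0)"

lemma central_binomial_Suc:
  "Suc j * (2 * Suc j choose Suc j) = 2 * (2 * j + 1) * (2 * j choose j)"
proof -
  have 1: "Suc j * (2 * Suc j choose Suc j) = 2 * Suc j * (Suc (2 * j) choose j)"
    using Suc_times_binomial_eq[of "Suc (2 * j)" j] by (simp add: mult_ac)
  have 2: "(Suc (2 * j) choose j) = (Suc (2 * j) choose Suc j)"
    using binomial_symmetric[of j "Suc (2 * j)"] by simp
  have 3: "Suc j * (Suc (2 * j) choose Suc j) = Suc (2 * j) * (2 * j choose j)"
    using Suc_times_binomial_eq[of "2 * j" j] by (simp add: mult_ac)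
  show ?thesis using 1 unfolding 2 using 3 by (simp add: mult.assoc)
qed

lemma K0_product_coeff_Suc_Suc:
  "(k + 2) * K0_product_coeff (k + 2) = 4 * (k + 1) ^ 3 * K0_product_coeff k"
proof (cases "even k")
  case True
  then obtain j where k: "k = 2 * j" by (elim evenE)
  have "(k + 2) * K0_product_coeff (k + 2) =
      2 * (Suc j * (2 * Suc j choose Suc j)) * ((\<Prod>i<j. 2 * i + 1) * (2 * j + 1))\<^sup>2"
  proof -
    have "K0_product_coeff (k + 2) = (2 * Suc j choose Suc j) * ((\<Prod>i<j. 2 * i + 1) * (2 * j + 1))\<^sup>2"
      by (simp add: k K0_product_coeff_def del: binomial_Suc_Suc)
    moreover have "k + 2 = 2 * Suc j" by (simp add: k)
    ultimately show ?thesis by (simp only: mult_ac)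
  qed
  also have "\<dots> = 4 * (k + 1) ^ 3 * K0_product_coeff k"
  proof -
    have "2 * (2 * (2 * j + 1) * (2 * j choose j)) * ((\<Prod>i<j. 2 * i + 1) * (2 * j + 1))\<^sup>2 =
        2 * 2 * (2 * j + 1) ^ 3 * ((2 * j choose j) * (\<Prod>i<j. 2 * i + 1)\<^sup>2)"
      by (simp only: power2_eq_square power3_eq_cube mult_ac)
    thus ?thesis unfolding central_binomial_Suc by (simp add: k K0_product_coeff_def)
  qed
  finally show ?thesis .
qed (simp add: K0_product_coeff_def)

text \<open>Both sides start with 1, 0 and obey the same recurrence of step two, with leading factor
  k + 2 nonzero. Here the fractional coefficients of the two factors combine to natural
  numbers.\<close>

lemma K0_product_series:
  "Abs_fps K0_coeff * Abs_fps (\<lambda>j. (- 1) ^ j * K0_coeff j) = Abs_fps (\<lambda>k. of_nat (K0_product_coeff k))"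
  (is "?P = _")
proof (rule fps_ext)
  fix k
  have "?P $ k = of_nat (K0_product_coeff k)"
  proof (induction k rule: induct_nat_012)
    case 0
    show ?case by (simp add: K0_product_coeff_def)
  next
    case 1
    show ?case by (simp add: fps_mult_nth K0_product_coeff_def)
  next
    case (ge2 k)
    have "of_nat (k + 2) * ?P $ (k + 2) = of_nat (4 * (k + 1) ^ 3 * K0_product_coeff k)"
      unfolding K0_product_recurrence ge2 by (simp add: add.commute)
    also have "\<dots> = of_nat (k + 2) * (of_nat (K0_product_coeff (k + 2)) :: complex)"
      unfolding K0_product_coeff_Suc_Suc[symmetric] by (rule of_nat_mult)
    finally have *: "of_nat (k + 2) * ?P $ (k + 2) = of_nat (k + 2) * of_nat (K0_product_coeff (k + 2))" .
    have "of_nat (k + 2) \<noteq> (0 :: complex)" by (simp only: of_nat_eq_0_iff)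
    hence "?P $ (k + 2) = of_nat (K0_product_coeff (k + 2))"
      using * by (metis mult_left_cancel)
    thus ?case by simp
  qed
  thus "?P $ k = Abs_fps (\<lambda>k. of_nat (K0_product_coeff k)) $ k" by simp
qed

section \<open>Integrality, parity and positivity for powers of a series with natural
  coefficients\<close>

lemma fps_power_of_nat_nth:
  "(Abs_fps (\<lambda>k. of_nat (q k)) ^ N :: 'a :: comm_semiring_1 fps) $ k = of_nat ((Abs_fps q ^ N) $ k)"
proof (induction N arbitrary: k)
  case (Suc N)
  thus ?case by (simp add: fps_mult_nth)
qed (simp add: fps_one_nth)

lemma fps_power_odd_nth:
  fixes q :: "nat \<Rightarrow> nat"
  assumes "\<And>k. odd k \<Longrightarrow> q k = 0" and "odd k"
  shows "(Abs_fps q ^ N) $ k = 0"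
  using \<open>odd k\<close>
proof (induction N arbitrary: k)
  case 0
  thus ?case by (cases k) auto
next
  case (Suc N)
  have "q i * (Abs_fps q ^ N) $ (k - i) = 0" if "i \<le> k" for i
    using assms(1)[of i] Suc.IH[of "k - i"] Suc.prems that by (cases "odd i") auto
  thus ?case by (auto simp: fps_mult_nth intro!: sum.neutral)
qed

text \<open>In the convolution the single term with index 0 is already positive, and natural numbers
  cannot cancel it.\<close>

lemma fps_power_even_nth_pos:
  fixes q :: "nat \<Rightarrow> nat"
  assumes "\<And>k. even k \<Longrightarrow> q k > 0" and "even k" and "N > 0"
  shows "(Abs_fps q ^ N) $ k > 0"
  using \<open>N > 0\<close>
proof (induction N rule: nat_induct_non_zero)
  case 1
  show ?case using assms by simp
next
  case (Suc N)
  have "0 < q 0 * (Abs_fps q ^ N) $ k" using Suc.IH assms(1)[of 0] by simp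
  also have "\<dots> \<le> (\<Sum>i=0..k. Abs_fps q $ i * (Abs_fps q ^ N) $ (k - i))"
    by (rule order_trans[OF _ member_le_sum[of 0]]) auto
  finally show ?case by (simp add: fps_mult_nth)
qed

lemma K0_product_coeff_pos: "even k \<Longrightarrow> K0_product_coeff k > 0"
  by (auto simp: K0_product_coeff_def intro!: prod_pos)

subsection \<open>Line integrals in the upper half plane\<close>

text \<open>Subtract from a primitive of \<open>F\<close> the explicit primitive \<open>H\<close> of
  its expansion: the difference has derivative O(1/|z|^2). Going from
  \<open>Complex R \<delta>\<close> to \<open>Complex (-R) \<delta>\<close> along the other three
  sides of a box, of total length at most 4R and with |z| >= R throughout, changes it by at most
  4C/R. The symmetry makes Re \<open>F\<close> even on the horizontal line, whence the factor
  2.\<close>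

lemma upper_half_plane_line_integral:
  fixes F :: "complex \<Rightarrow> complex" and e :: "nat \<Rightarrow> complex"
  assumes hol: "F holomorphic_on {z. Im z > 0}"
    and sym: "\<And>z. Im z > 0 \<Longrightarrow> F (- cnj z) = cnj (F z)"
    and expansion: "\<And>z. Im z > 0 \<Longrightarrow> norm z \<ge> 1 \<Longrightarrow>
      norm (F z - (\<beta> / z + (\<Sum>a<A. e a * z ^ (2 * a + 1)))) \<le> C / (norm z)\<^sup>2"
    and H: "H = (\<lambda>z. \<beta> * Ln z + (\<Sum>a<A. e a * z ^ (2 * a + 2) / of_nat (2 * a + 2)))"
    and R: "R \<ge> 1" and \<delta>: "0 < \<delta>" "\<delta> < 1"
  shows "\<bar>2 * integral {0..R} (\<lambda>t. Re (F (Complex t \<delta>))) -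
           Re (H (Complex R \<delta>) - H (Complex (-R) \<delta>))\<bar> \<le> 4 * C / R"
proof -
  define U where "U = {z. Im z > 0}"
  have U: "open U" "convex U"
    unfolding U_def using open_halfspace_Im_gt convex_halfspace_Im_gt by auto
  have "\<exists>P. \<forall>z\<in>U. (P has_field_derivative F z) (at z within U)"
  proof (rule holomorphic_convex_primitive'[OF U(2,1) hol[folded U_def]])
    fix g assume "\<And>x. x \<in> U \<Longrightarrow> (g has_field_derivative F x) (at x within U)"
    thus ?thesis by auto
  qed
  then obtain P where P: "\<And>z. z \<in> U \<Longrightarrow> (P has_field_derivative F z) (at z within U)"
    by auto
  have P': "(P has_field_derivative F z) (at z)" if "Im z > 0" for z
  proof -
    have z: "z \<in> U" using that by (simp add: U_def)
    show ?thesis using P[OF z] unfolding at_within_open[OF z U(1)] .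
  qed
  have H': "(H has_field_derivative (\<beta> / z + (\<Sum>a<A. e a * z ^ (2 * a + 1)))) (at z)"
    if "Im z > 0" for z
  proof -
    have "z \<notin> \<real>\<^sub>\<le>\<^sub>0" using that by (auto simp: complex_nonpos_Reals_iff)
    have *: "((\<lambda>z. e a * z ^ (2 * a + 2) / of_nat (2 * a + 2)) has_field_derivative e a * z ^ (2 * a + 1)) (at z)" for a
    proof -
      have "((\<lambda>z. z ^ (2 * a + 2)) has_field_derivative of_nat (2 * a + 2) * z ^ (2 * a + 1)) (at z)"
        using DERIV_power[OF DERIV_ident, where n = "2 * a + 2"] by simp
      from DERIV_cdivide[OF DERIV_cmult[OF this], of "e a" "of_nat (2 * a + 2)"]
      have "((\<lambda>z. e a * z ^ (2 * a + 2) / of_nat (2 * a + 2)) has_field_derivative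
          e a * (of_nat (2 * a + 2) * z ^ (2 * a + 1)) / of_nat (2 * a + 2)) (at z)" .
      moreover have "of_nat (2 * a + 2) \<noteq> (0::complex)" by (simp only: of_nat_eq_0_iff)
      hence "e a * (of_nat (2 * a + 2) * z ^ (2 * a + 1)) / of_nat (2 * a + 2) = e a * z ^ (2 * a + 1)"
        by (metis mult.left_commute nonzero_mult_div_cancel_left)
      ultimately show ?thesis by simp
    qed
    have **: "((\<lambda>z. \<beta> * Ln z) has_field_derivative \<beta> / z) (at z)"
      using \<open>z \<notin> \<real>\<^sub>\<le>\<^sub>0\<close> by (auto intro!: derivative_eq_intros simp: divide_inverse)
    show ?thesis unfolding H
      by (intro DERIV_add ** DERIV_sum *)
  qed
  define Q where "Q = (\<lambda>z. P z - H z)"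
  have Q': "(Q has_field_derivative (F z - (\<beta> / z + (\<Sum>a<A. e a * z ^ (2 * a + 1))))) (at z)"
    if "Im z > 0" for z
    unfolding Q_def by (intro DERIV_diff P' H' that)
  have Cnn: "C \<ge> 0"
    using order_trans[OF norm_ge_zero expansion[of \<i>]] by simp
  \<comment> \<open>Each side of the box will be placed in a convex region on which |z| >= R, so
    that the mean value inequality applies with constant C/R^2.\<close>
  have seg: "norm (Q x - Q y) \<le> C / R\<^sup>2 * norm (x - y)"
    if S: "convex S" "S \<subseteq> {z. Im z > 0 \<and> norm z \<ge> R}" "x \<in> S" "y \<in> S" for S x y
  proof (rule field_differentiable_bound[OF S(1) _ _ S(3,4)])
    fix z assume "z \<in> S"
    hence z: "Im z > 0" "norm z \<ge> R" using S by auto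
    show "(Q has_field_derivative (F z - (\<beta> / z + (\<Sum>a<A. e a * z ^ (2 * a + 1))))) (at z within S)"
      using Q'[OF z(1)] by (rule DERIV_subset) simp
    have "norm (F z - (\<beta> / z + (\<Sum>a<A. e a * z ^ (2 * a + 1)))) \<le> C / (norm z)\<^sup>2"
      using expansion[OF z(1)] z(2) R by simp
    also have "\<dots> \<le> C / R\<^sup>2"
      using z(2) R Cnn by (intro divide_left_mono power_mono mult_pos_pos zero_less_power) auto
    finally show "norm (F z - (\<beta> / z + (\<Sum>a<A. e a * z ^ (2 * a + 1)))) \<le> C / R\<^sup>2" .
  qed
  have s1: "norm (Q (Complex R \<delta>) - Q (Complex R R)) \<le> C / R\<^sup>2 * norm (Complex R \<delta> - Complex R R)"
  proof (rule seg[where S = "{z. Re z \<ge> R} \<inter> {z. Im z > 0}"])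
    show "convex ({z. Re z \<ge> R} \<inter> {z. Im z > 0})"
      by (intro convex_Int convex_halfspace_Re_ge convex_halfspace_Im_gt)
    show "{z. Re z \<ge> R} \<inter> {z. Im z > 0} \<subseteq> {z. Im z > 0 \<and> norm z \<ge> R}"
    proof safe
      fix z assume "Re z \<ge> R"
      thus "norm z \<ge> R" using complex_Re_le_cmod[of z] by linarith
    qed
  qed (use R \<delta> in auto)
  have s2: "norm (Q (Complex R R) - Q (Complex (-R) R)) \<le> C / R\<^sup>2 * norm (Complex R R - Complex (-R) R)"
  proof (rule seg[where S = "{z. Im z \<ge> R}"])
    show "convex {z. Im z \<ge> R}"
      by (intro convex_halfspace_Im_ge)
    show "{z. Im z \<ge> R} \<subseteq> {z. Im z > 0 \<and> norm z \<ge> R}"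
    proof safe
      fix z assume "Im z \<ge> R"
      thus "norm z \<ge> R" "Im z > 0" using abs_Im_le_cmod[of z] R by linarith+
    qed
  qed (use R \<delta> in auto)
  have s3: "norm (Q (Complex (-R) R) - Q (Complex (-R) \<delta>)) \<le> C / R\<^sup>2 * norm (Complex (-R) R - Complex (-R) \<delta>)"
  proof (rule seg[where S = "{z. Re z \<le> -R} \<inter> {z. Im z > 0}"])
    show "convex ({z. Re z \<le> -R} \<inter> {z. Im z > 0})"
      by (intro convex_Int convex_halfspace_Re_le convex_halfspace_Im_gt)
    show "{z. Re z \<le> -R} \<inter> {z. Im z > 0} \<subseteq> {z. Im z > 0 \<and> norm z \<ge> R}"
    proof safe
      fix z assume "Re z \<le> -R"
      thus "norm z \<ge> R" using abs_Re_le_cmod[of z] by linarith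
    qed
  qed (use R \<delta> in auto)
  have n1: "norm (Complex R \<delta> - Complex R R) \<le> R"
    using R \<delta> by (simp add: cmod_def)
  have "Complex R R - Complex (-R) R = of_real (2 * R)"
    by (simp add: complex_eq_iff)
  hence n2: "norm (Complex R R - Complex (-R) R) = 2 * R"
    using R by (simp only: norm_of_real)
  have n3: "norm (Complex (-R) R - Complex (-R) \<delta>) \<le> R"
    using R \<delta> by (simp add: cmod_def)
  have "norm (Q (Complex R \<delta>) - Q (Complex (-R) \<delta>)) \<le> C / R\<^sup>2 * R + C / R\<^sup>2 * (2 * R) + C / R\<^sup>2 * R"
  proof -
    have c: "C / R\<^sup>2 \<ge> 0" using Cnn by simp
    have "norm (Q (Complex R \<delta>) - Q (Complex (-R) \<delta>)) \<le>
       norm (Q (Complex R \<delta>) - Q (Complex R R)) + norm (Q (Complex R R) - Q (Complex (-R) R)) +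
       norm (Q (Complex (-R) R) - Q (Complex (-R) \<delta>))"
      using norm_triangle_ineq[of "Q (Complex R \<delta>) - Q (Complex R R)" "Q (Complex R R) - Q (Complex (-R) \<delta>)"]
        norm_triangle_ineq[of "Q (Complex R R) - Q (Complex (-R) R)" "Q (Complex (-R) R) - Q (Complex (-R) \<delta>)"]
      by simp
    moreover have "C / R\<^sup>2 * norm (Complex R \<delta> - Complex R R) \<le> C / R\<^sup>2 * R"
      by (rule mult_left_mono[OF n1 c])
    moreover have "C / R\<^sup>2 * norm (Complex (-R) R - Complex (-R) \<delta>) \<le> C / R\<^sup>2 * R"
      by (rule mult_left_mono[OF n3 c])
    ultimately show ?thesis using s1 s2[unfolded n2] s3 by linarith
  qed
  also have "\<dots> = 4 * C / R"
    using R by (simp add: field_simps power2_eq_square)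
  finally have QR: "norm (Q (Complex R \<delta>) - Q (Complex (-R) \<delta>)) \<le> 4 * C / R" .

  define f where "f = (\<lambda>t. F (Complex t \<delta>))"
  have line: "Complex t \<delta> = of_real t + \<i> * of_real \<delta>" for t by (simp add: complex_eq_iff)
  have "(f has_integral (P (Complex R \<delta>) - P (Complex (-R) \<delta>))) {-R..R}"
  proof (rule fundamental_theorem_of_calculus)
    fix x
    have 1: "((\<lambda>t. Complex t \<delta>) has_vector_derivative 1) (at x within {-R..R})"
      unfolding line by (auto intro!: derivative_eq_intros)
    have "((P \<circ> (\<lambda>t. Complex t \<delta>)) has_vector_derivative 1 * F (Complex x \<delta>)) (at x within {-R..R})"
      by (rule field_vector_diff_chain_within[OF 1])
         (rule has_field_derivative_at_within[OF P'], simp add: \<delta>)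
    thus "((\<lambda>t. P (Complex t \<delta>)) has_vector_derivative f x) (at x within {-R..R})"
      by (simp add: o_def f_def)
  qed (use R in simp)
  hence hiRe: "((\<lambda>t. Re (f t)) has_integral Re (P (Complex R \<delta>) - P (Complex (-R) \<delta>))) {-R..R}"
    by (rule has_integral_Re)
  have int: "integral {-R..R} (\<lambda>t. Re (f t)) = Re (P (Complex R \<delta>) - P (Complex (-R) \<delta>))"
    using hiRe by (rule integral_unique)
  have fint': "(\<lambda>t. Re (f t)) integrable_on {-R..R}"
    using hiRe by (rule has_integral_integrable)
  have fsym: "Re (f (-t)) = Re (f t)" for t
  proof -
    have "- cnj (Complex t \<delta>) = Complex (-t) \<delta>" by (simp add: complex_eq_iff)
    thus ?thesis using sym[of "Complex t \<delta>"] \<delta> by (simp add: f_def)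
  qed
  have "integral {-R..R} (\<lambda>t. Re (f t)) = integral {-R..0} (\<lambda>t. Re (f t)) + integral {0..R} (\<lambda>t. Re (f t))"
    by (rule Henstock_Kurzweil_Integration.integral_combine[symmetric]) (use R fint' in auto)
  also have "integral {-R..0} (\<lambda>t. Re (f t)) = integral {0..R} (\<lambda>t. Re (f t))"
    using Henstock_Kurzweil_Integration.integral_reflect_real[of R 0 "\<lambda>t. Re (f t)"] fsym by simp
  finally have "2 * integral {0..R} (\<lambda>t. Re (f t)) - Re (H (Complex R \<delta>) - H (Complex (-R) \<delta>))
      = Re (Q (Complex R \<delta>) - Q (Complex (-R) \<delta>))"
    using int by (simp add: Q_def)
  thus ?thesis using QR abs_Re_le_cmod[of "Q (Complex R \<delta>) - Q (Complex (-R) \<delta>)"]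
    by (simp add: f_def)
qed

lemma tendsto_Ln_real_line_difference:
  assumes "R > 0"
  shows "((\<lambda>\<delta>. Ln (Complex R \<delta>) - Ln (Complex (-R) \<delta>)) \<longlongrightarrow> - \<i> * pi) (at_right 0)"
proof -
  have line: "Complex x \<delta> = of_real x + \<i> * of_real \<delta>" for x \<delta> by (simp add: complex_eq_iff)
  have 1: "((\<lambda>\<delta>. Ln (Complex R \<delta>)) \<longlongrightarrow> Ln (of_real R)) (at_right 0)"
    unfolding line using assms by (auto intro!: tendsto_eq_intros)
  \<comment> \<open>\<open>Ln\<close> is discontinuous at -R, so the limit is taken at the negated
    point, which is close to R; negation from above the cut costs the summand i pi.\<close>
  have 2: "((\<lambda>\<delta>. Ln (- Complex (-R) \<delta>) + \<i> * pi) \<longlongrightarrow> Ln (of_real R) + \<i> * pi) (at_right 0)"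
    unfolding line using assms by (auto intro!: tendsto_eq_intros)
  have "\<forall>\<^sub>F \<delta> in at_right 0. Ln (- Complex (-R) \<delta>) + \<i> * pi = Ln (Complex (-R) \<delta>)"
    using eventually_at_right_less[of 0]
    by eventually_elim (use assms in \<open>auto simp: Ln_minus complex_eq_iff\<close>)
  from tendsto_diff[OF 1 Lim_transform_eventually[OF 2 this]]
  show ?thesis by simp
qed

subsection \<open>Uniform bounds for an inverse square root singularity\<close>

lemma norm_integral_le_AE:
  fixes f :: "'a \<Rightarrow> complex"
  assumes "f \<in> borel_measurable M" "integrable M g" "AE x in M. norm (f x) \<le> g x"
  shows "integrable M f" and "norm (integral\<^sup>L M f) \<le> integral\<^sup>L M g"
proof -
  show f: "integrable M f"
    by (rule Bochner_Integration.integrable_bound[OF assms(2,1)])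
       (use assms(3) in \<open>auto elim!: eventually_mono\<close>)
  have "norm (integral\<^sup>L M f) \<le> (\<integral>x. norm (f x) \<partial>M)"
    by (rule integral_norm_bound)
  also have "\<dots> \<le> integral\<^sup>L M g"
    using f assms by (intro integral_mono_AE) auto
  finally show "norm (integral\<^sup>L M f) \<le> integral\<^sup>L M g" .
qed

text \<open>The cutoff at 1 makes the singularity integrable over the whole line; at 0 division by
  zero gives the harmless value 0.\<close>

definition inv_sqrt_peak :: "real \<Rightarrow> real" where
  "inv_sqrt_peak y = (if \<bar>y\<bar> < 1 then 1 / sqrt \<bar>y\<bar> else 0)"

lemma inv_sqrt_peak_nonneg [simp]: "inv_sqrt_peak y \<ge> 0"
  by (simp add: inv_sqrt_peak_def)

lemma borel_measurable_inv_sqrt_peak [measurable]: "inv_sqrt_peak \<in> borel_measurable borel"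
  unfolding inv_sqrt_peak_def by measurable

lemma integrable_inv_sqrt_peak: "integrable lborel inv_sqrt_peak"
proof -
  have "(\<lambda>x. x powr (- 1 / 2)) absolutely_integrable_on {0<..(1::real)}"
    by (intro nonnegative_absolutely_integrable_1 integrable_on_powr_from_0') auto
  hence "set_integrable lborel {0<..(1::real)} (\<lambda>x. x powr (- 1 / 2))"
    unfolding set_integrable_def by (subst (asm) integrable_completion) auto
  hence 1: "integrable lborel (\<lambda>x::real. indicator {0<..1} x *\<^sub>R (x powr (- 1 / 2)))" (is "integrable _ ?f")
    unfolding set_integrable_def .
  have 2: "integrable lborel (\<lambda>x. ?f (0 + (- 1) * x))"
    by (rule lborel_integrable_real_affine[OF 1]) simp
  show ?thesis
  proof (rule Bochner_Integration.integrable_bound[OF Bochner_Integration.integrable_add[OF 1 2]])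
    show "AE x in lborel. norm (inv_sqrt_peak x) \<le> norm (?f x + ?f (0 + (- 1) * x))"
    proof (rule AE_I2)
      fix x :: real
      have "y powr (- 1 / 2) = 1 / sqrt y" if "y > 0" for y :: real
        using that by (simp add: powr_minus_divide powr_half_sqrt)
      thus "norm (inv_sqrt_peak x) \<le> norm (?f x + ?f (0 + (- 1) * x))"
        by (cases x "0::real" rule: linorder_cases)
           (auto simp: inv_sqrt_peak_def indicator_def)
    qed
  qed simp
qed

text \<open>Up to factors, a majorant of |1 - x^2/s^2|^(-1/2): the peaks cover the singularities at
  s and -s, the constant 1 the rest.\<close>

definition two_peaks :: "real \<Rightarrow> real \<Rightarrow> real" where
  "two_peaks s x = 1 + inv_sqrt_peak (x - s) + inv_sqrt_peak (x + s)"

lemma two_peaks_nonneg [simp]: "two_peaks s x \<ge> 0"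
  by (simp add: two_peaks_def)

lemma borel_measurable_two_peaks [measurable]: "two_peaks s \<in> borel_measurable borel"
  unfolding two_peaks_def by measurable

text \<open>With D the distance from |x| to s, the quantity under the root is at least D/s, so
  everything reduces to sqrt(s/D). The first bound trades the growth in s for a factor 1 + |x|,
  which Gaussian moments absorb; it serves for small \<open>\<eta>\<close>. The second keeps sqrt s
  and gives decay as s -> 0, that is, for large \<open>\<eta>\<close>.\<close>

lemma inv_sqrt_quadratic_le_two_peaks:
  assumes s: "s > 0" and x: "x \<noteq> s" "x \<noteq> - s"
  shows "1 / sqrt \<bar>1 - x\<^sup>2 / s\<^sup>2\<bar> \<le> (1 + \<bar>x\<bar>) * two_peaks s x"
    and "1 / sqrt \<bar>1 - x\<^sup>2 / s\<^sup>2\<bar> \<le> sqrt s * two_peaks s x"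
proof -
  define y where "y = \<bar>x\<bar>"
  define D where "D = \<bar>s - y\<bar>"
  have D: "D > 0" using x by (auto simp: D_def y_def abs_if split: if_splits)
  have y: "y \<ge> 0" by (simp add: y_def)
  have peak: "1 + inv_sqrt_peak D \<le> two_peaks s x"
  proof (cases "x \<ge> 0")
    case True
    hence "inv_sqrt_peak D = inv_sqrt_peak (x - s)"
      by (simp add: D_def y_def inv_sqrt_peak_def abs_minus_commute)
    thus ?thesis by (simp add: two_peaks_def)
  next
    case False
    hence "inv_sqrt_peak D = inv_sqrt_peak (x + s)"
      by (simp add: D_def y_def inv_sqrt_peak_def add.commute)
    thus ?thesis by (simp add: two_peaks_def)
  qed
  have "1 - x\<^sup>2 / s\<^sup>2 = (s - y) * (s + y) / s\<^sup>2"
    using s by (simp add: y_def field_simps power2_eq_square)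
  hence eq: "\<bar>1 - x\<^sup>2 / s\<^sup>2\<bar> = D * (s + y) / s\<^sup>2"
    using s y by (simp add: abs_mult D_def)
  have ge: "\<bar>1 - x\<^sup>2 / s\<^sup>2\<bar> \<ge> D / s"
  proof -
    have "D / s = D * s / s\<^sup>2" using s by (simp add: power2_eq_square)
    also have "\<dots> \<le> D * (s + y) / s\<^sup>2" using D y by (intro divide_right_mono mult_left_mono) auto
    finally show ?thesis unfolding eq .
  qed
  have main: "1 / sqrt \<bar>1 - x\<^sup>2 / s\<^sup>2\<bar> \<le> sqrt s * (1 / sqrt D)"
  proof -
    have "1 / sqrt \<bar>1 - x\<^sup>2 / s\<^sup>2\<bar> \<le> 1 / sqrt (D / s)"
      using real_sqrt_le_mono[OF ge] D s by (intro frac_le) auto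
    also have "\<dots> = sqrt s * (1 / sqrt D)" by (simp add: real_sqrt_divide)
    finally show ?thesis .
  qed
  have Dle: "1 / sqrt D \<le> 1 + inv_sqrt_peak D"
  proof (cases "D < 1")
    case False
    hence "sqrt D \<ge> 1" by simp
    thus ?thesis using False D by (simp add: inv_sqrt_peak_def)
  qed (use D in \<open>simp add: inv_sqrt_peak_def\<close>)
  have "1 / sqrt \<bar>1 - x\<^sup>2 / s\<^sup>2\<bar> \<le> sqrt s * two_peaks s x"
    using main order_trans[OF Dle peak] s
    by (meson mult_left_mono order_trans real_sqrt_ge_zero less_imp_le)
  thus "1 / sqrt \<bar>1 - x\<^sup>2 / s\<^sup>2\<bar> \<le> sqrt s * two_peaks s x" .
  \<comment> \<open>Near a peak, s <= 1 + y; away from it, D >= 1 gives s <= y + D <= (1 + y)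
    D.\<close>
  have "sqrt s * (1 / sqrt D) \<le> (1 + y) * (1 + inv_sqrt_peak D)"
  proof (cases "D < 1")
    case True
    hence "s \<le> 1 + y" by (auto simp: D_def)
    hence "sqrt s \<le> sqrt (1 + y)" by simp
    also have "\<dots> \<le> 1 + y" using y by (intro real_le_lsqrt) (auto simp: power2_eq_square algebra_simps)
    finally show ?thesis using Dle y D by (intro mult_mono) auto
  next
    case False
    have "s \<le> y + D" by (auto simp: D_def)
    also have "\<dots> \<le> (1 + y) * D" using False y mult_right_mono[of 1 D y] by (simp add: algebra_simps)
    also have "\<dots> \<le> (1 + y)\<^sup>2 * D" using D y by (intro mult_right_mono) (auto simp: power2_eq_square algebra_simps)
    finally have "sqrt s \<le> (1 + y) * sqrt D"
      using y real_sqrt_le_mono[of s "(1 + y)\<^sup>2 * D"] by (simp add: real_sqrt_mult)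
    hence "sqrt s * (1 / sqrt D) \<le> 1 + y" using D by (simp add: field_simps)
    also have "\<dots> \<le> (1 + y) * (1 + inv_sqrt_peak D)" using y by (simp add: algebra_simps)
    finally show ?thesis .
  qed
  also have "\<dots> \<le> (1 + y) * two_peaks s x" using peak y by (intro mult_left_mono) auto
  finally show "1 / sqrt \<bar>1 - x\<^sup>2 / s\<^sup>2\<bar> \<le> (1 + \<bar>x\<bar>) * two_peaks s x"
    using main by (simp add: y_def)
qed

lemma power_over_fact_le_exp:
  assumes "x \<ge> (0::real)"
  shows "x ^ k / fact k \<le> exp x"
proof -
  have "(\<Sum>n\<in>{k}. x ^ n /\<^sub>R fact n) \<le> (\<Sum>n. x ^ n /\<^sub>R fact n)"
    by (rule sum_le_suminf[OF summable_exp_generic]) (use assms in auto)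
  thus ?thesis by (simp add: exp_def divide_inverse mult.commute)
qed

lemma std_normal_density_power_bounded:
  "std_normal_density x * \<bar>x\<bar> ^ k \<le> 1 + 2 ^ k * fact k"
proof -
  have d: "std_normal_density x \<le> exp (- x\<^sup>2 / 2)"
  proof -
    have "1 \<le> sqrt (2 * pi)" using pi_gt3 by simp
    hence "1 / sqrt (2 * pi) \<le> 1" by simp
    hence "1 / sqrt (2 * pi) * exp (- x\<^sup>2 / 2) \<le> 1 * exp (- x\<^sup>2 / 2)"
      by (intro mult_right_mono) auto
    thus ?thesis by (simp add: std_normal_density_def)
  qed
  have "(x\<^sup>2 / 2) ^ k / fact k \<le> exp (x\<^sup>2 / 2)"
    by (rule power_over_fact_le_exp) simp
  hence e: "\<bar>x\<bar> ^ (2 * k) * exp (- x\<^sup>2 / 2) \<le> 2 ^ k * fact k"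
    unfolding power_mult by (simp add: power_divide exp_minus field_simps)
  have p: "\<bar>x\<bar> ^ k \<le> 1 + \<bar>x\<bar> ^ (2 * k)"
  proof (cases "\<bar>x\<bar> \<le> 1")
    case True
    thus ?thesis using power_le_one[of "\<bar>x\<bar>" k] by (simp add: add_increasing2)
  next
    case False
    hence "\<bar>x\<bar> ^ k \<le> \<bar>x\<bar> ^ (2 * k)" by (intro power_increasing) auto
    thus ?thesis by linarith
  qed
  have "std_normal_density x * \<bar>x\<bar> ^ k \<le> exp (- x\<^sup>2 / 2) * (1 + \<bar>x\<bar> ^ (2 * k))"
    using d p by (intro mult_mono) auto
  also have "\<dots> = exp (- x\<^sup>2 / 2) + \<bar>x\<bar> ^ (2 * k) * exp (- x\<^sup>2 / 2)" by (simp add: algebra_simps)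
  also have "\<dots> \<le> 1 + 2 ^ k * fact k" using e by (intro add_mono) auto
  finally show ?thesis .
qed

text \<open>The weight is bounded by \<open>B\<close>, and the integral of a translated peak does
  not depend on the translation; hence one \<open>M\<close> serves all s.\<close>

lemma std_normal_moment_two_peaks:
  obtains M where "\<And>s. integrable lborel (\<lambda>x. std_normal_density x * \<bar>x\<bar> ^ k * two_peaks s x)"
    and "\<And>s. (\<integral>x. std_normal_density x * \<bar>x\<bar> ^ k * two_peaks s x \<partial>lborel) \<le> M"
proof -
  define B :: real where "B = 1 + 2 ^ k * fact k"
  define g where "g = (\<lambda>s x. std_normal_density x * \<bar>x\<bar> ^ k + (B * inv_sqrt_peak (- s + 1 * x) + B * inv_sqrt_peak (s + 1 * x)))"
  have i1: "integrable lborel (\<lambda>x. inv_sqrt_peak (t + 1 * x))" for t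
    by (rule lborel_integrable_real_affine[OF integrable_inv_sqrt_peak]) simp
  have i2: "(\<integral>x. inv_sqrt_peak (t + 1 * x) \<partial>lborel) = (\<integral>x. inv_sqrt_peak x \<partial>lborel)" for t
    using lborel_integral_real_affine[of 1 inv_sqrt_peak t] by simp
  have ig: "integrable lborel (g s)" for s
    unfolding g_def by (intro Bochner_Integration.integrable_add integrable_mult_right i1 integrable_std_normal_moment_abs)
  have Ig: "(\<integral>x. g s x \<partial>lborel) = (\<integral>x. std_normal_density x * \<bar>x\<bar> ^ k \<partial>lborel) + 2 * B * (\<integral>x. inv_sqrt_peak x \<partial>lborel)" for s
    unfolding g_def
    by (subst Bochner_Integration.integral_add Bochner_Integration.integral_add;
        (intro Bochner_Integration.integrable_add integrable_mult_right i1 integrable_std_normal_moment_abs)?)+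
       (simp only: integral_mult_right_zero i2)
  have le: "std_normal_density x * \<bar>x\<bar> ^ k * two_peaks s x \<le> g s x" for s x
  proof -
    have "std_normal_density x * \<bar>x\<bar> ^ k * (inv_sqrt_peak (x - s) + inv_sqrt_peak (x + s)) \<le>
        B * (inv_sqrt_peak (x - s) + inv_sqrt_peak (x + s))"
      unfolding B_def by (intro mult_right_mono std_normal_density_power_bounded) auto
    thus ?thesis by (simp add: g_def two_peaks_def algebra_simps)
  qed
  have int: "integrable lborel (\<lambda>x. std_normal_density x * \<bar>x\<bar> ^ k * two_peaks s x)" for s
  proof (rule Bochner_Integration.integrable_bound[OF ig[of s]])
    show "AE x in lborel. norm (std_normal_density x * \<bar>x\<bar> ^ k * two_peaks s x) \<le> norm (g s x)"
    proof (rule AE_I2)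
      fix x
      show "norm (std_normal_density x * \<bar>x\<bar> ^ k * two_peaks s x) \<le> norm (g s x)"
        using order_trans[OF le[of x s] abs_ge_self] by (simp add: abs_mult)
    qed
  qed measurable
  show ?thesis
  proof (rule that[OF int])
    fix s
    show "(\<integral>x. std_normal_density x * \<bar>x\<bar> ^ k * two_peaks s x \<partial>lborel) \<le>
       (\<integral>x. std_normal_density x * \<bar>x\<bar> ^ k \<partial>lborel) + 2 * B * (\<integral>x. inv_sqrt_peak x \<partial>lborel)"
      unfolding Ig[of s, symmetric] by (intro integral_mono int ig le)
  qed
qed

lemma norm_gbinomial_minus_half_le: "norm ((- 1 / 2 :: complex) gchoose k) \<le> 1"
proof (induction k)
  case (Suc k)
  have "of_nat (Suc k) * ((- 1 / 2 :: complex) gchoose Suc k) = (- 1 / 2 - of_nat k) * ((- 1 / 2) gchoose k)"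
    using gbinomial_mult_1[of "- 1 / 2 :: complex" k] by (simp add: algebra_simps)
  hence "real (Suc k) * norm ((- 1 / 2 :: complex) gchoose Suc k) = norm (- 1 / 2 - of_nat k :: complex) * norm ((- 1 / 2 :: complex) gchoose k)"
    by (metis norm_mult norm_of_nat)
  also have "norm (- 1 / 2 - of_nat k :: complex) = 1 / 2 + real k"
  proof -
    have "- 1 / 2 - of_nat k = (of_real (- (1 / 2 + real k)) :: complex)" by simp
    thus ?thesis by (simp only: norm_of_real)
  qed
  also have "(1 / 2 + real k) * norm ((- 1 / 2 :: complex) gchoose k) \<le> real (Suc k) * 1"
    using Suc by (intro mult_mono) auto
  finally show ?case by (simp del: of_nat_Suc)
qed simp

text \<open>A remainder estimate for all w, not only inside the disc of convergence. For |w| <= 1/2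
  the tail is geometric. Otherwise (2|w|)^J >= 1 dominates every Taylor term, and the function
  itself is kept on the right-hand side to account for its singularity at w = -1.\<close>

lemma inverse_csqrt_taylor_bound:
  fixes w :: complex
  shows "norm (1 / csqrt (1 + w) - (\<Sum>j<J. ((- 1 / 2) gchoose j) * w ^ j))
     \<le> 2 ^ J * (real J + 2) * norm w ^ J * (1 + norm (1 / csqrt (1 + w)))"
proof (cases "norm w \<le> 1 / 2")
  case True
  define a where "a = (\<lambda>j. ((- 1 / 2 :: complex) gchoose j) * w ^ j)"
  have "a sums ((1 + w) powr (- 1 / 2))"
    unfolding a_def by (rule gen_binomial_complex) (use True in simp)
  moreover have "(1 + w) powr (- 1 / 2) = 1 / csqrt (1 + w)"
    using powr_minus_divide[of "1 + w" "1 / 2"] by (simp add: csqrt_conv_powr)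
  ultimately have "a sums (1 / csqrt (1 + w))" by simp
  hence s: "(\<lambda>j. a (j + J)) sums (1 / csqrt (1 + w) - (\<Sum>j<J. a j))"
    by (rule sums_split_initial_segment)
  have geo: "(\<lambda>j. norm w ^ J * norm w ^ j) sums (norm w ^ J * (1 / (1 - norm w)))"
    by (intro sums_mult geometric_sums) (use True in simp)
  have "norm (a (j + J)) \<le> norm w ^ J * norm w ^ j" for j
  proof -
    have "norm (a (j + J)) = norm ((- 1 / 2 :: complex) gchoose (j + J)) * (norm w ^ J * norm w ^ j)"
      by (simp add: a_def norm_mult norm_power power_add mult.commute)
    also have "\<dots> \<le> 1 * (norm w ^ J * norm w ^ j)"
      by (intro mult_right_mono norm_gbinomial_minus_half_le) auto
    finally show ?thesis by simp
  qed
  hence "norm (\<Sum>j. a (j + J)) \<le> (\<Sum>j. norm w ^ J * norm w ^ j)"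
    by (intro norm_suminf_le sums_summable[OF geo])
  hence "norm (1 / csqrt (1 + w) - (\<Sum>j<J. a j)) \<le> norm w ^ J * (1 / (1 - norm w))"
    by (simp only: sums_unique[OF s, symmetric] sums_unique[OF geo, symmetric])
  also have "\<dots> \<le> norm w ^ J * 2"
    using True by (intro mult_left_mono) (auto simp: field_simps)
  also have "\<dots> \<le> norm w ^ J * (2 ^ J * (real J + 2))"
  proof (rule mult_left_mono)
    have "1 * 2 \<le> 2 ^ J * (real J + 2)" by (intro mult_mono) auto
    thus "2 \<le> 2 ^ J * (real J + 2)" by simp
  qed simp
  also have "\<dots> = 2 ^ J * (real J + 2) * norm w ^ J * 1" by (simp add: mult_ac)
  also have "\<dots> \<le> 2 ^ J * (real J + 2) * norm w ^ J * (1 + norm (1 / csqrt (1 + w)))"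
    by (intro mult_left_mono) auto
  finally show ?thesis by (simp add: a_def)
next
  case False
  have p: "norm w ^ j \<le> 2 ^ J * norm w ^ J" if "j \<le> J" for j
  proof -
    have "norm w ^ j \<le> (2 * norm w) ^ j" by (intro power_mono) auto
    also have "\<dots> \<le> (2 * norm w) ^ J" using False that by (intro power_increasing) auto
    finally show ?thesis by (simp add: power_mult_distrib)
  qed
  have "norm (\<Sum>j<J. ((- 1 / 2 :: complex) gchoose j) * w ^ j) \<le> (\<Sum>j<J. norm (((- 1 / 2 :: complex) gchoose j) * w ^ j))"
    by (rule norm_sum)
  also have "\<dots> \<le> (\<Sum>j<J. 2 ^ J * norm w ^ J)"
  proof (rule sum_mono)
    fix j assume "j \<in> {..<J}"
    have "norm (((- 1 / 2 :: complex) gchoose j) * w ^ j) \<le> 1 * norm w ^ j"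
      unfolding norm_mult norm_power by (intro mult_right_mono norm_gbinomial_minus_half_le) auto
    thus "norm (((- 1 / 2 :: complex) gchoose j) * w ^ j) \<le> 2 ^ J * norm w ^ J"
      using p[of j] \<open>j \<in> {..<J}\<close> by simp
  qed
  finally have 1: "norm (\<Sum>j<J. ((- 1 / 2 :: complex) gchoose j) * w ^ j) \<le> real J * (2 ^ J * norm w ^ J)" by simp
  define q where "q = norm (1 / csqrt (1 + w))"
  have q: "q \<ge> 0" by (simp add: q_def)
  define r where "r = 2 ^ J * norm w ^ J"
  have r: "r \<ge> 1" using p[of 0] by (simp add: r_def)
  have "norm (1 / csqrt (1 + w) - (\<Sum>j<J. ((- 1 / 2) gchoose j) * w ^ j)) \<le> q + real J * r"
    using norm_triangle_ineq4[of "1 / csqrt (1 + w)" "\<Sum>j<J. ((- 1 / 2) gchoose j) * w ^ j"] 1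
    by (simp add: q_def r_def)
  also have "\<dots> \<le> q * r + real J * r" using q r mult_left_mono[of 1 r q] by simp
  also have "\<dots> \<le> (q + real J) * r + (2 + real J * q + q) * r" using q r by (simp add: algebra_simps)
  also have "\<dots> = (real J + 2) * r * (1 + q)" by (simp add: algebra_simps)
  finally show ?thesis by (simp add: q_def r_def mult_ac)
qed

subsection \<open>The Gaussian transform off the real line\<close>

text \<open>For nonreal \<open>\<eta>\<close> the radicand never meets the branch cut of
  \<open>csqrt\<close>, so the principal root yields V on both half planes.\<close>

definition gauss_kernel :: "complex \<Rightarrow> real \<Rightarrow> complex" where
  "gauss_kernel \<eta> x = of_real (std_normal_density x) / csqrt (1 + \<eta> * of_real (x\<^sup>2))"

definition gauss_transform :: "complex \<Rightarrow> complex" where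
  "gauss_transform \<eta> = (LINT x|lborel. gauss_kernel \<eta> x)"

lemma one_plus_mult_square_not_nonpos:
  "Im \<eta> \<noteq> 0 \<Longrightarrow> 1 + \<eta> * of_real (x\<^sup>2) \<notin> \<real>\<^sub>\<le>\<^sub>0"
  by (cases "x = 0") (auto simp: complex_nonpos_Reals_iff)

lemma continuous_gauss_kernel:
  assumes "Im \<eta> \<noteq> 0"
  shows "continuous_on UNIV (gauss_kernel \<eta>)"
proof -
  have "csqrt (1 + \<eta> * of_real (x\<^sup>2)) \<noteq> 0" for x
    using one_plus_mult_square_not_nonpos[OF assms, of x] by (auto simp del: of_real_power)
  moreover have "continuous_on UNIV (\<lambda>x. csqrt (1 + \<eta> * of_real (x\<^sup>2)))"
    by (rule continuous_on_compose2[OF continuous_on_csqrt])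
       (use one_plus_mult_square_not_nonpos[OF assms] in \<open>auto intro!: continuous_intros\<close>)
  ultimately show ?thesis
    unfolding gauss_kernel_def std_normal_density_def
    by (intro continuous_intros) auto
qed

lemma borel_measurable_gauss_kernel:
  "Im \<eta> \<noteq> 0 \<Longrightarrow> gauss_kernel \<eta> \<in> borel_measurable lborel"
  using borel_measurable_continuous_onI[OF continuous_gauss_kernel] by simp

text \<open>By the reverse triangle inequality |1 + \<eta> x^2| is at least |1 - |\<eta>| x^2|. Only
  the modulus of \<open>\<eta>\<close> enters, so the estimate is uniform up to the cut; s marks
  where the worst case becomes singular.\<close>

lemma norm_inverse_csqrt_le:
  assumes "s > 0" "norm \<eta> = 1 / s\<^sup>2" "x \<noteq> s" "x \<noteq> - s"
  shows "norm (1 / csqrt (1 + \<eta> * of_real (x\<^sup>2))) \<le> 1 / sqrt \<bar>1 - x\<^sup>2 / s\<^sup>2\<bar>"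
proof -
  have "\<bar>norm (1 :: complex) - norm (- (\<eta> * of_real (x\<^sup>2)))\<bar> \<le> norm (1 - (- (\<eta> * of_real (x\<^sup>2))))"
    by (rule norm_triangle_ineq3)
  hence "\<bar>1 - x\<^sup>2 / s\<^sup>2\<bar> \<le> norm (1 + \<eta> * of_real (x\<^sup>2))"
    using assms(2) by (simp add: norm_mult norm_power)
  moreover have "\<bar>1 - x\<^sup>2 / s\<^sup>2\<bar> > 0"
  proof -
    have "x\<^sup>2 \<noteq> s\<^sup>2" using assms by (simp add: power2_eq_iff)
    thus ?thesis using assms(1) by (simp add: field_simps)
  qed
  ultimately have "1 / sqrt (norm (1 + \<eta> * of_real (x\<^sup>2))) \<le> 1 / sqrt \<bar>1 - x\<^sup>2 / s\<^sup>2\<bar>"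
    by (intro frac_le) auto
  thus ?thesis by (simp add: norm_divide)
qed

lemma AE_lborel_neq2: "AE x in lborel. x \<noteq> s \<and> x \<noteq> (t::real)"
  using AE_lborel_singleton[of s] AE_lborel_singleton[of t] by eventually_elim auto

lemma norm_gauss_kernel:
  "norm (gauss_kernel \<eta> x) = std_normal_density x * norm (1 / csqrt (1 + \<eta> * of_real (x\<^sup>2)))"
  by (simp add: gauss_kernel_def norm_divide)

text \<open>For \<eta> = 1/(4z) the parameter is s = 2 sqrt |z|. The plain bound governs large z;
  the bound by sqrt s makes V of order |z|^(1/4) near z = 0, enough to keep the 1/z prefactor of the
  product integrable there.\<close>

lemma gauss_transform_bounds:
  obtains M where "M \<ge> 0"
    and "\<And>\<eta>. Im \<eta> \<noteq> 0 \<Longrightarrow> integrable lborel (gauss_kernel \<eta>)"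
    and "\<And>\<eta>. Im \<eta> \<noteq> 0 \<Longrightarrow> norm (gauss_transform \<eta>) \<le> M"
    and "\<And>\<eta> s. Im \<eta> \<noteq> 0 \<Longrightarrow> s > 0 \<Longrightarrow> norm \<eta> = 1 / s\<^sup>2 \<Longrightarrow> norm (gauss_transform \<eta>) \<le> M * sqrt s"
proof -
  from std_normal_moment_two_peaks[of 0] obtain M0 where
    M0: "\<And>s. integrable lborel (\<lambda>x. std_normal_density x * \<bar>x\<bar> ^ 0 * two_peaks s x)"
    "\<And>s. (\<integral>x. std_normal_density x * \<bar>x\<bar> ^ 0 * two_peaks s x \<partial>lborel) \<le> M0" by blast
  from std_normal_moment_two_peaks[of 1] obtain M1 where
    M1: "\<And>s. integrable lborel (\<lambda>x. std_normal_density x * \<bar>x\<bar> ^ 1 * two_peaks s x)"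
    "\<And>s. (\<integral>x. std_normal_density x * \<bar>x\<bar> ^ 1 * two_peaks s x \<partial>lborel) \<le> M1" by blast
  have nn: "M0 \<ge> 0" "M1 \<ge> 0"
    by (rule order_trans[OF _ M0(2)[of 0]] order_trans[OF _ M1(2)[of 0]]; intro integral_nonneg_AE AE_I2; simp)+
  have main: "integrable lborel (gauss_kernel \<eta>) \<and> norm (gauss_transform \<eta>) \<le> M0 + M1 \<and> norm (gauss_transform \<eta>) \<le> M0 * sqrt s"
    if \<eta>: "Im \<eta> \<noteq> 0" "s > 0" "norm \<eta> = 1 / s\<^sup>2" for \<eta> s
  proof -
    have b1: "AE x in lborel. norm (gauss_kernel \<eta> x) \<le> std_normal_density x * \<bar>x\<bar> ^ 0 * two_peaks s x + std_normal_density x * \<bar>x\<bar> ^ 1 * two_peaks s x"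
      using AE_lborel_neq2[of s "-s"]
    proof eventually_elim
      case (elim x)
      hence "norm (gauss_kernel \<eta> x) \<le> std_normal_density x * ((1 + \<bar>x\<bar>) * two_peaks s x)"
        unfolding norm_gauss_kernel using \<eta>
        by (intro mult_left_mono order_trans[OF norm_inverse_csqrt_le inv_sqrt_quadratic_le_two_peaks(1)]) auto
      thus ?case by (simp add: algebra_simps)
    qed
    have b2: "AE x in lborel. norm (gauss_kernel \<eta> x) \<le> sqrt s * (std_normal_density x * \<bar>x\<bar> ^ 0 * two_peaks s x)"
      using AE_lborel_neq2[of s "-s"]
    proof eventually_elim
      case (elim x)
      hence "norm (gauss_kernel \<eta> x) \<le> std_normal_density x * (sqrt s * two_peaks s x)"
        unfolding norm_gauss_kernel using \<eta>
        by (intro mult_left_mono order_trans[OF norm_inverse_csqrt_le inv_sqrt_quadratic_le_two_peaks(2)]) auto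
      thus ?case by (simp add: algebra_simps)
    qed
    note m = borel_measurable_gauss_kernel[OF \<eta>(1)]
    note 1 = norm_integral_le_AE[OF m Bochner_Integration.integrable_add[OF M0(1) M1(1)] b1]
    note 2 = norm_integral_le_AE[OF m integrable_mult_right[OF M0(1)] b2]
    have "norm (gauss_transform \<eta>) \<le> M0 + M1"
      using 1(2) M0(2)[of s] M1(2)[of s] Bochner_Integration.integral_add[OF M0(1)[of s] M1(1)[of s]]
      by (simp add: gauss_transform_def)
    moreover have "norm (gauss_transform \<eta>) \<le> M0 * sqrt s"
    proof -
      have "norm (gauss_transform \<eta>) \<le> sqrt s * (\<integral>x. std_normal_density x * \<bar>x\<bar> ^ 0 * two_peaks s x \<partial>lborel)"
        using 2(2) by (simp only: gauss_transform_def integral_mult_right_zero)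
      also have "\<dots> \<le> sqrt s * M0" using M0(2)[of s] \<eta> by (intro mult_left_mono) auto
      finally show ?thesis by (simp only: mult.commute)
    qed
    ultimately show ?thesis using 1(1) by blast
  qed
  have s: "1 / sqrt (norm \<eta>) > 0 \<and> norm \<eta> = 1 / (1 / sqrt (norm \<eta>))\<^sup>2" if "Im \<eta> \<noteq> 0" for \<eta>
    using that by (auto simp: power_divide)
  show ?thesis
  proof (rule that[of "M0 + M1"])
    fix \<eta> :: complex assume \<eta>: "Im \<eta> \<noteq> 0"
    show "integrable lborel (gauss_kernel \<eta>)" "norm (gauss_transform \<eta>) \<le> M0 + M1"
      using main[OF \<eta>] s[OF \<eta>] by blast+
    fix s :: real assume s: "s > 0" "norm \<eta> = 1 / s\<^sup>2"
    have "norm (gauss_transform \<eta>) \<le> M0 * sqrt s" using main[OF \<eta> s] by blast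
    also have "\<dots> \<le> (M0 + M1) * sqrt s" using nn s by (intro mult_right_mono) auto
    finally show "norm (gauss_transform \<eta>) \<le> (M0 + M1) * sqrt s" .
  qed (use nn in simp)
qed

lemma integrable_gauss_kernel: "Im \<eta> \<noteq> 0 \<Longrightarrow> integrable lborel (gauss_kernel \<eta>)"
  using gauss_transform_bounds by metis

text \<open>Integrate the global Taylor remainder of order J against the Gaussian. The moment 2J
  comes from (x^2)^J, and the moment 2J + 1 pays for the factor 1 + |x| in the bound for the
  singular term. The constant is independent of the argument of \<open>\<eta>\<close>.\<close>

lemma gauss_transform_asymptotics:
  obtains C where "\<And>\<eta>. Im \<eta> \<noteq> 0 \<Longrightarrow> norm (gauss_transform \<eta> - (\<Sum>j<J. K0_coeff j * \<eta> ^ j)) \<le> C * norm \<eta> ^ J"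
proof -
  from std_normal_moment_two_peaks[of "2 * J"] obtain M0 where
    M0: "\<And>s. integrable lborel (\<lambda>x. std_normal_density x * \<bar>x\<bar> ^ (2 * J) * two_peaks s x)"
    "\<And>s. (\<integral>x. std_normal_density x * \<bar>x\<bar> ^ (2 * J) * two_peaks s x \<partial>lborel) \<le> M0" by blast
  from std_normal_moment_two_peaks[of "2 * J + 1"] obtain M1 where
    M1: "\<And>s. integrable lborel (\<lambda>x. std_normal_density x * \<bar>x\<bar> ^ (2 * J + 1) * two_peaks s x)"
    "\<And>s. (\<integral>x. std_normal_density x * \<bar>x\<bar> ^ (2 * J + 1) * two_peaks s x \<partial>lborel) \<le> M1" by blast
  define M where "M = (\<integral>x. std_normal_density x * \<bar>x\<bar> ^ (2 * J) \<partial>lborel)"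
  note iM = integrable_std_normal_moment_abs[of "2 * J"]
  define K :: real where "K = 2 ^ J * (real J + 2)"
  have K: "K \<ge> 0" by (simp add: K_def)
  define c where "c = (\<lambda>j. (- 1 / 2 :: complex) gchoose j)"
  \<comment> \<open>The even moments of the normal law turn the binomials \<open>c j\<close> into
    \<open>K0_coeff j\<close>.\<close>
  have mom: "has_bochner_integral lborel (\<lambda>x. \<Sum>j<J. of_real (std_normal_density x * x ^ (2 * j)) * (c j * \<eta> ^ j)) (\<Sum>j<J. K0_coeff j * \<eta> ^ j)" for \<eta>
  proof -
    have "has_bochner_integral lborel (\<lambda>x. of_real (std_normal_density x * x ^ (2 * j)) * (c j * \<eta> ^ j))
       (of_real (fact (2 * j) / (2 ^ j * fact j)) * (c j * \<eta> ^ j))" for j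
      by (intro has_bochner_integral_mult_left has_bochner_integral_of_real std_normal_moment_even)
    hence "has_bochner_integral lborel (\<lambda>x. \<Sum>j<J. of_real (std_normal_density x * x ^ (2 * j)) * (c j * \<eta> ^ j))
        (\<Sum>j<J. of_real (fact (2 * j) / (2 ^ j * fact j)) * (c j * \<eta> ^ j))"
      by (intro has_bochner_integral_sum)
    thus ?thesis by (simp add: K0_coeff_def c_def mult_ac)
  qed
  note mom1 = conjunct1[OF iffD1[OF has_bochner_integral_iff mom]]
  show ?thesis
  proof (rule that[of "K * (M + (M0 + M1))"])
    fix \<eta> :: complex assume \<eta>: "Im \<eta> \<noteq> 0"
    define s where "s = 1 / sqrt (norm \<eta>)"
    have s: "s > 0" "norm \<eta> = 1 / s\<^sup>2" using \<eta> by (auto simp: s_def power_divide)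
    define f where "f = (\<lambda>x. gauss_kernel \<eta> x - (\<Sum>j<J. of_real (std_normal_density x * x ^ (2 * j)) * (c j * \<eta> ^ j)))"
    have f: "f = (\<lambda>x. of_real (std_normal_density x) * (1 / csqrt (1 + \<eta> * of_real (x\<^sup>2)) - (\<Sum>j<J. c j * (\<eta> * of_real (x\<^sup>2)) ^ j)))"
    proof -
      have "(\<eta> * of_real (x\<^sup>2)) ^ j = of_real (x ^ (2 * j)) * \<eta> ^ j" for x j
        by (simp add: power_mult_distrib mult.commute flip: power_mult)
      thus ?thesis
        unfolding f_def gauss_kernel_def by (simp add: sum_distrib_left right_diff_distrib mult_ac del: of_real_power)
    qed
    have int_f: "integrable lborel f"
      unfolding f_def by (intro Bochner_Integration.integrable_diff integrable_gauss_kernel[OF \<eta>] mom1)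
    have If: "integral\<^sup>L lborel f = gauss_transform \<eta> - (\<Sum>j<J. K0_coeff j * \<eta> ^ j)"
      unfolding f_def gauss_transform_def Bochner_Integration.integral_diff[OF integrable_gauss_kernel[OF \<eta>] mom1]
        has_bochner_integral_integral_eq[OF mom] ..
    define g where "g = (\<lambda>x. K * norm \<eta> ^ J * (std_normal_density x * \<bar>x\<bar> ^ (2 * J) +
        (std_normal_density x * \<bar>x\<bar> ^ (2 * J) * two_peaks s x + std_normal_density x * \<bar>x\<bar> ^ (2 * J + 1) * two_peaks s x)))"
    have ig: "integrable lborel g"
      unfolding g_def by (intro integrable_mult_right Bochner_Integration.integrable_add iM M0(1) M1(1))
    have Ig: "integral\<^sup>L lborel g = K * norm \<eta> ^ J * (M + ((\<integral>x. std_normal_density x * \<bar>x\<bar> ^ (2 * J) * two_peaks s x \<partial>lborel)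
        + (\<integral>x. std_normal_density x * \<bar>x\<bar> ^ (2 * J + 1) * two_peaks s x \<partial>lborel)))"
      unfolding g_def M_def integral_mult_right_zero
      by (simp only: Bochner_Integration.integral_add iM M0(1) M1(1) Bochner_Integration.integrable_add)
    have "AE x in lborel. norm (f x) \<le> g x"
      using AE_lborel_neq2[of s "-s"]
    proof eventually_elim
      case (elim x)
      have q: "norm (1 / csqrt (1 + \<eta> * of_real (x\<^sup>2))) \<le> (1 + \<bar>x\<bar>) * two_peaks s x"
        using elim s by (intro order_trans[OF norm_inverse_csqrt_le inv_sqrt_quadratic_le_two_peaks(1)]) auto
      have "norm (f x) = std_normal_density x * norm (1 / csqrt (1 + \<eta> * of_real (x\<^sup>2)) - (\<Sum>j<J. c j * (\<eta> * of_real (x\<^sup>2)) ^ j))"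
        unfolding f norm_mult by simp
      also have "\<dots> \<le> std_normal_density x * (K * norm (\<eta> * of_real (x\<^sup>2)) ^ J * (1 + norm (1 / csqrt (1 + \<eta> * of_real (x\<^sup>2)))))"
        unfolding c_def K_def by (intro mult_left_mono inverse_csqrt_taylor_bound) auto
      also have "\<dots> \<le> std_normal_density x * (K * norm (\<eta> * of_real (x\<^sup>2)) ^ J * (1 + (1 + \<bar>x\<bar>) * two_peaks s x))"
        using q K by (intro mult_left_mono add_left_mono mult_nonneg_nonneg) auto
      also have "norm (\<eta> * of_real (x\<^sup>2)) ^ J = norm \<eta> ^ J * \<bar>x\<bar> ^ (2 * J)"
        by (simp add: norm_mult power_mult_distrib power_mult norm_power)
      finally show ?case by (simp add: g_def algebra_simps)
    qed
    from norm_integral_le_AE(2)[OF borel_measurable_integrable[OF int_f] ig this]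
    have "norm (gauss_transform \<eta> - (\<Sum>j<J. K0_coeff j * \<eta> ^ j)) \<le> integral\<^sup>L lborel g"
      by (simp only: If)
    also have "\<dots> \<le> K * norm \<eta> ^ J * (M + (M0 + M1))"
      unfolding Ig using M0(2)[of s] M1(2)[of s] K by (intro mult_left_mono add_left_mono add_mono) auto
    finally show "norm (gauss_transform \<eta> - (\<Sum>j<J. K0_coeff j * \<eta> ^ j)) \<le> K * (M + (M0 + M1)) * norm \<eta> ^ J"
      by (simp only: mult_ac)
  qed
qed

text \<open>The right-hand side is the distance from 0 to the line of points 1 + \<eta> r;
  multiplying by \<open>cnj \<eta>\<close> makes the imaginary part constant along it.\<close>

lemma norm_one_plus_mult_real_ge:
  "norm (1 + \<eta> * of_real r) \<ge> \<bar>Im \<eta>\<bar> / norm \<eta>"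
proof (cases "\<eta> = 0")
  case False
  have "\<bar>Im \<eta>\<bar> = \<bar>Im (cnj \<eta> * (1 + \<eta> * of_real r))\<bar>" by (simp add: algebra_simps)
  also have "\<dots> \<le> norm (cnj \<eta> * (1 + \<eta> * of_real r))" by (rule abs_Im_le_cmod)
  also have "\<dots> = norm \<eta> * norm (1 + \<eta> * of_real r)" by (simp add: norm_mult)
  finally show ?thesis using False by (simp add: field_simps)
qed simp

text \<open>The integrals over [-n, n] are holomorphic by differentiation under the integral sign,
  and they converge locally uniformly because off the real line the kernel is bounded by a constant
  times the density.\<close>

lemma holomorphic_on_gauss_transform:
  assumes S: "open S" "convex S" "S \<subseteq> {\<eta>. Im \<eta> \<noteq> 0}"
  shows "gauss_transform holomorphic_on S"
proof -
  define f where "f = (\<lambda>n::nat. \<lambda>\<eta>. integral (cbox (- real n) (real n)) (gauss_kernel \<eta>))"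
  have f_eq: "f n \<eta> = (LINT x:{- real n..real n}|lborel. gauss_kernel \<eta> x)" if "Im \<eta> \<noteq> 0" for n \<eta>
    unfolding f_def
    by (subst set_borel_integral_eq_integral(2))
       (auto intro!: borel_integrable_atLeastAtMost' continuous_on_subset[OF continuous_gauss_kernel[OF that]])
  define e where "e = (\<lambda>n::nat. (\<integral>x. indicator (- {- real n..real n}) x * std_normal_density x \<partial>lborel))"
  have e: "e \<longlonglongrightarrow> (\<integral>x. 0 \<partial>(lborel :: real measure))"
    unfolding e_def
  proof (rule integral_dominated_convergence[where w = std_normal_density])
    show "AE x in lborel. (\<lambda>n. indicator (- {- real n..real n}) x * std_normal_density x) \<longlonglongrightarrow> 0"
    proof (rule AE_I2)
      fix x :: real
      obtain N where N: "real N > \<bar>x\<bar>" using reals_Archimedean2 by blast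
      show "(\<lambda>n. indicator (- {- real n..real n}) x * std_normal_density x) \<longlonglongrightarrow> 0"
        by (rule tendsto_eventually, rule eventually_sequentiallyI[of N])
           (use N in \<open>auto simp: indicator_def\<close>)
    qed
  qed (auto simp: indicator_def)
  show ?thesis
  proof (rule holomorphic_uniform_sequence[OF S(1), of f])
    fix n
    define h' where "h' = (\<lambda>\<eta> x. - (of_real (std_normal_density x) * (of_real (x\<^sup>2) * inverse (2 * csqrt (1 + \<eta> * of_real (x\<^sup>2))))) /
        (csqrt (1 + \<eta> * of_real (x\<^sup>2)) * csqrt (1 + \<eta> * of_real (x\<^sup>2))))"
    show "f n holomorphic_on S"
      unfolding f_def
    proof (rule leibniz_rule_holomorphic[where fx = h'])
      fix \<eta> x assume "\<eta> \<in> S"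
      hence nz: "1 + \<eta> * of_real (x\<^sup>2) \<notin> \<real>\<^sub>\<le>\<^sub>0" using S(3) one_plus_mult_square_not_nonpos by blast
      have 1: "((\<lambda>\<eta>. csqrt (1 + \<eta> * of_real (x\<^sup>2))) has_field_derivative inverse (2 * csqrt (1 + \<eta> * of_real (x\<^sup>2))) * of_real (x\<^sup>2)) (at \<eta> within S)"
        by (rule DERIV_chain2[where f = csqrt and g = "\<lambda>\<eta>. 1 + \<eta> * of_real (x\<^sup>2)" and x = \<eta>, OF has_field_derivative_csqrt[OF nz]])
           (auto intro!: derivative_eq_intros)
      have 2: "csqrt (1 + \<eta> * of_real (x\<^sup>2)) \<noteq> 0" using nz by (auto simp del: of_real_power)
      show "((\<lambda>\<eta>. gauss_kernel \<eta> x) has_field_derivative h' \<eta> x) (at \<eta> within S)"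
        unfolding gauss_kernel_def h'_def
        by (rule DERIV_cong[OF DERIV_divide[OF DERIV_const 1 2]]) (simp add: mult_ac)
    next
      fix \<eta> assume "\<eta> \<in> S"
      thus "gauss_kernel \<eta> integrable_on cbox (- real n) (real n)"
        using S(3) by (intro integrable_continuous continuous_on_subset[OF continuous_gauss_kernel]) auto
    next
      have "continuous_on (S \<times> cbox (- real n) (real n)) (\<lambda>z. csqrt (1 + fst z * of_real ((snd z)\<^sup>2)))"
        by (rule continuous_on_compose2[OF continuous_on_csqrt])
           (use S(3) one_plus_mult_square_not_nonpos in \<open>auto intro!: continuous_intros simp del: of_real_power\<close>)
      moreover have "csqrt (1 + fst z * of_real ((snd z)\<^sup>2)) \<noteq> 0" if "z \<in> S \<times> cbox (- real n) (real n)" for z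
        using that S(3) one_plus_mult_square_not_nonpos[of "fst z" "snd z"] by (auto simp del: of_real_power)
      ultimately show "continuous_on (S \<times> cbox (- real n) (real n)) (\<lambda>(\<eta>, x). h' \<eta> x)"
        unfolding h'_def case_prod_unfold std_normal_density_def
        by (intro continuous_intros) auto
    qed (rule S(2))
  next
    fix \<eta>0 assume "\<eta>0 \<in> S"
    then obtain d where d: "d > 0" "cball \<eta>0 d \<subseteq> S"
      using S(1) open_contains_cball by blast
    have nr: "Im \<eta> \<noteq> 0" if "\<eta> \<in> cball \<eta>0 d" for \<eta> using that d(2) S(3) by blast
    have "norm \<eta> \<noteq> 0" if "\<eta> \<in> cball \<eta>0 d" for \<eta> using nr[OF that] by auto
    hence "continuous_on (cball \<eta>0 d) (\<lambda>\<eta>. \<bar>Im \<eta>\<bar> / norm \<eta>)"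
      by (intro continuous_intros) blast
    \<comment> \<open>The minimum over the compact ball is positive and gives a common lower bound
      \<open>m\<close> for |1 + \<eta> x^2|; the truncation error is then at most the Gaussian tail
      \<open>e n\<close> over sqrt m.\<close>
    then obtain \<eta>1 where \<eta>1: "\<eta>1 \<in> cball \<eta>0 d" "\<And>\<eta>. \<eta> \<in> cball \<eta>0 d \<Longrightarrow> \<bar>Im \<eta>1\<bar> / norm \<eta>1 \<le> \<bar>Im \<eta>\<bar> / norm \<eta>"
      using continuous_attains_inf[of "cball \<eta>0 d" "\<lambda>\<eta>. \<bar>Im \<eta>\<bar> / norm \<eta>"] d(1) by auto
    define m where "m = \<bar>Im \<eta>1\<bar> / norm \<eta>1"
    have "\<eta>1 \<noteq> 0" using nr[OF \<eta>1(1)] by auto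
    hence m: "m > 0" using nr[OF \<eta>1(1)] by (simp add: m_def)
    have bd: "norm (f n \<eta> - gauss_transform \<eta>) \<le> 1 / sqrt m * e n" if \<eta>: "\<eta> \<in> cball \<eta>0 d" for n \<eta>
    proof -
      have ik: "integrable lborel (gauss_kernel \<eta>)" by (rule integrable_gauss_kernel[OF nr[OF \<eta>]])
      have iu: "integrable lborel (\<lambda>x. indicator {- real n..real n} x *\<^sub>R gauss_kernel \<eta> x)"
        by (rule integrable_mult_indicator[OF _ ik]) simp
      have "gauss_transform \<eta> - f n \<eta> = (\<integral>x. gauss_kernel \<eta> x - indicator {- real n..real n} x *\<^sub>R gauss_kernel \<eta> x \<partial>lborel)"
        unfolding f_eq[OF nr[OF \<eta>]] gauss_transform_def set_lebesgue_integral_def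
        by (rule Bochner_Integration.integral_diff[OF ik iu, symmetric])
      also have "norm \<dots> \<le> (\<integral>x. 1 / sqrt m * (indicator (- {- real n..real n}) x * std_normal_density x) \<partial>lborel)"
      proof (rule norm_integral_le_AE(2))
        show "integrable lborel (\<lambda>x. 1 / sqrt m * (indicator (- {- real n..real n}) x * std_normal_density x))"
          using integrable_mult_indicator[of "- {- real n..real n}" lborel std_normal_density]
          by (intro integrable_mult_right) simp
        show "AE x in lborel. norm (gauss_kernel \<eta> x - indicator {- real n..real n} x *\<^sub>R gauss_kernel \<eta> x) \<le>
           1 / sqrt m * (indicator (- {- real n..real n}) x * std_normal_density x)"
        proof (rule AE_I2)
          fix x :: real
          have "m \<le> norm (1 + \<eta> * of_real (x\<^sup>2))"
            unfolding m_def by (rule order_trans[OF \<eta>1(2)[OF \<eta>] norm_one_plus_mult_real_ge])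
          hence "1 / sqrt (norm (1 + \<eta> * of_real (x\<^sup>2))) \<le> 1 / sqrt m"
            using m by (intro frac_le) auto
          hence "norm (1 / csqrt (1 + \<eta> * of_real (x\<^sup>2))) \<le> 1 / sqrt m"
            by (simp add: norm_divide)
          hence "norm (gauss_kernel \<eta> x) \<le> std_normal_density x * (1 / sqrt m)"
            unfolding norm_gauss_kernel by (intro mult_left_mono) auto
          thus "norm (gauss_kernel \<eta> x - indicator {- real n..real n} x *\<^sub>R gauss_kernel \<eta> x) \<le>
           1 / sqrt m * (indicator (- {- real n..real n}) x * std_normal_density x)"
            by (simp add: indicator_def mult.commute)
        qed
      qed (use ik iu in measurable)
      finally show ?thesis unfolding e_def integral_mult_right_zero by (simp only: norm_minus_commute)
    qed
    have lim: "(\<lambda>n. 1 / sqrt m * e n) \<longlonglongrightarrow> 0"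
      using tendsto_mult_right_zero[OF e[simplified], of "1 / sqrt m"] .
    have "uniform_limit (cball \<eta>0 d) f gauss_transform sequentially"
    proof (rule uniform_limitI)
      fix r :: real assume "r > 0"
      from order_tendstoD(2)[OF lim this]
      show "\<forall>\<^sub>F n in sequentially. \<forall>\<eta>\<in>cball \<eta>0 d. dist (f n \<eta>) (gauss_transform \<eta>) < r"
        by eventually_elim (simp add: dist_norm le_less_trans[OF bd])
    qed
    thus "\<exists>d>0. cball \<eta>0 d \<subseteq> S \<and> uniform_limit (cball \<eta>0 d) f gauss_transform sequentially"
      using d by blast
  qed
qed

subsection \<open>Boundary values of the Gaussian transform\<close>

lemma set_integrable_exp_minus_cosh:
  fixes t :: real
  assumes "t > 0"
  shows "set_integrable lborel {0<..} (\<lambda>u. exp (- t * cosh u))"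
proof -
  have "(\<lambda>u::real. exp (- (t / 2) * u)) absolutely_integrable_on {0..}"
    by (intro nonnegative_absolutely_integrable_1 integrable_on_exp_minus_to_infinity) (use assms in auto)
  hence "set_integrable lborel {0..} (\<lambda>u::real. exp (- (t / 2) * u))"
    unfolding set_integrable_def by (subst (asm) integrable_completion) auto
  hence "set_integrable lborel {0<..} (\<lambda>u::real. exp (- (t / 2) * u))"
    by (rule set_integrable_subset) auto
  hence "integrable lborel (\<lambda>u::real. indicator {0<..} u *\<^sub>R exp (- (t / 2) * u))"
    unfolding set_integrable_def .
  thus ?thesis unfolding set_integrable_def
  proof (rule Bochner_Integration.integrable_bound)
    show "AE u in lborel. norm (indicator {0<..} u *\<^sub>R exp (- t * cosh u)) \<le> norm (indicator {0<..} u *\<^sub>R exp (- (t / 2) * u))"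
    proof (rule AE_I2)
      fix u :: real
      have "t * cosh u \<ge> t / 2 * u" if "u > 0"
      proof -
        have "exp u / 2 \<le> cosh u" by (simp add: cosh_field_def)
        hence "u / 2 \<le> cosh u" using exp_ge_add_one_self[of u] by linarith
        from mult_left_mono[OF this, of t] show ?thesis using assms by simp
      qed
      thus "norm (indicator {0<..} u *\<^sub>R exp (- t * cosh u)) \<le> norm (indicator {0<..} u *\<^sub>R exp (- (t / 2) * u))"
        by (auto simp: indicator_def)
    qed
  qed (simp add: cosh_def)
qed

text \<open>Put x = 2 sqrt t sinh(u/2). The root becomes cosh(u/2) and cancels against dx, while
  x^2/2 = t (cosh u - 1).\<close>

lemma gauss_K0_substitution:
  assumes t: "t > 0"
  shows "set_integrable lborel {0<..} (\<lambda>x. std_normal_density x / sqrt (1 + x\<^sup>2 / (4 * t)))"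
    and "(LINT x:{0<..}|lborel. std_normal_density x / sqrt (1 + x\<^sup>2 / (4 * t))) = sqrt (t / (2 * pi)) * exp t * bessel_K0 t"
proof -
  define f where "f = (\<lambda>x. std_normal_density x / sqrt (1 + x\<^sup>2 / (4 * t)))"
  define g where "g = (\<lambda>u. 2 * sqrt t * sinh (u / 2))"
  define g' where "g' = (\<lambda>u. sqrt t * cosh (u / 2))"
  have fg: "f (g u) * g' u = sqrt (t / (2 * pi)) * exp t * exp (- t * cosh u)" for u
  proof -
    have "(g u)\<^sup>2 = 4 * t * (sinh (u / 2))\<^sup>2" using t by (simp add: g_def power_mult_distrib)
    moreover have "cosh u = 2 * (sinh (u / 2))\<^sup>2 + 1"
      using cosh_double_cosh[of "u / 2"] by (simp add: cosh_square_eq)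
    ultimately have 1: "(g u)\<^sup>2 / (4 * t) = (sinh (u / 2))\<^sup>2" and 2: "- (g u)\<^sup>2 / 2 = t + (- t * cosh u)"
      using t by (simp_all add: algebra_simps)
    have 3: "sqrt (1 + (sinh (u / 2))\<^sup>2) = cosh (u / 2)"
      using real_sqrt_unique[of "cosh (u / 2)"] by (simp add: cosh_square_eq add.commute)
    show ?thesis
      unfolding f_def 1 3 std_normal_density_def 2 exp_add g'_def
      using t by (simp add: real_sqrt_divide real_sqrt_mult)
  qed
  have pos: "1 + x\<^sup>2 / (4 * t) > 0" for x using t by (simp add: add_pos_nonneg)
  have fnn: "f (g u) \<ge> 0" if "0 < u" for u
    using pos[of "g u"] by (simp add: f_def)
  have cont: "isCont f (g u)" if "0 < u" for u
    using pos[of "g u"] unfolding f_def std_normal_density_def by (intro continuous_intros) (use t in auto)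
  have g'nn: "g' u \<ge> 0" if "0 \<le> u" for u
    unfolding g'_def using t by (intro mult_nonneg_nonneg) auto
  have int: "set_integrable lborel (einterval (ereal 0) \<infinity>) (\<lambda>u. f (g u) * g' u)"
    unfolding fg using set_integrable_exp_minus_cosh[OF t] by (simp add: set_integrable_mult_right)
  have lim1: "((ereal \<circ> g \<circ> real_of_ereal) \<longlongrightarrow> ereal 0) (at_right (ereal 0))"
    unfolding ereal_tendsto_simps g_def by (auto intro!: tendsto_eq_intros)
  have "filterlim (\<lambda>u::real. 1 / 2 * u) at_top at_top"
    by (rule filterlim_tendsto_pos_mult_at_top[OF tendsto_const _ filterlim_ident]) simp
  hence "filterlim (\<lambda>u::real. sinh (u / 2)) at_top at_top"
    using filterlim_compose[OF sinh_real_at_top] by fastforce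
  hence lim2: "((ereal \<circ> g \<circ> real_of_ereal) \<longlongrightarrow> \<infinity>) (at_left \<infinity>)"
    unfolding ereal_tendsto_simps g_def using t by (intro filterlim_tendsto_pos_mult_at_top[OF tendsto_const]) auto
  have deriv: "\<And>u. ereal 0 < ereal u \<Longrightarrow> ereal u < \<infinity> \<Longrightarrow> DERIV g u :> g' u"
    unfolding g_def g'_def by (auto intro!: derivative_eq_intros)
  have contg': "\<And>u. ereal 0 < ereal u \<Longrightarrow> ereal u < \<infinity> \<Longrightarrow> isCont g' u"
    unfolding g'_def by (intro continuous_intros) auto
  have contf: "\<And>u. ereal 0 < ereal u \<Longrightarrow> ereal u < \<infinity> \<Longrightarrow> isCont f (g u)"
    by (rule cont) auto
  have f_nonneg: "\<And>u. ereal 0 < ereal u \<Longrightarrow> ereal u < \<infinity> \<Longrightarrow> 0 \<le> f (g u)"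
    by (rule fnn) auto
  have g'_nonneg: "\<And>u. ereal 0 \<le> ereal u \<Longrightarrow> ereal u \<le> \<infinity> \<Longrightarrow> 0 \<le> g' u"
    by (rule g'nn) auto
  have ab: "ereal 0 < \<infinity>" by simp
  note sub = interval_integral_substitution_nonneg[where g = g and g' = g' and f = f,
      OF ab deriv contf contg' f_nonneg g'_nonneg lim1 lim2 int]
  show "set_integrable lborel {0<..} (\<lambda>x. std_normal_density x / sqrt (1 + x\<^sup>2 / (4 * t)))"
    using sub(1) by (simp add: f_def)
  show "(LINT x:{0<..}|lborel. std_normal_density x / sqrt (1 + x\<^sup>2 / (4 * t))) = sqrt (t / (2 * pi)) * exp t * bessel_K0 t"
    using sub(2) unfolding fg interval_integral_to_infinity_eq by (simp add: f_def bessel_K0_def)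
qed

text \<open>The trigonometric analogue x = 2 sqrt t sin(u/2), for which x^2/2 = t (1 - cos u); the
  range 0 < u < pi is exactly the part of the half line inside the singularity.\<close>

lemma gauss_I0_substitution:
  assumes t: "t > 0"
  shows "set_integrable lborel {0<..<2 * sqrt t} (\<lambda>x. std_normal_density x / sqrt (1 - x\<^sup>2 / (4 * t)))"
    and "(LINT x:{0<..<2 * sqrt t}|lborel. std_normal_density x / sqrt (1 - x\<^sup>2 / (4 * t))) = sqrt (t / (2 * pi)) * exp (- t) * (pi * bessel_I0 t)"
proof -
  define f where "f = (\<lambda>x. std_normal_density x / sqrt (1 - x\<^sup>2 / (4 * t)))"
  define g where "g = (\<lambda>u. 2 * sqrt t * sin (u / 2))"
  define g' where "g' = (\<lambda>u. sqrt t * cos (u / 2))"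
  have g2: "(g u)\<^sup>2 / (4 * t) = (sin (u / 2))\<^sup>2" for u using t by (simp add: g_def power_mult_distrib)
  have cospos: "cos (u / 2) > 0" if "0 < u" "u < pi" for u
    using that by (intro cos_gt_zero) auto
  have fg: "f (g u) * g' u = sqrt (t / (2 * pi)) * exp (- t) * exp (t * cos u)" if u: "0 < u" "u < pi" for u
  proof -
    have a: "(g u)\<^sup>2 = 4 * t * (sin (u / 2))\<^sup>2" using t by (simp add: g_def power_mult_distrib)
    have b: "cos u = 1 - 2 * (sin (u / 2))\<^sup>2"
      using cos_double_sin[of "u / 2"] by simp
    have 2: "- (g u)\<^sup>2 / 2 = - t + t * cos u"
      unfolding a b by (simp add: algebra_simps)
    have 3: "sqrt (1 - (sin (u / 2))\<^sup>2) = cos (u / 2)"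
      using real_sqrt_unique[of "cos (u / 2)"] cospos[OF u] by (simp add: cos_squared_eq)
    show ?thesis
      unfolding f_def g2 3 std_normal_density_def 2 exp_add g'_def
      using t cospos[OF u] by (simp add: real_sqrt_divide real_sqrt_mult)
  qed
  have pos: "1 - (g u)\<^sup>2 / (4 * t) > 0" if "0 < u" "u < pi" for u
    unfolding g2 using cospos[OF that] by (simp add: sin_squared_eq)
  have intI: "set_integrable lborel {0<..<pi} (\<lambda>u. sqrt (t / (2 * pi)) * exp (- t) * exp (t * cos u))"
    by (rule set_integrable_subset[OF borel_integrable_atLeastAtMost'[of 0 pi]]) (auto intro!: continuous_intros)
  hence int: "set_integrable lborel (einterval (ereal 0) (ereal pi)) (\<lambda>u. f (g u) * g' u)"
    unfolding einterval_eq by (subst set_integrable_cong[OF refl refl fg]) auto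
  have lim1: "((ereal \<circ> g \<circ> real_of_ereal) \<longlongrightarrow> ereal 0) (at_right (ereal 0))"
    unfolding ereal_tendsto_simps g_def by (auto intro!: tendsto_eq_intros)
  have lim2: "((ereal \<circ> g \<circ> real_of_ereal) \<longlongrightarrow> ereal (2 * sqrt t)) (at_left (ereal pi))"
    unfolding ereal_tendsto_simps g_def by (auto intro!: tendsto_eq_intros)
  have fnn: "f (g u) \<ge> 0" if "0 < u" "u < pi" for u
    using pos[OF that] by (simp add: f_def)
  have cont: "isCont f (g u)" if "0 < u" "u < pi" for u
    using pos[OF that] unfolding f_def std_normal_density_def
    by (intro continuous_intros) (use t in \<open>auto split: if_splits\<close>)
  have g'nn: "g' u \<ge> 0" if "0 \<le> u" "u \<le> pi" for u
    unfolding g'_def using that t by (intro mult_nonneg_nonneg cos_ge_zero) auto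
  have deriv: "\<And>u. ereal 0 < ereal u \<Longrightarrow> ereal u < ereal pi \<Longrightarrow> DERIV g u :> g' u"
    unfolding g_def g'_def by (auto intro!: derivative_eq_intros)
  have contg': "\<And>u. ereal 0 < ereal u \<Longrightarrow> ereal u < ereal pi \<Longrightarrow> isCont g' u"
    unfolding g'_def by (intro continuous_intros) auto
  have contf: "\<And>u. ereal 0 < ereal u \<Longrightarrow> ereal u < ereal pi \<Longrightarrow> isCont f (g u)"
    by (rule cont) auto
  have f_nonneg: "\<And>u. ereal 0 < ereal u \<Longrightarrow> ereal u < ereal pi \<Longrightarrow> 0 \<le> f (g u)"
    by (rule fnn) auto
  have g'_nonneg: "\<And>u. ereal 0 \<le> ereal u \<Longrightarrow> ereal u \<le> ereal pi \<Longrightarrow> 0 \<le> g' u"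
    by (rule g'nn) auto
  have ab: "ereal 0 < ereal pi" by simp
  note sub = interval_integral_substitution_nonneg[where g = g and g' = g' and f = f,
      OF ab deriv contf contg' f_nonneg g'_nonneg lim1 lim2 int]
  show "set_integrable lborel {0<..<2 * sqrt t} (\<lambda>x. std_normal_density x / sqrt (1 - x\<^sup>2 / (4 * t)))"
    using sub(1) by (simp add: f_def)
  have "(LINT x:{0<..<2 * sqrt t}|lborel. f x) = (LINT u:{0<..<pi}|lborel. f (g u) * g' u)"
    using sub(2) t by (simp add: interval_lebesgue_integral_le_eq)
  also have "\<dots> = (LINT u:{0<..<pi}|lborel. sqrt (t / (2 * pi)) * exp (- t) * exp (t * cos u))"
    by (rule set_lebesgue_integral_cong) (use fg in auto)
  also have "\<dots> = (LINT u:{0..pi}|lborel. sqrt (t / (2 * pi)) * exp (- t) * exp (t * cos u))"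
    using interval_integral_Icc[of 0 pi "\<lambda>u. sqrt (t / (2 * pi)) * exp (- t) * exp (t * cos u)"]
    by (simp add: interval_lebesgue_integral_le_eq)
  also have "\<dots> = sqrt (t / (2 * pi)) * exp (- t) * (pi * bessel_I0 t)"
    by (simp add: bessel_I0_def)
  finally show "(LINT x:{0<..<2 * sqrt t}|lborel. std_normal_density x / sqrt (1 - x\<^sup>2 / (4 * t))) = sqrt (t / (2 * pi)) * exp (- t) * (pi * bessel_I0 t)"
    by (simp add: f_def)
qed

text \<open>Beyond the singularity x = 2 sqrt t cosh(u/2), with x^2/2 = t (cosh u + 1). The sign of
  the constant t accounts for the factor exp(-t) in place of exp t.\<close>

lemma gauss_K0_outer_substitution:
  assumes t: "t > 0"
  shows "set_integrable lborel {2 * sqrt t<..} (\<lambda>x. std_normal_density x / sqrt (x\<^sup>2 / (4 * t) - 1))"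
    and "(LINT x:{2 * sqrt t<..}|lborel. std_normal_density x / sqrt (x\<^sup>2 / (4 * t) - 1)) = sqrt (t / (2 * pi)) * exp (- t) * bessel_K0 t"
proof -
  define f where "f = (\<lambda>x. std_normal_density x / sqrt (x\<^sup>2 / (4 * t) - 1))"
  define g where "g = (\<lambda>u. 2 * sqrt t * cosh (u / 2))"
  define g' where "g' = (\<lambda>u. sqrt t * sinh (u / 2))"
  have g2: "(g u)\<^sup>2 / (4 * t) = (cosh (u / 2))\<^sup>2" for u using t by (simp add: g_def power_mult_distrib)
  have fg: "f (g u) * g' u = sqrt (t / (2 * pi)) * exp (- t) * exp (- t * cosh u)" if u: "0 < u" for u
  proof -
    have a: "(g u)\<^sup>2 = 4 * t * (cosh (u / 2))\<^sup>2" using t by (simp add: g_def power_mult_distrib)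
    have b: "cosh u = 2 * (cosh (u / 2))\<^sup>2 - 1"
      using cosh_double_cosh[of "u / 2"] by simp
    have 2: "- (g u)\<^sup>2 / 2 = - t + (- t * cosh u)"
      unfolding a b by (simp add: algebra_simps)
    have 3: "sqrt ((cosh (u / 2))\<^sup>2 - 1) = sinh (u / 2)"
      using real_sqrt_unique[of "sinh (u / 2)"] u by (simp add: cosh_square_eq)
    have "sinh (u / 2) \<noteq> 0" using u by simp
    thus ?thesis
      unfolding f_def g2 3 std_normal_density_def 2 exp_add g'_def
      using t by (simp add: real_sqrt_divide real_sqrt_mult)
  qed
  have pos: "(g u)\<^sup>2 / (4 * t) - 1 > 0" if "0 < u" for u
    unfolding g2 using that by (simp add: cosh_square_eq)
  have int: "set_integrable lborel (einterval (ereal 0) \<infinity>) (\<lambda>u. f (g u) * g' u)"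
    unfolding einterval_eq using set_integrable_exp_minus_cosh[OF t]
    by (subst set_integrable_cong[OF refl refl fg]) (auto simp: set_integrable_mult_right)
  have lim1: "((ereal \<circ> g \<circ> real_of_ereal) \<longlongrightarrow> ereal (2 * sqrt t)) (at_right (ereal 0))"
    unfolding ereal_tendsto_simps g_def by (auto intro!: tendsto_eq_intros)
  have "filterlim (\<lambda>u::real. 1 / 2 * u) at_top at_top"
    by (rule filterlim_tendsto_pos_mult_at_top[OF tendsto_const _ filterlim_ident]) simp
  hence "filterlim (\<lambda>u::real. cosh (u / 2)) at_top at_top"
    using filterlim_compose[OF cosh_real_at_top] by fastforce
  hence lim2: "((ereal \<circ> g \<circ> real_of_ereal) \<longlongrightarrow> \<infinity>) (at_left \<infinity>)"
    unfolding ereal_tendsto_simps g_def using t by (intro filterlim_tendsto_pos_mult_at_top[OF tendsto_const]) auto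
  have fnn: "f (g u) \<ge> 0" if "0 < u" for u
    using pos[OF that] by (simp add: f_def)
  have cont: "isCont f (g u)" if "0 < u" for u
    using pos[OF that] unfolding f_def std_normal_density_def
    by (intro continuous_intros) (use t in \<open>auto split: if_splits\<close>)
  have g'nn: "g' u \<ge> 0" if "0 \<le> u" for u
    unfolding g'_def using that t by (intro mult_nonneg_nonneg) auto
  have deriv: "\<And>u. ereal 0 < ereal u \<Longrightarrow> ereal u < \<infinity> \<Longrightarrow> DERIV g u :> g' u"
    unfolding g_def g'_def by (auto intro!: derivative_eq_intros)
  have contg': "\<And>u. ereal 0 < ereal u \<Longrightarrow> ereal u < \<infinity> \<Longrightarrow> isCont g' u"
    unfolding g'_def by (intro continuous_intros) auto
  have contf: "\<And>u. ereal 0 < ereal u \<Longrightarrow> ereal u < \<infinity> \<Longrightarrow> isCont f (g u)"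
    by (rule cont) auto
  have f_nonneg: "\<And>u. ereal 0 < ereal u \<Longrightarrow> ereal u < \<infinity> \<Longrightarrow> 0 \<le> f (g u)"
    by (rule fnn) auto
  have g'_nonneg: "\<And>u. ereal 0 \<le> ereal u \<Longrightarrow> ereal u \<le> \<infinity> \<Longrightarrow> 0 \<le> g' u"
    by (rule g'nn) auto
  have ab: "ereal 0 < \<infinity>" by simp
  note sub = interval_integral_substitution_nonneg[where g = g and g' = g' and f = f,
      OF ab deriv contf contg' f_nonneg g'_nonneg lim1 lim2 int]
  show "set_integrable lborel {2 * sqrt t<..} (\<lambda>x. std_normal_density x / sqrt (x\<^sup>2 / (4 * t) - 1))"
    using sub(1) by (simp add: f_def)
  have "(LINT x:{2 * sqrt t<..}|lborel. f x) = (LINT u:{0<..}|lborel. f (g u) * g' u)"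
    using sub(2) by (simp add: interval_integral_to_infinity_eq)
  also have "\<dots> = (LINT u:{0<..}|lborel. sqrt (t / (2 * pi)) * exp (- t) * exp (- t * cosh u))"
    by (rule set_lebesgue_integral_cong) (use fg in auto)
  also have "\<dots> = sqrt (t / (2 * pi)) * exp (- t) * bessel_K0 t"
    by (simp add: bessel_K0_def)
  finally show "(LINT x:{2 * sqrt t<..}|lborel. std_normal_density x / sqrt (x\<^sup>2 / (4 * t) - 1)) = sqrt (t / (2 * pi)) * exp (- t) * bessel_K0 t"
    by (simp add: f_def)
qed

lemma has_bochner_integral_even_Ioi:
  fixes h :: "real \<Rightarrow> 'a :: {banach, second_countable_topology}"
  assumes h: "h \<in> borel_measurable borel" and even: "\<And>x. h (- x) = h x"
    and I: "has_bochner_integral lborel (\<lambda>x. indicator {0<..} x *\<^sub>R h x) I"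
  shows "has_bochner_integral lborel h (2 *\<^sub>R I)"
proof (rule has_bochner_integral_even_function[where f = h, OF _ even])
  have "AE x in lborel. indicator {0<..} x *\<^sub>R h x = indicator {0..} x *\<^sub>R h x"
    using AE_lborel_singleton[of 0] by eventually_elim (auto simp: indicator_def)
  thus "has_bochner_integral lborel (\<lambda>x. indicator {0..} x *\<^sub>R h x) I"
    using I h by (subst (asm) has_bochner_integral_cong_AE) auto
qed

lemma sqrt_double_quotient: "t > 0 \<Longrightarrow> 2 * sqrt (t / (2 * pi)) = sqrt (2 * t / pi)"
proof -
  assume "t > 0"
  have "2 * sqrt (t / (2 * pi)) = sqrt (4 * (t / (2 * pi)))" by (simp only: real_sqrt_mult) simp
  thus ?thesis by (simp add: field_simps)
qed

lemma has_bochner_integral_gauss_K0: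
  assumes t: "t > 0"
  shows "has_bochner_integral lborel (\<lambda>x. std_normal_density x / sqrt (1 + x\<^sup>2 / (4 * t))) (sqrt (2 * t / pi) * exp t * bessel_K0 t)"
proof -
  have "has_bochner_integral lborel (\<lambda>x. std_normal_density x / sqrt (1 + x\<^sup>2 / (4 * t))) (2 *\<^sub>R (sqrt (t / (2 * pi)) * exp t * bessel_K0 t))"
  proof (rule has_bochner_integral_even_Ioi)
    show "has_bochner_integral lborel (\<lambda>x. indicator {0<..} x *\<^sub>R (std_normal_density x / sqrt (1 + x\<^sup>2 / (4 * t)))) (sqrt (t / (2 * pi)) * exp t * bessel_K0 t)"
      using gauss_K0_substitution[OF t]
      by (simp add: has_bochner_integral_iff set_integrable_def set_lebesgue_integral_def)
  qed (simp_all add: std_normal_density_def)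
  thus ?thesis using sqrt_double_quotient[OF t] by (simp add: mult.assoc[symmetric])
qed

text \<open>The limit of the kernel at -1/(4z) as z tends to t from above. That argument has
  positive imaginary part, so beyond the singularity the radicand reaches the negative axis from
  above, its root tends to a positive multiple of i, and the reciprocal carries -i.\<close>

definition gauss_boundary_kernel :: "real \<Rightarrow> real \<Rightarrow> complex" where
  "gauss_boundary_kernel t x =
     (if \<bar>x\<bar> < 2 * sqrt t then of_real (std_normal_density x / sqrt (1 - x\<^sup>2 / (4 * t)))
      else - \<i> * of_real (std_normal_density x / sqrt (x\<^sup>2 / (4 * t) - 1)))"

lemma borel_measurable_gauss_boundary_kernel [measurable]: "gauss_boundary_kernel t \<in> borel_measurable borel"
  unfolding gauss_boundary_kernel_def by measurable

lemma has_bochner_integral_gauss_boundary_kernel: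
  assumes t: "t > 0"
  shows "has_bochner_integral lborel (gauss_boundary_kernel t)
     (of_real (sqrt (2 * t / pi) * exp (- t)) * (of_real (pi * bessel_I0 t) - \<i> * of_real (bessel_K0 t)))"
proof -
  let ?c = "sqrt (t / (2 * pi)) * exp (- t)"
  let ?f = "\<lambda>x. std_normal_density x / sqrt (1 - x\<^sup>2 / (4 * t))"
  let ?g = "\<lambda>x. std_normal_density x / sqrt (x\<^sup>2 / (4 * t) - 1)"
  have 1: "has_bochner_integral lborel (\<lambda>x. indicator {0<..<2 * sqrt t} x *\<^sub>R ?f x) (?c * (pi * bessel_I0 t))"
    using gauss_I0_substitution[OF t]
    by (simp add: has_bochner_integral_iff set_integrable_def set_lebesgue_integral_def)
  have 2: "has_bochner_integral lborel (\<lambda>x. indicator {2 * sqrt t<..} x *\<^sub>R ?g x) (?c * bessel_K0 t)"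
    using gauss_K0_outer_substitution[OF t]
    by (simp add: has_bochner_integral_iff set_integrable_def set_lebesgue_integral_def)
  have 3: "has_bochner_integral lborel (\<lambda>x. of_real (indicator {0<..<2 * sqrt t} x *\<^sub>R ?f x) + - \<i> * of_real (indicator {2 * sqrt t<..} x *\<^sub>R ?g x))
     (of_real (?c * (pi * bessel_I0 t)) + - \<i> * of_real (?c * bessel_K0 t))"
    by (intro has_bochner_integral_add has_bochner_integral_mult_right has_bochner_integral_of_real 1 2)
  have "AE x in lborel. of_real (indicator {0<..<2 * sqrt t} x *\<^sub>R ?f x) + - \<i> * of_real (indicator {2 * sqrt t<..} x *\<^sub>R ?g x)
      = indicator {0<..} x *\<^sub>R gauss_boundary_kernel t x"
    using AE_lborel_singleton[of "2 * sqrt t"]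
  proof eventually_elim
    case (elim x)
    have "2 * sqrt t > 0" using t by simp
    hence "2 * sqrt t < x \<Longrightarrow> x > 0" by linarith
    thus ?case using elim
      by (cases x "2 * sqrt t" rule: linorder_cases) (auto simp: indicator_def gauss_boundary_kernel_def)
  qed
  hence 4: "has_bochner_integral lborel (\<lambda>x. indicator {0<..} x *\<^sub>R gauss_boundary_kernel t x)
     (of_real (?c * (pi * bessel_I0 t)) + - \<i> * of_real (?c * bessel_K0 t))"
    using 3 by (subst (asm) has_bochner_integral_cong_AE) auto
  have "has_bochner_integral lborel (gauss_boundary_kernel t) (2 *\<^sub>R (of_real (?c * (pi * bessel_I0 t)) + - \<i> * of_real (?c * bessel_K0 t)))"
    by (rule has_bochner_integral_even_Ioi[OF _ _ 4]) (auto simp: gauss_boundary_kernel_def std_normal_density_def)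
  also have "2 *\<^sub>R (of_real (?c * (pi * bessel_I0 t)) + - \<i> * of_real (?c * bessel_K0 t)) =
     of_real ((2 * sqrt (t / (2 * pi))) * exp (- t)) * (of_real (pi * bessel_I0 t) - \<i> * of_real (bessel_K0 t))"
    by (simp add: scaleR_conv_of_real algebra_simps)
  finally show ?thesis unfolding sqrt_double_quotient[OF t] .
qed

text \<open>Dominated convergence needs a majorant independent of \<open>\<delta>\<close>, but
  \<open>norm_inverse_csqrt_le\<close> puts the peaks at 2 sqrt |z|, which moves with
  \<open>\<delta>\<close>. Comparing real parts of 4z + \<epsilon> x^2 fixes them at 2 sqrt t; the
  price is the factor sqrt((t+1)/t), from |z| <= t + 1.\<close>

lemma gauss_kernel_dominated:
  assumes t: "t > 0" and \<delta>: "0 < \<delta>" "\<delta> < 1" and x: "x \<noteq> 2 * sqrt t" "x \<noteq> - (2 * sqrt t)"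
    and \<eta>: "\<eta> = \<epsilon> / (4 * Complex t \<delta>)" and \<epsilon>: "\<epsilon> = 1 \<or> \<epsilon> = - 1"
  shows "norm (gauss_kernel \<eta> x) \<le> std_normal_density x * (sqrt ((t + 1) / t) * (sqrt (2 * sqrt t) * two_peaks (2 * sqrt t) x))"
proof -
  define s where "s = 2 * sqrt t"
  have s: "s > 0" "s\<^sup>2 = 4 * t" using t by (auto simp: s_def power_mult_distrib)
  have xs: "x \<noteq> s" "x \<noteq> - s" using x by (auto simp: s_def)
  define z where "z = Complex t \<delta>"
  have z: "z \<noteq> 0" using t by (auto simp: z_def complex_eq_iff)
  have nz: "norm z \<le> t + 1"
    using cmod_le[of z] t \<delta> by (simp add: z_def)
  define q where "q = \<bar>1 - x\<^sup>2 / s\<^sup>2\<bar>"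
  have "x\<^sup>2 \<noteq> s\<^sup>2" using xs by (auto simp: power2_eq_iff)
  hence q: "q > 0" using s(1) by (auto simp: q_def field_simps)
  have "4 * t * q = \<bar>4 * t - x\<^sup>2\<bar>"
  proof -
    have "4 * t * q = \<bar>(4 * t) * (1 - x\<^sup>2 / (4 * t))\<bar>" using t by (simp add: q_def s abs_mult)
    also have "(4 * t) * (1 - x\<^sup>2 / (4 * t)) = 4 * t - x\<^sup>2" using t by (simp add: field_simps)
    finally show ?thesis .
  qed
  also have "\<dots> \<le> \<bar>Re (4 * z + \<epsilon> * of_real (x\<^sup>2))\<bar>"
  proof -
    have "\<bar>4 * t - x\<^sup>2\<bar> \<le> 4 * t + x\<^sup>2" using t by (simp add: abs_le_iff)
    thus ?thesis using \<epsilon> t by (auto simp: z_def simp flip: of_real_power)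
  qed
  also have "\<dots> \<le> norm (4 * z + \<epsilon> * of_real (x\<^sup>2))" by (rule abs_Re_le_cmod)
  finally have 1: "4 * t * q \<le> norm (4 * z + \<epsilon> * of_real (x\<^sup>2))" .
  have "1 + \<eta> * of_real (x\<^sup>2) = (4 * z + \<epsilon> * of_real (x\<^sup>2)) / (4 * z)"
    using z by (simp add: \<eta> z_def[symmetric] field_simps)
  hence "norm (1 + \<eta> * of_real (x\<^sup>2)) = norm (4 * z + \<epsilon> * of_real (x\<^sup>2)) / (4 * norm z)"
    by (simp add: norm_divide norm_mult)
  also have "\<dots> \<ge> (4 * t * q) / (4 * (t + 1))"
    using 1 nz z t q by (intro frac_le) auto
  also have "(4 * t * q) / (4 * (t + 1)) = q / ((t + 1) / t)" using t by (simp add: field_simps)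
  finally have "q / ((t + 1) / t) \<le> norm (1 + \<eta> * of_real (x\<^sup>2))" .
  hence "1 / sqrt (norm (1 + \<eta> * of_real (x\<^sup>2))) \<le> 1 / sqrt (q / ((t + 1) / t))"
    using q t by (intro frac_le real_sqrt_le_mono) auto
  also have "\<dots> = sqrt ((t + 1) / t) * (1 / sqrt q)" by (simp only: real_sqrt_divide) simp
  also have "\<dots> \<le> sqrt ((t + 1) / t) * (sqrt s * two_peaks s x)"
    unfolding q_def using t by (intro mult_left_mono inv_sqrt_quadratic_le_two_peaks(2)[OF s(1) xs]) auto
  finally have "norm (1 / csqrt (1 + \<eta> * of_real (x\<^sup>2))) \<le> sqrt ((t + 1) / t) * (sqrt s * two_peaks s x)"
    by (simp add: norm_divide)
  thus ?thesis unfolding norm_gauss_kernel s_def by (intro mult_left_mono) auto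
qed

text \<open>The boundary is approached along the heights 1/(n + 2), which lie strictly between 0 and
  1 for every n, as the majorant requires. The two exceptional points form a null set.\<close>

lemma gauss_transform_boundary_limit:
  assumes t: "t > 0" and L: "L \<in> borel_measurable borel" and \<epsilon>: "\<epsilon> = 1 \<or> \<epsilon> = - 1"
    and lim: "\<And>x. x \<noteq> 2 * sqrt t \<Longrightarrow> x \<noteq> - (2 * sqrt t) \<Longrightarrow>
       (\<lambda>n. gauss_kernel (\<epsilon> / (4 * Complex t (1 / (real n + 2)))) x) \<longlonglongrightarrow> L x"
  shows "(\<lambda>n. gauss_transform (\<epsilon> / (4 * Complex t (1 / (real n + 2))))) \<longlonglongrightarrow> (\<integral>x. L x \<partial>lborel)"
  unfolding gauss_transform_def
proof (rule integral_dominated_convergence[where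
      w = "\<lambda>x. sqrt ((t + 1) / t) * sqrt (2 * sqrt t) * (std_normal_density x * \<bar>x\<bar> ^ 0 * two_peaks (2 * sqrt t) x)"])
  have Im: "Im (\<epsilon> / (4 * Complex t \<delta>)) \<noteq> 0" if "\<delta> > 0" for \<delta>
  proof -
    have "16 * t\<^sup>2 + 16 * \<delta>\<^sup>2 > 0" using that t by (simp add: add_pos_pos)
    thus ?thesis using that \<epsilon> t by (auto simp: Im_divide)
  qed
  show "gauss_kernel (\<epsilon> / (4 * Complex t (1 / (real n + 2)))) \<in> borel_measurable lborel" for n
    by (rule borel_measurable_gauss_kernel[OF Im]) simp
  show "integrable lborel (\<lambda>x. sqrt ((t + 1) / t) * sqrt (2 * sqrt t) * (std_normal_density x * \<bar>x\<bar> ^ 0 * two_peaks (2 * sqrt t) x))"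
    using std_normal_moment_two_peaks[of 0] by (intro integrable_mult_right) metis
  show "AE x in lborel. (\<lambda>n. gauss_kernel (\<epsilon> / (4 * Complex t (1 / (real n + 2)))) x) \<longlonglongrightarrow> L x"
    using AE_lborel_neq2[of "2 * sqrt t" "- (2 * sqrt t)"] by eventually_elim (use lim in blast)
  show "AE x in lborel. norm (gauss_kernel (\<epsilon> / (4 * Complex t (1 / (real n + 2)))) x) \<le>
      sqrt ((t + 1) / t) * sqrt (2 * sqrt t) * (std_normal_density x * \<bar>x\<bar> ^ 0 * two_peaks (2 * sqrt t) x)" for n
    using AE_lborel_neq2[of "2 * sqrt t" "- (2 * sqrt t)"]
  proof eventually_elim
    case (elim x)
    have "norm (gauss_kernel (\<epsilon> / (4 * Complex t (1 / (real n + 2)))) x) \<le>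
       std_normal_density x * (sqrt ((t + 1) / t) * (sqrt (2 * sqrt t) * two_peaks (2 * sqrt t) x))"
      by (rule gauss_kernel_dominated[OF t _ _ _ _ refl \<epsilon>]) (use elim in auto)
    thus ?case by (simp only: mult_ac power_0 mult_1_right)
  qed
qed (use L in simp)

lemma tendsto_Complex_boundary:
  "(\<lambda>n. Complex t (1 / (real n + 2))) \<longlonglongrightarrow> of_real t"
proof -
  have "(\<lambda>n. Complex t (1 / (real n + 2))) \<longlonglongrightarrow> Complex t 0"
    by (intro tendsto_Complex tendsto_const) real_asymp
  thus ?thesis by (simp add: complex_of_real_def)
qed

lemma tendsto_kernel_argument:
  assumes "t > 0"
  shows "(\<lambda>n. 1 + \<epsilon> / (4 * Complex t (1 / (real n + 2))) * of_real (x\<^sup>2)) \<longlonglongrightarrow> 1 + \<epsilon> / (4 * of_real t) * of_real (x\<^sup>2)"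
  by (intro tendsto_intros tendsto_Complex_boundary) (use assms in auto)

lemma gauss_transform_tendsto_K0:
  assumes t: "t > 0"
  shows "(\<lambda>n. gauss_transform (1 / (4 * Complex t (1 / (real n + 2))))) \<longlonglongrightarrow> of_real (sqrt (2 * t / pi) * exp t * bessel_K0 t)"
proof -
  let ?L = "\<lambda>x. of_real (std_normal_density x / sqrt (1 + x\<^sup>2 / (4 * t))) :: complex"
  have "(\<lambda>n. gauss_transform (1 / (4 * Complex t (1 / (real n + 2))))) \<longlonglongrightarrow> (\<integral>x. ?L x \<partial>lborel)"
  proof (rule gauss_transform_boundary_limit[OF t])
    fix x :: real
    have pos: "1 + x\<^sup>2 / (4 * t) > 0" using t by (simp add: add_pos_nonneg)
    have e: "1 + 1 / (4 * of_real t) * of_real (x\<^sup>2) = (of_real (1 + x\<^sup>2 / (4 * t)) :: complex)" by simp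
    have "(\<lambda>n. csqrt (1 + 1 / (4 * Complex t (1 / (real n + 2))) * of_real (x\<^sup>2))) \<longlonglongrightarrow> csqrt (of_real (1 + x\<^sup>2 / (4 * t)))"
      by (rule isCont_tendsto_compose[OF _ tendsto_kernel_argument[OF t, of 1 x, unfolded e]])
         (rule continuous_at_csqrt, use pos in \<open>simp only: nonpos_Reals_of_real_iff not_le\<close>)
    moreover have "csqrt (of_real (1 + x\<^sup>2 / (4 * t))) = of_real (sqrt (1 + x\<^sup>2 / (4 * t)))"
      using pos by (intro of_real_sqrt[symmetric]) auto
    ultimately have "(\<lambda>n. gauss_kernel (1 / (4 * Complex t (1 / (real n + 2)))) x) \<longlonglongrightarrow>
        of_real (std_normal_density x) / of_real (sqrt (1 + x\<^sup>2 / (4 * t)))"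
      unfolding gauss_kernel_def using pos by (intro tendsto_divide tendsto_const) (auto split: if_splits)
    thus "(\<lambda>n. gauss_kernel (1 / (4 * Complex t (1 / (real n + 2)))) x) \<longlonglongrightarrow> ?L x" by simp
  qed simp_all
  also have "(\<integral>x. ?L x \<partial>lborel) = of_real (sqrt (2 * t / pi) * exp t * bessel_K0 t)"
    by (rule has_bochner_integral_integral_eq[OF has_bochner_integral_of_real[OF has_bochner_integral_gauss_K0[OF t]]])
  finally show ?thesis .
qed

lemma gauss_transform_tendsto_I0_K0:
  assumes t: "t > 0"
  shows "(\<lambda>n. gauss_transform (- 1 / (4 * Complex t (1 / (real n + 2))))) \<longlonglongrightarrow>
     of_real (sqrt (2 * t / pi) * exp (- t)) * (of_real (pi * bessel_I0 t) - \<i> * of_real (bessel_K0 t))"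
proof -
  have "(\<lambda>n. gauss_transform (- 1 / (4 * Complex t (1 / (real n + 2))))) \<longlonglongrightarrow> (\<integral>x. gauss_boundary_kernel t x \<partial>lborel)"
  proof (rule gauss_transform_boundary_limit[OF t])
    fix x :: real assume x: "x \<noteq> 2 * sqrt t" "x \<noteq> - (2 * sqrt t)"
    let ?w = "\<lambda>n. 1 + - 1 / (4 * Complex t (1 / (real n + 2))) * of_real (x\<^sup>2)"
    have e: "1 + - 1 / (4 * of_real t) * of_real (x\<^sup>2) = (of_real (1 - x\<^sup>2 / (4 * t)) :: complex)" by simp
    note lim = tendsto_kernel_argument[OF t, of "- 1" x, unfolded e]
    have st: "(2 * sqrt t)\<^sup>2 = 4 * t" using t by (simp add: power_mult_distrib)
    show "(\<lambda>n. gauss_kernel (- 1 / (4 * Complex t (1 / (real n + 2)))) x) \<longlonglongrightarrow> gauss_boundary_kernel t x"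
    proof (cases "\<bar>x\<bar> < 2 * sqrt t")
      case True
      hence "\<bar>x\<bar>\<^sup>2 < (2 * sqrt t)\<^sup>2" by (intro power_strict_mono) auto
      hence "x\<^sup>2 < 4 * t" using st by simp
      hence pos: "1 - x\<^sup>2 / (4 * t) > 0" using t by (simp add: field_simps)
      have "(\<lambda>n. csqrt (?w n)) \<longlonglongrightarrow> csqrt (of_real (1 - x\<^sup>2 / (4 * t)))"
        by (rule isCont_tendsto_compose[OF _ lim])
           (rule continuous_at_csqrt, use pos in \<open>simp only: nonpos_Reals_of_real_iff not_le\<close>)
      moreover have "csqrt (of_real (1 - x\<^sup>2 / (4 * t))) = of_real (sqrt (1 - x\<^sup>2 / (4 * t)))"
        using pos by (intro of_real_sqrt[symmetric]) auto
      ultimately have "(\<lambda>n. gauss_kernel (- 1 / (4 * Complex t (1 / (real n + 2)))) x) \<longlonglongrightarrow>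
          of_real (std_normal_density x) / of_real (sqrt (1 - x\<^sup>2 / (4 * t)))"
        unfolding gauss_kernel_def using pos by (intro tendsto_divide tendsto_const) (auto split: if_splits)
      thus ?thesis using True by (simp add: gauss_boundary_kernel_def)
    next
      case False
      hence "\<bar>x\<bar> > 2 * sqrt t" using x by auto
      hence "(2 * sqrt t)\<^sup>2 < \<bar>x\<bar>\<^sup>2" using t by (intro power_strict_mono) auto
      hence "x\<^sup>2 > 4 * t" using st by simp
      hence pos: "x\<^sup>2 / (4 * t) - 1 > 0" and x0: "x \<noteq> 0" using t by (auto simp: field_simps)
      have Im: "Im (- ?w n) < 0" for n
      proof -
        have "Im (- ?w n) = Im (1 / (4 * Complex t (1 / (real n + 2)))) * x\<^sup>2"
        proof -
          have "- ?w n = - 1 + 1 / (4 * Complex t (1 / (real n + 2))) * of_real (x\<^sup>2)" by simp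
          moreover have "Im (- 1 + q * of_real r) = Im q * r" for q r by simp
          ultimately show ?thesis by (simp only:)
        qed
        moreover have "Im (1 / (4 * Complex t (1 / (real n + 2)))) < 0"
          using t by (simp add: Im_divide divide_neg_pos add_pos_pos)
        ultimately show ?thesis using x0 by (simp add: mult_neg_pos)
      qed
      \<comment> \<open>The radicand lies just above the branch cut. Factoring out i moves the
        remaining root to -w, whose limit is positive and where \<open>csqrt\<close> is
        continuous.\<close>
      have "csqrt (?w n) = \<i> * csqrt (- ?w n)" for n
        using csqrt_minus[of "- ?w n"] Im[of n] by simp
      hence eq: "gauss_kernel (- 1 / (4 * Complex t (1 / (real n + 2)))) x = of_real (std_normal_density x) / (\<i> * csqrt (- ?w n))" for n
        unfolding gauss_kernel_def by (simp only:)
      have lim': "(\<lambda>n. - ?w n) \<longlonglongrightarrow> of_real (x\<^sup>2 / (4 * t) - 1)"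
      proof -
        have "of_real (x\<^sup>2 / (4 * t) - 1) = - (of_real (1 - x\<^sup>2 / (4 * t)) :: complex)" by simp
        thus ?thesis using tendsto_minus[OF lim] by (simp only:)
      qed
      have "(\<lambda>n. csqrt (- ?w n)) \<longlonglongrightarrow> csqrt (of_real (x\<^sup>2 / (4 * t) - 1))"
        by (rule isCont_tendsto_compose[OF _ lim'])
           (rule continuous_at_csqrt, use pos in \<open>simp only: nonpos_Reals_of_real_iff not_le\<close>)
      moreover have "csqrt (of_real (x\<^sup>2 / (4 * t) - 1)) = of_real (sqrt (x\<^sup>2 / (4 * t) - 1))"
        using pos by (intro of_real_sqrt[symmetric]) auto
      ultimately have "(\<lambda>n. gauss_kernel (- 1 / (4 * Complex t (1 / (real n + 2)))) x) \<longlonglongrightarrow>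
          of_real (std_normal_density x) / (\<i> * of_real (sqrt (x\<^sup>2 / (4 * t) - 1)))"
        unfolding eq using pos by (intro tendsto_divide tendsto_mult tendsto_const) (auto split: if_splits)
      moreover have "u / (\<i> * v) = - \<i> * (u / v)" for u v :: complex
      proof -
        have "u / (\<i> * v) = u / v / \<i>" by (simp only: divide_divide_eq_left mult.commute)
        thus ?thesis by simp
      qed
      ultimately show ?thesis using False by (simp add: gauss_boundary_kernel_def)
    qed
  qed simp_all
  also have "(\<integral>x. gauss_boundary_kernel t x \<partial>lborel) = of_real (sqrt (2 * t / pi) * exp (- t)) * (of_real (pi * bessel_I0 t) - \<i> * of_real (bessel_K0 t))"
    by (rule has_bochner_integral_integral_eq[OF has_bochner_integral_gauss_boundary_kernel[OF t]])
  finally show ?thesis .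
qed

subsection \<open>Asymptotic expansions and boundary value integrals\<close>

text \<open>An asymptotic, in general divergent, expansion. It is restricted to the lower half plane
  because that is where 1/(4z) lies when Im z > 0.\<close>

definition has_expansion_at_0 :: "(complex \<Rightarrow> complex) \<Rightarrow> complex fps \<Rightarrow> bool" where
  "has_expansion_at_0 g p \<longleftrightarrow> (\<forall>J. \<exists>C. \<forall>\<eta>. Im \<eta> < 0 \<longrightarrow> norm \<eta> \<le> 1 \<longrightarrow>
      norm (g \<eta> - (\<Sum>j<J. fps_nth p j * \<eta> ^ j)) \<le> C * norm \<eta> ^ J)"

lemma has_expansion_at_0_1: "has_expansion_at_0 (\<lambda>_. 1) 1"
  unfolding has_expansion_at_0_def
proof (intro allI exI impI)
  fix J and \<eta> :: complex
  have "(\<Sum>j<J. fps_nth (1 :: complex fps) j * \<eta> ^ j) = (if J = 0 then 0 else 1)"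
    by (cases J) (simp_all add: sum.lessThan_Suc_shift fps_one_nth del: sum.lessThan_Suc)
  thus "norm (1 - (\<Sum>j<J. fps_nth (1 :: complex fps) j * \<eta> ^ j)) \<le> 1 * norm \<eta> ^ J"
    by simp
qed

text \<open>With truncations P and Q, split f g - P Q as (f - P) g + P (g - Q). What P Q has beyond
  the truncated Cauchy product consists of the pairs in \<open>S\<close>, of total degree at least
  J.\<close>

lemma has_expansion_at_0_mult:
  assumes "has_expansion_at_0 f p" "has_expansion_at_0 g q"
  shows "has_expansion_at_0 (\<lambda>\<eta>. f \<eta> * g \<eta>) (p * q)"
  unfolding has_expansion_at_0_def
proof
  fix J
  let ?P = "\<lambda>\<eta>. \<Sum>j<J. fps_nth p j * \<eta> ^ j" and ?Q = "\<lambda>\<eta>. \<Sum>j<J. fps_nth q j * \<eta> ^ j"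
  obtain C where C: "\<And>\<eta>. Im \<eta> < 0 \<Longrightarrow> norm \<eta> \<le> 1 \<Longrightarrow> norm (f \<eta> - ?P \<eta>) \<le> C * norm \<eta> ^ J"
    using assms(1) unfolding has_expansion_at_0_def by blast
  obtain D where D: "\<And>\<eta>. Im \<eta> < 0 \<Longrightarrow> norm \<eta> \<le> 1 \<Longrightarrow> norm (g \<eta> - ?Q \<eta>) \<le> D * norm \<eta> ^ J"
    using assms(2) unfolding has_expansion_at_0_def by blast
  define A where "A = (\<Sum>j<J. norm (fps_nth p j))"
  define B where "B = (\<Sum>j<J. norm (fps_nth q j))"
  define S where "S = {(i, k). i < J \<and> k < J \<and> \<not> i + k < J}"
  define E where "E = (\<Sum>(i, k)\<in>S. norm (fps_nth p i * fps_nth q k))"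
  have bd: "norm (\<Sum>j<J. fps_nth r j * \<eta> ^ j) \<le> (\<Sum>j<J. norm (fps_nth r j))" if "norm \<eta> \<le> 1" for r :: "complex fps" and \<eta> :: complex
  proof (rule order_trans[OF norm_sum sum_mono])
    fix j
    show "norm (fps_nth r j * \<eta> ^ j) \<le> norm (fps_nth r j)"
      using power_le_one[of "norm \<eta>" j] that by (simp add: norm_mult norm_power mult_left_le)
  qed
  have "norm (f \<eta> * g \<eta> - (\<Sum>j<J. fps_nth (p * q) j * \<eta> ^ j)) \<le> (C * (D + B) + A * D + E) * norm \<eta> ^ J"
    if \<eta>: "Im \<eta> < 0" "norm \<eta> \<le> 1" for \<eta>
  proof -
    have pw: "norm \<eta> ^ J \<le> 1" using \<eta>(2) by (intro power_le_one) auto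
    have "0 \<le> C * norm \<eta> ^ J" "0 \<le> D * norm \<eta> ^ J"
      using order_trans[OF norm_ge_zero C[OF \<eta>]] order_trans[OF norm_ge_zero D[OF \<eta>]] by auto
    moreover have "norm \<eta> ^ J > 0" using \<eta>(1) by (intro zero_less_power) auto
    ultimately have CD: "C \<ge> 0" "D \<ge> 0" by (simp_all add: zero_le_mult_iff)
    have AB: "A \<ge> 0" "B \<ge> 0" by (simp_all add: A_def B_def sum_nonneg)
    have gb: "norm (g \<eta>) \<le> D + B"
    proof -
      have "norm (g \<eta>) \<le> norm (g \<eta> - ?Q \<eta>) + norm (?Q \<eta>)" by (metis norm_triangle_sub add.commute)
      also have "\<dots> \<le> D * norm \<eta> ^ J + B" using D[OF \<eta>] bd[OF \<eta>(2), of q] by (simp add: B_def)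
      also have "\<dots> \<le> D * 1 + B" using pw CD by (intro add_right_mono mult_left_mono)
      finally show ?thesis by simp
    qed
    have 1: "norm ((f \<eta> - ?P \<eta>) * g \<eta>) \<le> C * norm \<eta> ^ J * (D + B)"
      unfolding norm_mult using C[OF \<eta>] gb CD by (intro mult_mono) auto
    have 2: "norm (?P \<eta> * (g \<eta> - ?Q \<eta>)) \<le> A * (D * norm \<eta> ^ J)"
      unfolding norm_mult using bd[OF \<eta>(2), of p] D[OF \<eta>] AB by (intro mult_mono) (auto simp: A_def)
    have 3: "norm (?P \<eta> * ?Q \<eta> - (\<Sum>j<J. fps_nth (p * q) j * \<eta> ^ j)) \<le> E * norm \<eta> ^ J"
    proof -
      let ?h = "\<lambda>(i, k). fps_nth p i * fps_nth q k * \<eta> ^ (i + k)"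
      have sq: "{..<J} \<times> {..<J} = {(i, k). i + k < J} \<union> S" by (auto simp: S_def)
      have fin: "finite S" by (rule finite_subset[of _ "{..<J} \<times> {..<J}"]) (auto simp: S_def)
      have fin': "finite {(i, k). i + k < J}" by (rule finite_subset[of _ "{..<J} \<times> {..<J}"]) auto
      have "?P \<eta> * ?Q \<eta> = (\<Sum>x\<in>{..<J} \<times> {..<J}. ?h x)"
        by (simp add: sum_product sum.cartesian_product power_add mult_ac)
      also have "\<dots> = (\<Sum>x\<in>{(i, k). i + k < J}. ?h x) + (\<Sum>x\<in>S. ?h x)"
        unfolding sq by (rule sum.union_disjoint[OF fin' fin]) (auto simp: S_def)
      also have "(\<Sum>x\<in>{(i, k). i + k < J}. ?h x) = (\<Sum>j<J. fps_nth (p * q) j * \<eta> ^ j)"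
        unfolding sum.triangle_reindex
        by (intro sum.cong refl) (simp add: fps_mult_nth sum_distrib_right atLeast0AtMost)
      finally have "?P \<eta> * ?Q \<eta> - (\<Sum>j<J. fps_nth (p * q) j * \<eta> ^ j) = (\<Sum>x\<in>S. ?h x)" by simp
      also have "norm \<dots> \<le> (\<Sum>(i, k)\<in>S. norm (fps_nth p i * fps_nth q k) * norm \<eta> ^ J)"
      proof (rule order_trans[OF norm_sum sum_mono])
        fix x assume "x \<in> S"
        then obtain i k where x: "x = (i, k)" "i + k \<ge> J" by (auto simp: S_def)
        have "norm \<eta> ^ (i + k) \<le> norm \<eta> ^ J" using x(2) \<eta>(2) by (intro power_decreasing) auto
        thus "norm (?h x) \<le> (case x of (i, k) \<Rightarrow> norm (fps_nth p i * fps_nth q k) * norm \<eta> ^ J)"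
          by (simp add: x(1) norm_mult norm_power mult_left_mono)
      qed
      also have "\<dots> = E * norm \<eta> ^ J" by (simp add: E_def sum_distrib_right case_prod_unfold)
      finally show ?thesis .
    qed
    have "f \<eta> * g \<eta> - (\<Sum>j<J. fps_nth (p * q) j * \<eta> ^ j) = (f \<eta> - ?P \<eta>) * g \<eta> + ?P \<eta> * (g \<eta> - ?Q \<eta>) +
        (?P \<eta> * ?Q \<eta> - (\<Sum>j<J. fps_nth (p * q) j * \<eta> ^ j))" by (simp add: algebra_simps)
    also have "norm \<dots> \<le> C * norm \<eta> ^ J * (D + B) + A * (D * norm \<eta> ^ J) + E * norm \<eta> ^ J"
      by (intro norm_triangle_le add_mono 1 2 3)
    also have "\<dots> = (C * (D + B) + A * D + E) * norm \<eta> ^ J" by (simp add: algebra_simps)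
    finally show ?thesis .
  qed
  thus "\<exists>C. \<forall>\<eta>. Im \<eta> < 0 \<longrightarrow> norm \<eta> \<le> 1 \<longrightarrow>
      norm (f \<eta> * g \<eta> - (\<Sum>j<J. fps_nth (p * q) j * \<eta> ^ j)) \<le> C * norm \<eta> ^ J" by blast
qed

lemma has_expansion_at_0_power:
  assumes "has_expansion_at_0 f p"
  shows "has_expansion_at_0 (\<lambda>\<eta>. f \<eta> ^ N) (p ^ N)"
proof (induction N)
  case (Suc N)
  show ?case using has_expansion_at_0_mult[OF assms Suc.IH] by simp
qed (simp add: has_expansion_at_0_1)

text \<open>The expansion of V holds on both sides of the real line, so it may be used at
  \<open>\<eta>\<close> and at \<open>- \<eta>\<close>; multiplying the two series gives the natural
  coefficients.\<close>

lemma has_expansion_gauss_transform_product: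
  "has_expansion_at_0 (\<lambda>\<eta>. gauss_transform \<eta> * gauss_transform (- \<eta>)) (Abs_fps (\<lambda>k. of_nat (K0_product_coeff k)))"
proof -
  have 1: "has_expansion_at_0 gauss_transform (Abs_fps K0_coeff)"
    unfolding has_expansion_at_0_def
  proof
    fix J
    obtain C where "\<And>\<eta>. Im \<eta> \<noteq> 0 \<Longrightarrow> norm (gauss_transform \<eta> - (\<Sum>j<J. K0_coeff j * \<eta> ^ j)) \<le> C * norm \<eta> ^ J"
      using gauss_transform_asymptotics[of J] by metis
    thus "\<exists>C. \<forall>\<eta>. Im \<eta> < 0 \<longrightarrow> norm \<eta> \<le> 1 \<longrightarrow>
      norm (gauss_transform \<eta> - (\<Sum>j<J. fps_nth (Abs_fps K0_coeff) j * \<eta> ^ j)) \<le> C * norm \<eta> ^ J"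
      by (intro exI[of _ C]) simp
  qed
  have 2: "has_expansion_at_0 (\<lambda>\<eta>. gauss_transform (- \<eta>)) (Abs_fps (\<lambda>j. (- 1) ^ j * K0_coeff j))"
    unfolding has_expansion_at_0_def
  proof
    fix J
    obtain C where C: "\<And>\<eta>. Im \<eta> \<noteq> 0 \<Longrightarrow> norm (gauss_transform \<eta> - (\<Sum>j<J. K0_coeff j * \<eta> ^ j)) \<le> C * norm \<eta> ^ J"
      using gauss_transform_asymptotics[of J] by metis
    have "norm (gauss_transform (- \<eta>) - (\<Sum>j<J. (- 1) ^ j * K0_coeff j * \<eta> ^ j)) \<le> C * norm \<eta> ^ J"
      if "Im \<eta> < 0" for \<eta>
    proof -
      have "K0_coeff j * (- \<eta>) ^ j = (- 1) ^ j * K0_coeff j * \<eta> ^ j" for j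
        unfolding power_minus[of \<eta>] by (simp only: mult_ac)
      hence "(\<Sum>j<J. K0_coeff j * (- \<eta>) ^ j) = (\<Sum>j<J. (- 1) ^ j * K0_coeff j * \<eta> ^ j)" by (simp only:)
      thus ?thesis using C[of "- \<eta>"] that by (simp only: uminus_complex.sel norm_minus_cancel)
    qed
    thus "\<exists>C. \<forall>\<eta>. Im \<eta> < 0 \<longrightarrow> norm \<eta> \<le> 1 \<longrightarrow>
      norm (gauss_transform (- \<eta>) - (\<Sum>j<J. fps_nth (Abs_fps (\<lambda>j. (- 1) ^ j * K0_coeff j)) j * \<eta> ^ j)) \<le> C * norm \<eta> ^ J"
      by (intro exI[of _ C]) simp
  qed
  show ?thesis using has_expansion_at_0_mult[OF 1 2] unfolding K0_product_series .
qed

text \<open>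
  Cauchy's theorem on a large box in the upper half plane, in terms of a primitive: only the
  \<open>\<beta> / z\<close> term of the expansion at infinity contributes to the integral along the real line,
  since the odd powers have even primitives.
\<close>
lemma boundary_value_integral:
  fixes F :: "complex \<Rightarrow> complex" and e :: "nat \<Rightarrow> complex"
  assumes hol: "F holomorphic_on {z. Im z > 0}"
    and sym: "\<And>z. Im z > 0 \<Longrightarrow> F (- cnj z) = cnj (F z)"
    and expansion: "\<And>z. Im z > 0 \<Longrightarrow> norm z \<ge> 1 \<Longrightarrow>
      norm (F z - (\<beta> / z + (\<Sum>a<A. e a * z ^ (2 * a + 1)))) \<le> C / (norm z)\<^sup>2"
    and bd: "\<And>R. \<exists>B. \<forall>t \<delta>. 0 < t \<longrightarrow> t \<le> R \<longrightarrow> 0 < \<delta> \<longrightarrow> \<delta> < 1 \<longrightarrow> norm (F (Complex t \<delta>)) \<le> B * t powr (- 1 / 2)"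
    and lim: "\<And>t. t > 0 \<Longrightarrow> (\<lambda>n. F (Complex t (1 / (real n + 2)))) \<longlonglongrightarrow> F0 t"
    and int: "set_integrable lborel {0<..} (\<lambda>t. Re (F0 t))"
  shows "(LINT t:{0<..}|lborel. Re (F0 t)) = pi / 2 * Im \<beta>"
proof -
  define H where "H = (\<lambda>z. \<beta> * Ln z + (\<Sum>a<A. e a * z ^ (2 * a + 2) / of_nat (2 * a + 2)))"
  define \<delta> where "\<delta> = (\<lambda>n. 1 / (real n + 2))"
  have \<delta>: "0 < \<delta> n" "\<delta> n < 1" for n by (auto simp: \<delta>_def)
  have \<delta>0: "\<delta> \<longlonglongrightarrow> 0" unfolding \<delta>_def by real_asymp
  have int0: "set_integrable lborel {0..} (\<lambda>t. Re (F0 t))"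
  proof -
    have "integrable lborel (\<lambda>t. indicator {0..} t *\<^sub>R Re (F0 t)) \<longleftrightarrow> integrable lborel (\<lambda>t. indicator {0<..} t *\<^sub>R Re (F0 t))"
      using AE_lborel_singleton[of 0]
      by (intro integrable_discrete_difference[where X = "{0}"]) (auto simp: indicator_def)
    thus ?thesis using int by (simp add: set_integrable_def)
  qed
  \<comment> \<open>For fixed R the height \<open>\<delta>\<close> goes to 0 first; R goes to
    infinity only afterwards, where the integrability of the real part is used.\<close>
  have key: "\<bar>2 * (LINT t:{0..R}|lborel. Re (F0 t)) - pi * Im \<beta>\<bar> \<le> 4 * C / R" if R: "R \<ge> 1" for R
  proof -
    define f where "f = (\<lambda>n t. Re (F (Complex t (\<delta> n))))"
    have line: "Complex t d = of_real t + \<i> * of_real d" for t d by (simp add: complex_eq_iff)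
    have cont: "continuous_on {0..R} (f n)" for n
      unfolding f_def line
      by (intro continuous_intros continuous_on_compose2[OF holomorphic_on_imp_continuous_on[OF hol]]) (use \<delta> in auto)
    have I: "integral {0..R} (f n) = (LINT t:{0..R}|lborel. f n t)" for n
      by (rule set_borel_integral_eq_integral(2)[symmetric]) (rule borel_integrable_atLeastAtMost'[OF cont])
    obtain B where B: "\<And>t \<delta>. 0 < t \<Longrightarrow> t \<le> R \<Longrightarrow> 0 < \<delta> \<Longrightarrow> \<delta> < 1 \<Longrightarrow> norm (F (Complex t \<delta>)) \<le> B * t powr (- 1 / 2)"
      using bd[of R] by blast
    have L1: "(\<lambda>n. LINT t:{0..R}|lborel. f n t) \<longlonglongrightarrow> (LINT t:{0..R}|lborel. Re (F0 t))"
      unfolding set_lebesgue_integral_def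
    \<comment> \<open>The hypothesis \<open>bd\<close> supplies a majorant B t^(-1/2), integrable at
      0 and uniform in the height.\<close>
    proof (rule integral_dominated_convergence[where w = "\<lambda>t. indicator {0<..R} t *\<^sub>R (B * t powr (- 1 / 2))"])
      show "(\<lambda>t. indicator {0..R} t *\<^sub>R Re (F0 t)) \<in> borel_measurable lborel"
        using set_integrable_subset[OF int0, of "{0..R}"] unfolding set_integrable_def
        by (intro borel_measurable_integrable) auto
      show "(\<lambda>t. indicator {0..R} t *\<^sub>R f n t) \<in> borel_measurable lborel" for n
        using borel_integrable_atLeastAtMost'[OF cont] unfolding set_integrable_def
        by (rule borel_measurable_integrable)
      have "(\<lambda>x. x powr (- 1 / 2)) absolutely_integrable_on {0<..R}"
        by (intro nonnegative_absolutely_integrable_1 integrable_on_powr_from_0') (use R in auto)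
      hence "set_integrable lborel {0<..R} (\<lambda>x. x powr (- 1 / 2))"
        unfolding set_integrable_def by (subst (asm) integrable_completion) auto
      hence "set_integrable lborel {0<..R} (\<lambda>t. B * t powr (- 1 / 2))" by simp
      thus "integrable lborel (\<lambda>t. indicator {0<..R} t *\<^sub>R (B * t powr (- 1 / 2)))"
        unfolding set_integrable_def .
      show "AE t in lborel. (\<lambda>n. indicator {0..R} t *\<^sub>R f n t) \<longlonglongrightarrow> indicator {0..R} t *\<^sub>R Re (F0 t)"
        using AE_lborel_singleton[of 0]
      proof eventually_elim
        case (elim t)
        show ?case
        proof (cases "t \<in> {0..R}")
          case True
          hence "t > 0" using elim by auto
          from tendsto_Re[OF lim[OF this]] show ?thesis using True by (simp add: f_def \<delta>_def)
        qed simp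
      qed
      show "AE t in lborel. norm (indicator {0..R} t *\<^sub>R f n t) \<le> indicator {0<..R} t *\<^sub>R (B * t powr (- 1 / 2))" for n
        using AE_lborel_singleton[of 0]
      proof eventually_elim
        case (elim t)
        show ?case
        proof (cases "t \<in> {0..R}")
          case True
          hence t: "t > 0" "t \<le> R" using elim by auto
          have "\<bar>f n t\<bar> \<le> B * t powr (- 1 / 2)"
            unfolding f_def by (rule order_trans[OF abs_Re_le_cmod B[OF t \<delta>]])
          thus ?thesis using t by simp
        qed (auto simp: indicator_def)
      qed
    qed
    have even: "(\<lambda>n. \<Sum>a<A. e a * (Complex S (\<delta> n)) ^ (2 * a + 2) / of_nat (2 * a + 2)) \<longlonglongrightarrow>
        (\<Sum>a<A. e a * of_real S ^ (2 * a + 2) / of_nat (2 * a + 2))" for S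
    proof -
      have "(\<lambda>n. Complex S (\<delta> n)) \<longlonglongrightarrow> of_real S"
        unfolding line using tendsto_add[OF tendsto_const tendsto_mult[OF tendsto_const tendsto_of_real[OF \<delta>0]]] by simp
      moreover have "of_nat (2 * a + 2) \<noteq> (0 :: complex)" for a by (simp only: of_nat_eq_0_iff)
      ultimately show ?thesis
        by (intro tendsto_sum tendsto_divide tendsto_mult tendsto_power tendsto_const)
    qed
    have "filterlim \<delta> (at_right 0) sequentially"
    proof -
      have "\<delta> n \<noteq> 0" for n using \<delta>(1)[of n] by simp
      thus ?thesis unfolding filterlim_at using \<delta>0 \<delta>(1) by (auto intro!: always_eventually)
    qed
    from filterlim_compose[OF tendsto_Ln_real_line_difference this, of R]
    have Ln: "(\<lambda>n. Ln (Complex R (\<delta> n)) - Ln (Complex (- R) (\<delta> n))) \<longlonglongrightarrow> - \<i> * pi"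
      using R by simp
    have eqH: "H (Complex R (\<delta> n)) - H (Complex (- R) (\<delta> n)) = \<beta> * (Ln (Complex R (\<delta> n)) - Ln (Complex (- R) (\<delta> n))) +
      ((\<Sum>a<A. e a * (Complex R (\<delta> n)) ^ (2 * a + 2) / of_nat (2 * a + 2)) - (\<Sum>a<A. e a * (Complex (- R) (\<delta> n)) ^ (2 * a + 2) / of_nat (2 * a + 2)))" for n
      unfolding H_def by (simp add: algebra_simps)
    have "(\<lambda>n. H (Complex R (\<delta> n)) - H (Complex (- R) (\<delta> n))) \<longlonglongrightarrow> \<beta> * (- \<i> * pi) +
      ((\<Sum>a<A. e a * of_real R ^ (2 * a + 2) / of_nat (2 * a + 2)) - (\<Sum>a<A. e a * of_real (- R) ^ (2 * a + 2) / of_nat (2 * a + 2)))"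
      unfolding eqH by (intro tendsto_add tendsto_mult tendsto_const tendsto_diff Ln even)
    \<comment> \<open>The even powers agree at R and -R. The logarithm leaves -i pi \<beta>, whose
      real part is pi times Im \<beta>.\<close>
    hence L2: "(\<lambda>n. H (Complex R (\<delta> n)) - H (Complex (- R) (\<delta> n))) \<longlonglongrightarrow> \<beta> * (- \<i> * pi)" by simp
    have "(\<lambda>n. \<bar>2 * integral {0..R} (f n) - Re (H (Complex R (\<delta> n)) - H (Complex (- R) (\<delta> n)))\<bar>) \<longlonglongrightarrow>
       \<bar>2 * (LINT t:{0..R}|lborel. Re (F0 t)) - Re (\<beta> * (- \<i> * pi))\<bar>"
      unfolding I by (intro tendsto_intros L1 L2)
    moreover have "\<bar>2 * integral {0..R} (f n) - Re (H (Complex R (\<delta> n)) - H (Complex (- R) (\<delta> n)))\<bar> \<le> 4 * C / R" for n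
      unfolding f_def by (rule upper_half_plane_line_integral[OF hol sym expansion H_def R \<delta>])
    ultimately have "\<bar>2 * (LINT t:{0..R}|lborel. Re (F0 t)) - Re (\<beta> * (- \<i> * pi))\<bar> \<le> 4 * C / R"
      by (intro tendsto_upperbound[OF _ always_eventually]) auto
    thus ?thesis by (simp add: mult.commute)
  qed
  have T: "((\<lambda>R. LINT t:{0..R}|lborel. Re (F0 t)) \<longlongrightarrow> (LINT t:{0..}|lborel. Re (F0 t))) at_top"
    by (rule tendsto_set_lebesgue_integral_at_top[OF _ int0]) simp
  have "((\<lambda>R. 2 * (LINT t:{0..R}|lborel. Re (F0 t)) - pi * Im \<beta>) \<longlongrightarrow> 0) at_top"
  proof (rule Lim_null_comparison)
    show "\<forall>\<^sub>F R in at_top. norm (2 * (LINT t:{0..R}|lborel. Re (F0 t)) - pi * Im \<beta>) \<le> 4 * C / R"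
      using eventually_ge_at_top[of 1] by eventually_elim (use key in simp)
    show "((\<lambda>R. 4 * C / R) \<longlongrightarrow> 0) at_top" by real_asymp
  qed
  moreover have "((\<lambda>R. 2 * (LINT t:{0..R}|lborel. Re (F0 t)) - pi * Im \<beta>) \<longlongrightarrow> 2 * (LINT t:{0..}|lborel. Re (F0 t)) - pi * Im \<beta>) at_top"
    by (intro tendsto_intros T)
  ultimately have "2 * (LINT t:{0..}|lborel. Re (F0 t)) - pi * Im \<beta> = 0"
    using tendsto_unique trivial_limit_at_top_linorder by blast
  moreover have "(LINT t:{0<..}|lborel. Re (F0 t)) = (LINT t:{0..}|lborel. Re (F0 t))"
    unfolding set_lebesgue_integral_def
    by (intro integral_discrete_difference[where X = "{0}"]) (auto simp: indicator_def)
  ultimately show ?thesis by simp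
qed

subsection \<open>Bounds for the Bessel functions\<close>

lemma bessel_K0_nonneg: "bessel_K0 t \<ge> 0"
  unfolding bessel_K0_def set_lebesgue_integral_def by (rule integral_nonneg_AE) simp

lemma bessel_I0_nonneg: "bessel_I0 t \<ge> 0"
  unfolding bessel_I0_def set_lebesgue_integral_def by (intro mult_nonneg_nonneg integral_nonneg_AE) simp_all

lemma bessel_I0_le_exp:
  assumes "t > 0"
  shows "pi * bessel_I0 t \<le> pi * exp t"
proof -
  have "(LINT \<theta>:{0..pi}|lborel. exp (t * cos \<theta>)) \<le> (LINT \<theta>:{0..pi}|lborel. exp t)"
    by (rule set_integral_mono)
       (use assms in \<open>auto intro!: borel_integrable_atLeastAtMost' continuous_intros\<close>)
  also have "\<dots> = pi * exp t" by (simp add: set_lebesgue_integral_def)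
  finally show ?thesis by (simp add: bessel_I0_def)
qed

lemma borel_measurable_bessel_I0 [measurable]: "bessel_I0 \<in> borel_measurable borel"
  unfolding bessel_I0_def set_lebesgue_integral_def by measurable

lemma borel_measurable_bessel_K0 [measurable]: "bessel_K0 \<in> borel_measurable borel"
  unfolding bessel_K0_def set_lebesgue_integral_def cosh_def by measurable

lemma Im_quotient_Complex_neq_0:
  assumes "t > 0" "\<delta> > 0" "\<epsilon> = 1 \<or> \<epsilon> = - 1"
  shows "Im (\<epsilon> / (4 * Complex t \<delta>)) \<noteq> 0"
proof -
  have "16 * t\<^sup>2 + 16 * \<delta>\<^sup>2 > 0" using assms by (simp add: add_pos_pos)
  thus ?thesis using assms by (auto simp: Im_divide)
qed

text \<open>The boundary value sqrt(2t/pi) e^t K0(t) inherits both bounds on V by passing to the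
  limit. The plain bound gives the first estimate, the one by sqrt s the second, whose weaker
  singularity is needed near 0.\<close>

lemma bessel_K0_bounds:
  obtains C where "C \<ge> 0"
    and "\<And>t. t > 0 \<Longrightarrow> t * (bessel_K0 t)\<^sup>2 \<le> C * exp (- 2 * t)"
    and "\<And>t. t > 0 \<Longrightarrow> (bessel_K0 t)\<^sup>2 \<le> C * t powr (- 1 / 2) * exp (- 2 * t)"
proof -
  obtain M where M: "M \<ge> 0"
    "\<And>\<eta>. Im \<eta> \<noteq> 0 \<Longrightarrow> norm (gauss_transform \<eta>) \<le> M"
    "\<And>\<eta> s. Im \<eta> \<noteq> 0 \<Longrightarrow> s > 0 \<Longrightarrow> norm \<eta> = 1 / s\<^sup>2 \<Longrightarrow> norm (gauss_transform \<eta>) \<le> M * sqrt s"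
    using gauss_transform_bounds by metis
  have main: "t * (bessel_K0 t)\<^sup>2 \<le> (pi * M\<^sup>2) * exp (- 2 * t) \<and>
      (bessel_K0 t)\<^sup>2 \<le> (pi * M\<^sup>2) * t powr (- 1 / 2) * exp (- 2 * t)" if t: "t > 0" for t
  proof -
    define \<eta> where "\<eta> = (\<lambda>n. 1 / (4 * Complex t (1 / (real n + 2))))"
    define s where "s = (\<lambda>n. 2 * sqrt (norm (Complex t (1 / (real n + 2)))))"
    define k where "k = sqrt (2 * t / pi) * exp t * bessel_K0 t"
    have k0: "k \<ge> 0" using t bessel_K0_nonneg by (simp add: k_def)
    have Im: "Im (\<eta> n) \<noteq> 0" for n
      unfolding \<eta>_def by (rule Im_quotient_Complex_neq_0) (use t in auto)
    have z: "Complex t (1 / (real n + 2)) \<noteq> 0" for n using t by (auto simp: complex_eq_iff)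
    have s: "s n > 0" "norm (\<eta> n) = 1 / (s n)\<^sup>2" for n
      using z[of n] by (auto simp: s_def \<eta>_def norm_divide norm_mult power_mult_distrib)
    have "(\<lambda>n. norm (gauss_transform (\<eta> n))) \<longlonglongrightarrow> norm (of_real k :: complex)"
      unfolding k_def \<eta>_def by (intro tendsto_norm gauss_transform_tendsto_K0 t)
    hence lim: "(\<lambda>n. norm (gauss_transform (\<eta> n))) \<longlonglongrightarrow> k" using k0 by simp
    have k1: "k \<le> M"
      by (rule tendsto_upperbound[OF lim]) (use M(2)[OF Im] in auto)
    have "s \<longlonglongrightarrow> 2 * sqrt (norm (of_real t :: complex))"
      unfolding s_def by (intro tendsto_intros tendsto_Complex_boundary)
    hence lim2: "(\<lambda>n. M * sqrt (s n)) \<longlonglongrightarrow> M * sqrt (2 * sqrt t)"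
      using t by (intro tendsto_intros) simp
    have k2: "k \<le> M * sqrt (2 * sqrt t)"
      by (rule tendsto_le[OF sequentially_bot lim2 lim]) (use M(3)[OF Im s] in auto)
    have ksq: "k\<^sup>2 = 2 / pi * (t * (bessel_K0 t)\<^sup>2 * exp (2 * t))"
      using t by (simp add: k_def power_mult_distrib exp_double)
    have "k\<^sup>2 \<le> M\<^sup>2" using k0 k1 by (intro power_mono)
    hence "t * (bessel_K0 t)\<^sup>2 * exp (2 * t) \<le> pi / 2 * M\<^sup>2" unfolding ksq by (simp add: field_simps)
    also have "\<dots> \<le> pi * M\<^sup>2" by simp
    finally have 1: "t * (bessel_K0 t)\<^sup>2 \<le> (pi * M\<^sup>2) * exp (- 2 * t)" by (simp add: exp_minus field_simps)
    have "k\<^sup>2 \<le> (M * sqrt (2 * sqrt t))\<^sup>2" using k0 k2 by (intro power_mono)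
    also have "\<dots> = 2 * M\<^sup>2 * sqrt t" using t by (simp add: power_mult_distrib)
    finally have "t * ((bessel_K0 t)\<^sup>2 * exp (2 * t)) \<le> t * (pi * M\<^sup>2 * (sqrt t / t))"
      unfolding ksq using t by (simp add: field_simps)
    hence "(bessel_K0 t)\<^sup>2 * exp (2 * t) \<le> pi * M\<^sup>2 * (sqrt t / t)"
      using t by (simp only: mult_le_cancel_left_pos)
    also have "sqrt t / t = t powr (- 1 / 2)"
      using t powr_diff[of t "1 / 2" 1] by (simp add: powr_half_sqrt)
    finally have 2: "(bessel_K0 t)\<^sup>2 \<le> (pi * M\<^sup>2) * t powr (- 1 / 2) * exp (- 2 * t)"
      by (simp add: exp_minus field_simps)
    show ?thesis using 1 2 by blast
  qed
  show ?thesis by (rule that[of "pi * M\<^sup>2"]) (use main in auto)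
qed

text \<open>The product contains q + 1 factors K0^2. The estimate with weight t is applied to q of
  them and the one with t^(-1/2) to the last, leaving t^(d - 1/2). Since l >= 1 gives m - l <= q,
  the growth of the I0 factors is beaten with at least exp(-2t) to spare.\<close>

lemma set_integrable_bessel_moment:
  assumes l: "l \<in> {1..m}" and n: "n > 0"
  shows "set_integrable lborel {0<..} (\<lambda>t. (pi * bessel_I0 t) ^ (2 * (m - l)) * bessel_K0 t ^ (2 * (m + l - 1)) *
           (2 * t) ^ (2 * (n + m - 2)))"
proof -
  obtain C where C: "C \<ge> 0" "\<And>t. t > 0 \<Longrightarrow> t * (bessel_K0 t)\<^sup>2 \<le> C * exp (- 2 * t)"
    "\<And>t. t > 0 \<Longrightarrow> (bessel_K0 t)\<^sup>2 \<le> C * t powr (- 1 / 2) * exp (- 2 * t)"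
    using bessel_K0_bounds by metis
  define q where "q = m + l - 2"
  \<comment> \<open>The subtraction does not truncate: d = 2(n - 1) + (m - l), by n >= 1 and l <=
    m.\<close>
  define d where "d = 2 * (n + m - 2) - q"
  have qd: "m + l - 1 = Suc q" "2 * (n + m - 2) = q + d" and ml: "m - l \<le> q" using l n by (auto simp: q_def d_def)
  define A where "A = pi ^ (2 * (m - l)) * 2 ^ (q + d) * C ^ Suc q"
  \<comment> \<open>The majorant is the integrand of the Gamma function at d + 1/2.\<close>
  have "(\<lambda>t. t powr ((real d + 1 / 2) - 1) / exp t) absolutely_integrable_on {0..}"
    using Gamma_integral_real[of "real d + 1 / 2"]
    by (intro nonnegative_absolutely_integrable_1) (auto simp: has_integral_integrable)
  hence "set_integrable lborel {0..} (\<lambda>t. t powr ((real d + 1 / 2) - 1) / exp t)"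
    unfolding set_integrable_def by (subst (asm) integrable_completion) auto
  hence "set_integrable lborel {0<..} (\<lambda>t. t powr ((real d + 1 / 2) - 1) / exp t)"
    by (rule set_integrable_subset) auto
  hence "set_integrable lborel {0<..} (\<lambda>t. A * (t powr ((real d + 1 / 2) - 1) / exp t))"
    by (intro set_integrable_mult_right)
  hence "integrable lborel (\<lambda>t. indicator {0<..} t *\<^sub>R (A * (t powr ((real d + 1 / 2) - 1) / exp t)))"
    by (simp only: set_integrable_def)
  thus ?thesis unfolding set_integrable_def
  proof (rule Bochner_Integration.integrable_bound)
    show "AE t in lborel. norm (indicator {0<..} t *\<^sub>R ((pi * bessel_I0 t) ^ (2 * (m - l)) * bessel_K0 t ^ (2 * (m + l - 1)) *
           (2 * t) ^ (2 * (n + m - 2)))) \<le> norm (indicator {0<..} t *\<^sub>R (A * (t powr ((real d + 1 / 2) - 1) / exp t)))"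
    proof (rule AE_I2)
      fix t :: real
      show "norm (indicator {0<..} t *\<^sub>R ((pi * bessel_I0 t) ^ (2 * (m - l)) * bessel_K0 t ^ (2 * (m + l - 1)) *
           (2 * t) ^ (2 * (n + m - 2)))) \<le> norm (indicator {0<..} t *\<^sub>R (A * (t powr ((real d + 1 / 2) - 1) / exp t)))"
      proof (cases "t > 0")
        case t: True
        let ?I = "pi * bessel_I0 t" and ?K = "bessel_K0 t"
        have I: "?I ^ (2 * (m - l)) \<le> (pi * exp t) ^ (2 * (m - l))"
          using bessel_I0_le_exp[OF t] bessel_I0_nonneg by (intro power_mono) auto
        have K1: "(t * ?K\<^sup>2) ^ q \<le> (C * exp (- 2 * t)) ^ q"
          using C(2)[OF t] t by (intro power_mono) auto
        have "?I ^ (2 * (m - l)) * ((t * ?K\<^sup>2) ^ q * ?K\<^sup>2) \<le>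
            (pi * exp t) ^ (2 * (m - l)) * ((C * exp (- 2 * t)) ^ q * (C * t powr (- 1 / 2) * exp (- 2 * t)))"
          using t C(1) bessel_I0_nonneg[of t]
          by (intro mult_mono I K1 C(3)) (auto intro!: mult_nonneg_nonneg)
        also have "\<dots> = pi ^ (2 * (m - l)) * C ^ Suc q * t powr (- 1 / 2) * (exp t ^ (2 * (m - l)) * exp (- 2 * t) ^ q * exp (- 2 * t))"
          by (simp add: power_mult_distrib)
        also have "exp t ^ (2 * (m - l)) * exp (- 2 * t) ^ q * exp (- 2 * t) = exp (real (2 * (m - l)) * t + real q * (- 2 * t) + - 2 * t)"
          by (simp only: exp_add exp_of_nat_mult)
        also have "pi ^ (2 * (m - l)) * C ^ Suc q * t powr (- 1 / 2) * \<dots> \<le> pi ^ (2 * (m - l)) * C ^ Suc q * t powr (- 1 / 2) * exp (- t)"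
        proof (intro mult_left_mono)
          have "real (m - l) * t \<le> real q * t" using ml t by (intro mult_right_mono) auto
          moreover have "real (2 * (m - l)) * t + real q * (- 2 * t) + - 2 * t = 2 * (real (m - l) * t) - 2 * (real q * t) - 2 * t"
            by simp
          ultimately have "real (2 * (m - l)) * t + real q * (- 2 * t) + - 2 * t \<le> - t" using t by linarith
          thus "exp (real (2 * (m - l)) * t + real q * (- 2 * t) + - 2 * t) \<le> exp (- t)" by (simp only: exp_le_cancel_iff)
        qed (use C in auto)
        finally have "?I ^ (2 * (m - l)) * ((t * ?K\<^sup>2) ^ q * ?K\<^sup>2) \<le> pi ^ (2 * (m - l)) * C ^ Suc q * t powr (- 1 / 2) * exp (- t)" .
        hence "(2 ^ (q + d) * t ^ d) * (?I ^ (2 * (m - l)) * ((t * ?K\<^sup>2) ^ q * ?K\<^sup>2)) \<le>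
           (2 ^ (q + d) * t ^ d) * (pi ^ (2 * (m - l)) * C ^ Suc q * t powr (- 1 / 2) * exp (- t))"
          using t by (intro mult_left_mono) auto
        also have "(2 ^ (q + d) * t ^ d) * (?I ^ (2 * (m - l)) * ((t * ?K\<^sup>2) ^ q * ?K\<^sup>2)) =
            ?I ^ (2 * (m - l)) * ?K ^ (2 * (m + l - 1)) * (2 * t) ^ (2 * (n + m - 2))"
          unfolding qd by (simp add: power_mult_distrib power_add power_mult power2_eq_square mult_ac)
        also have "(2 ^ (q + d) * t ^ d) * (pi ^ (2 * (m - l)) * C ^ Suc q * t powr (- 1 / 2) * exp (- t)) =
            A * (t powr ((real d + 1 / 2) - 1) / exp t)"
        proof -
          have "t ^ d * t powr (- 1 / 2) = t powr (real d + - 1 / 2)"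
            unfolding powr_add using t by (simp add: powr_realpow)
          thus ?thesis by (simp add: A_def exp_minus field_simps)
        qed
        finally have "?I ^ (2 * (m - l)) * ?K ^ (2 * (m + l - 1)) * (2 * t) ^ (2 * (n + m - 2)) \<le> A * (t powr ((real d + 1 / 2) - 1) / exp t)" .
        moreover have "0 \<le> ?I ^ (2 * (m - l)) * ?K ^ (2 * (m + l - 1)) * (2 * t) ^ (2 * (n + m - 2))"
          by (simp add: zero_le_even_power)
        ultimately have "norm (?I ^ (2 * (m - l)) * ?K ^ (2 * (m + l - 1)) * (2 * t) ^ (2 * (n + m - 2))) \<le>
            norm (A * (t powr ((real d + 1 / 2) - 1) / exp t))"
          unfolding real_norm_def by linarith
        thus ?thesis using t by simp
      qed simp
    qed
  qed measurable
qed

subsection \<open>The continued product of Bessel functions\<close>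

text \<open>This is K0(z) K0(-z) with K0 written through V: the exponentials cancel, and
  continuation through the upper half plane gives sqrt(-z) = -i sqrt z, hence the prefactor i
  pi/(2z).\<close>

definition bessel_product :: "complex \<Rightarrow> complex" where
  "bessel_product z = \<i> * of_real pi / (2 * z) * (gauss_transform (1 / (4 * z)) * gauss_transform (- (1 / (4 * z))))"

lemma Im_inverse_neg:
  assumes "Im z > 0"
  shows "Im (1 / (4 * z)) < 0"
proof -
  have "Im (1 / (4 * z)) = - (4 * Im z) / ((4 * Re z)\<^sup>2 + (4 * Im z)\<^sup>2)"
    by (simp add: Im_divide)
  also have "\<dots> < 0" using assms by (intro divide_neg_pos add_nonneg_pos) auto
  finally show ?thesis .
qed

lemma gauss_transform_cnj: "Im \<eta> \<noteq> 0 \<Longrightarrow> gauss_transform (cnj \<eta>) = cnj (gauss_transform \<eta>)"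
proof -
  assume "Im \<eta> \<noteq> 0"
  hence "gauss_kernel (cnj \<eta>) x = cnj (gauss_kernel \<eta> x)" for x
    unfolding gauss_kernel_def using cnj_csqrt[OF one_plus_mult_square_not_nonpos, of \<eta> x] by simp
  hence "gauss_kernel (cnj \<eta>) = (\<lambda>x. cnj (gauss_kernel \<eta> x))" by blast
  thus ?thesis unfolding gauss_transform_def by (simp only: Bochner_Integration.integral_cnj)
qed

text \<open>Reflection in the imaginary axis sends 1/(4z) to minus its conjugate, so the two V
  factors change places and are conjugated.\<close>

lemma bessel_product_cnj:
  assumes "Im z > 0"
  shows "bessel_product (- cnj z) = cnj (bessel_product z)"
proof -
  note Im = Im_inverse_neg[OF assms]
  have 1: "1 / (4 * - cnj z) = cnj (- (1 / (4 * z)))" and 2: "- (1 / (4 * - cnj z)) = cnj (1 / (4 * z))" by simp_all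
  have "gauss_transform (1 / (4 * - cnj z)) = cnj (gauss_transform (- (1 / (4 * z))))"
    unfolding 1 by (rule gauss_transform_cnj) (use Im in simp)
  moreover have "gauss_transform (- (1 / (4 * - cnj z))) = cnj (gauss_transform (1 / (4 * z)))"
    unfolding 2 by (rule gauss_transform_cnj) (use Im in simp)
  ultimately show ?thesis unfolding bessel_product_def by (simp add: mult_ac)
qed

lemma holomorphic_on_bessel_product: "bessel_product holomorphic_on {z. Im z > 0}"
proof -
  have 1: "gauss_transform holomorphic_on {\<eta>. Im \<eta> < 0}"
    by (rule holomorphic_on_gauss_transform) (auto intro: open_halfspace_Im_lt convex_halfspace_Im_lt)
  have 2: "gauss_transform holomorphic_on {\<eta>. Im \<eta> > 0}"
    by (rule holomorphic_on_gauss_transform) (auto intro: open_halfspace_Im_gt convex_halfspace_Im_gt)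
  have 3: "(\<lambda>z. 1 / (4 * z)) holomorphic_on {z. Im z > 0}"
    by (intro holomorphic_intros) auto
  have 4: "(\<lambda>z. - (1 / (4 * z))) holomorphic_on {z. Im z > 0}"
    by (intro holomorphic_intros) auto
  have 5: "(\<lambda>z. gauss_transform (1 / (4 * z))) holomorphic_on {z. Im z > 0}"
    using holomorphic_on_compose_gen[OF 3 1] Im_inverse_neg by (auto simp: o_def)
  have 6: "(\<lambda>z. gauss_transform (- (1 / (4 * z)))) holomorphic_on {z. Im z > 0}"
  proof -
    have "(\<lambda>z. - (1 / (4 * z))) ` {z. Im z > 0} \<subseteq> {\<eta>. Im \<eta> > 0}"
      by (intro image_subsetI) (use Im_inverse_neg in \<open>simp only: mem_Collect_eq uminus_complex.sel neg_0_less_iff_less\<close>)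
    from holomorphic_on_compose_gen[OF 4 2 this] show ?thesis by (simp only: o_def)
  qed
  show ?thesis unfolding bessel_product_def
    by (intro holomorphic_on_mult holomorphic_on_divide holomorphic_on_const holomorphic_on_id[unfolded id_def] 5 6) auto
qed

text \<open>Each V factor is O(|z|^(1/4)), against the prefactor of order 1/|z|.\<close>

lemma norm_bessel_product_le:
  obtains C where "C \<ge> 0" and "\<And>z. Im z > 0 \<Longrightarrow> norm (bessel_product z) \<le> C / sqrt (norm z)"
proof -
  obtain M where M: "M \<ge> 0"
    "\<And>\<eta> s. Im \<eta> \<noteq> 0 \<Longrightarrow> s > 0 \<Longrightarrow> norm \<eta> = 1 / s\<^sup>2 \<Longrightarrow> norm (gauss_transform \<eta>) \<le> M * sqrt s"
    using gauss_transform_bounds by metis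
  have "norm (bessel_product z) \<le> pi * M\<^sup>2 / sqrt (norm z)" if z: "Im z > 0" for z
  proof -
    define s where "s = 2 * sqrt (norm z)"
    have "z \<noteq> 0" using z by auto
    hence r: "norm z > 0" by simp
    have s: "s > 0" "norm (1 / (4 * z)) = 1 / s\<^sup>2" "norm (- (1 / (4 * z))) = 1 / s\<^sup>2"
      using r by (auto simp: s_def norm_divide norm_mult power_mult_distrib)
    have Im: "Im (1 / (4 * z)) \<noteq> 0" "Im (- (1 / (4 * z))) \<noteq> 0" using Im_inverse_neg[OF z] by auto
    have "norm (bessel_product z) \<le> pi / (2 * norm z) * ((M * sqrt s) * (M * sqrt s))"
      unfolding bessel_product_def norm_mult norm_divide
      using M(2)[OF Im(1) s(1,2)] M(2)[OF Im(2) s(1,3)] M(1) s(1)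
      by (intro mult_mono) auto
    also have "(M * sqrt s) * (M * sqrt s) = M\<^sup>2 * s" using s(1) by (simp add: power2_eq_square mult_ac)
    also have "pi / (2 * norm z) * (M\<^sup>2 * s) = pi * M\<^sup>2 * (sqrt (norm z) / norm z)" by (simp add: s_def)
    also have "sqrt (norm z) / norm z = 1 / sqrt (norm z)" using r by (simp add: field_simps)
    finally show ?thesis by simp
  qed
  thus ?thesis using that[of "pi * M\<^sup>2"] by simp
qed

text \<open>Multiply the two boundary values of V: the exponentials cancel, pi/(2t) meets 2t/pi, and
  i (pi I0 - i K0) = K0 + i pi I0.\<close>

lemma bessel_product_boundary_limit:
  assumes t: "t > 0"
  shows "(\<lambda>n. bessel_product (Complex t (1 / (real n + 2)))) \<longlonglongrightarrow>
     of_real (bessel_K0 t) * (of_real (bessel_K0 t) + \<i> * of_real (pi * bessel_I0 t))"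
proof -
  define a where "a = sqrt (2 * t / pi)"
  have "(\<lambda>n. bessel_product (Complex t (1 / (real n + 2)))) \<longlonglongrightarrow> \<i> * of_real pi / (2 * of_real t) *
     (of_real (a * exp t * bessel_K0 t) * (of_real (a * exp (- t)) * (of_real (pi * bessel_I0 t) - \<i> * of_real (bessel_K0 t))))"
    unfolding bessel_product_def a_def
    by (intro tendsto_mult tendsto_divide tendsto_const tendsto_Complex_boundary gauss_transform_tendsto_K0[OF t]
          gauss_transform_tendsto_I0_K0[OF t, unfolded divide_minus_left])
       (use t in auto)
  also have "\<i> * of_real pi / (2 * of_real t) *
     (of_real (a * exp t * bessel_K0 t) * (of_real (a * exp (- t)) * (of_real (pi * bessel_I0 t) - \<i> * of_real (bessel_K0 t)))) =
     of_real (pi / (2 * t) * a\<^sup>2 * (exp t * exp (- t))) * (of_real (bessel_K0 t) * (\<i> * of_real (pi * bessel_I0 t) - \<i> * \<i> * of_real (bessel_K0 t)))"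
  proof -
    have "i * D * ((A * E * K) * ((A * E') * (J - i * K))) = (D * (A * A) * (E * E')) * (K * (i * J - i * i * K))"
      for i D A E E' J K :: complex by (simp add: algebra_simps)
    from this[of \<i> "of_real pi / (2 * of_real t)"] show ?thesis
      by (simp only: of_real_mult of_real_divide of_real_numeral power2_eq_square times_divide_eq_right)
  qed
  also have "pi / (2 * t) * a\<^sup>2 * (exp t * exp (- t)) = 1"
    using t by (simp add: a_def flip: exp_add)
  finally show ?thesis by (simp add: add.commute)
qed

section \<open>From the alternating sum to a coefficient of a power series\<close>

lemma sum_lessThan_double: "(\<Sum>k<2 * m. g k) = (\<Sum>j<m. g (2 * j) + g (Suc (2 * j)) :: 'a :: comm_monoid_add)"
  by (induction m) (simp_all add: add.assoc)

lemma Re_power_odd: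
  fixes x y :: real
  shows "Re ((of_real x + \<i> * of_real y) ^ (2 * m + 1)) =
    (\<Sum>j<Suc m. (- 1) ^ j * real ((2 * m + 1) choose (2 * j)) * y ^ (2 * j) * x ^ (2 * m + 1 - 2 * j))"
proof -
  define N where "N = 2 * m + 1"
  define g where "g = (\<lambda>k. Re (of_nat (N choose k) * (\<i> * of_real y) ^ k * of_real x ^ (N - k)))"
  have "Re ((of_real x + \<i> * of_real y) ^ N) = (\<Sum>k\<le>N. g k)"
    unfolding g_def add.commute[of "of_real x"] binomial_ring by simp
  also have "{..N} = {..<2 * Suc m}" by (auto simp: N_def)
  also have "(\<Sum>k<2 * Suc m. g k) = (\<Sum>j<Suc m. g (2 * j) + g (Suc (2 * j)))"
    by (rule sum_lessThan_double)
  also have "\<dots> = (\<Sum>j<Suc m. (- 1) ^ j * real (N choose (2 * j)) * y ^ (2 * j) * x ^ (N - 2 * j))"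
  proof (intro sum.cong refl)
    fix j
    have e: "(\<i> * of_real y) ^ (2 * j) = (of_real ((- 1) ^ j * y ^ (2 * j)) :: complex)"
    proof -
      have "(\<i> * of_real y) ^ (2 * j) = ((\<i> * of_real y)\<^sup>2 :: complex) ^ j" by (rule power_mult)
      also have "(\<i> * of_real y)\<^sup>2 = (of_real ((- 1) * y\<^sup>2) :: complex)" by (simp add: power_mult_distrib)
      also have "(of_real ((- 1) * y\<^sup>2) :: complex) ^ j = of_real (((- 1) * y\<^sup>2) ^ j)" by (rule of_real_power[symmetric])
      also have "((- 1) * y\<^sup>2) ^ j = (- 1) ^ j * y ^ (2 * j)" by (simp only: power_mult_distrib power_mult)
      finally show ?thesis .
    qed
    have "g (2 * j) = Re (of_real (real (N choose (2 * j)) * ((- 1) ^ j * y ^ (2 * j)) * x ^ (N - 2 * j)))"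
      unfolding g_def e by simp
    moreover have "g (Suc (2 * j)) = Re (\<i> * of_real (real (N choose Suc (2 * j)) * y * ((- 1) ^ j * y ^ (2 * j)) * x ^ (N - Suc (2 * j))))"
      unfolding g_def power_Suc e by (simp add: mult_ac)
    ultimately show "g (2 * j) + g (Suc (2 * j)) = (- 1) ^ j * real (N choose (2 * j)) * y ^ (2 * j) * x ^ (N - 2 * j)"
      by (simp only: Re_complex_of_real Re_i_times Im_complex_of_real) simp
  qed
  finally show ?thesis by (simp only: N_def)
qed

text \<open>Reverse the binomial sum by j = Suc m - l. The symmetry of the binomial turns the even
  lower index 2j into 2l - 1, and reversing the alternating sign leaves the global factor
  (-1)^m.\<close>

lemma alternating_bessel_sum:
  fixes I K T :: real
  shows "(\<Sum>l = 1..Suc m. (- 1) ^ (l - 1) * real ((2 * Suc m - 1) choose (2 * l - 1)) *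
       (I ^ (2 * (Suc m - l)) * K ^ (2 * (Suc m + l - 1)) * T)) =
     (- 1) ^ m * Re (of_real T * (of_real K * (of_real K + \<i> * of_real I)) ^ (2 * m + 1))"
proof -
  define f where "f = (\<lambda>l. (- 1) ^ (l - 1) * real ((2 * Suc m - 1) choose (2 * l - 1)) *
       (I ^ (2 * (Suc m - l)) * K ^ (2 * (Suc m + l - 1)) * T))"
  define g where "g = (\<lambda>j. (- 1) ^ m * (T * K ^ (2 * m + 1)) * ((- 1) ^ j * real ((2 * m + 1) choose (2 * j)) * I ^ (2 * j) * K ^ (2 * m + 1 - 2 * j)))"
  have "of_real T * (of_real K * (of_real K + \<i> * of_real I)) ^ (2 * m + 1) =
      of_real (T * K ^ (2 * m + 1)) * (of_real K + \<i> * of_real I :: complex) ^ (2 * m + 1)"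
    by (simp only: power_mult_distrib of_real_mult of_real_power mult.assoc)
  hence "(- 1) ^ m * Re (of_real T * (of_real K * (of_real K + \<i> * of_real I)) ^ (2 * m + 1)) =
     (- 1) ^ m * ((T * K ^ (2 * m + 1)) * Re ((of_real K + \<i> * of_real I) ^ (2 * m + 1)))"
    by (simp only: Re_complex_of_real Im_complex_of_real times_complex.sel) simp
  also have "\<dots> = (\<Sum>j<Suc m. g j)"
    unfolding Re_power_odd g_def sum_distrib_left by (simp only: mult.assoc)
  also have "\<dots> = (\<Sum>i<Suc m. g (Suc m - Suc i))" by (rule sum.nat_diff_reindex[symmetric])
  also have "\<dots> = (\<Sum>i<Suc m. f (Suc i))"
  proof (intro sum.cong refl)
    fix i assume "i \<in> {..<Suc m}"
    then obtain r where m: "m = i + r" using le_Suc_ex[of i m] by auto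
    have c: "(2 * (i + r) + 1) choose (2 * r) = (2 * (i + r) + 1) choose (2 * i + 1)"
      using binomial_symmetric[of "2 * r" "2 * (i + r) + 1"] by simp
    have s: "(- 1) ^ (i + r) * (- 1) ^ r = ((- 1) ^ i :: real)"
      by (simp add: power_add mult.assoc flip: power_mult_distrib)
    have k: "K ^ (2 * (i + r) + 1) * K ^ (2 * i + 1) = K ^ (2 * (2 * i + r + 1))"
    proof -
      have "2 * (i + r) + 1 + (2 * i + 1) = 2 * (2 * i + r + 1)" by simp
      thus ?thesis by (metis power_add)
    qed
    have "g (Suc m - Suc i) = ((- 1) ^ (i + r) * (- 1) ^ r) * real ((2 * (i + r) + 1) choose (2 * r)) * (I ^ (2 * r) * (K ^ (2 * (i + r) + 1) * K ^ (2 * i + 1)) * T)"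
      by (simp add: g_def m mult_ac)
    also have "\<dots> = f (Suc i)"
      unfolding s c k f_def by (simp add: m algebra_simps)
    finally show "g (Suc m - Suc i) = f (Suc i)" .
  qed
  also have "\<dots> = (\<Sum>l = 1..Suc m. f l)"
    by (rule sum.reindex_bij_witness[of _ "\<lambda>l. l - 1" Suc]) auto
  finally show ?thesis by (simp only: f_def)
qed

text \<open>After the prefactors, z^(2n - 1) multiplies a series in even powers of 1/(4z). Cutting
  at order 2n + 1 leaves odd positive powers, the single term \<beta>/z at index 2n, and a remainder
  O(1/|z|^2); 16^n is 4^(2n).\<close>

lemma bessel_product_power_expansion:
  fixes m n :: nat
  defines "B \<equiv> fps_nth (Abs_fps K0_product_coeff ^ (2 * m + 1)) (2 * n)"
  defines "\<beta> \<equiv> (\<i> * of_real pi / 2) ^ (2 * m + 1) * of_nat B / 16 ^ n"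
  obtains C e where "\<And>z. Im z > 0 \<Longrightarrow> norm z \<ge> 1 \<Longrightarrow>
    norm (z ^ (2 * (n + m)) * bessel_product z ^ (2 * m + 1) - (\<beta> / z + (\<Sum>a<n. e a * z ^ (2 * a + 1)))) \<le> C / (norm z)\<^sup>2"
proof -
  define N where "N = 2 * m + 1"
  define c where "c = (\<i> * of_real pi / 2 :: complex) ^ N"
  define b where "b = (\<lambda>k. fps_nth (Abs_fps K0_product_coeff ^ N) k)"
  define W where "W = (\<lambda>\<eta>. gauss_transform \<eta> * gauss_transform (- \<eta>))"
  \<comment> \<open>Index reversal: the term of order 2j produces z^(2(n-j) - 1), so j = n - Suc
    a.\<close>
  define e where "e = (\<lambda>a. c * of_nat (b (2 * (n - Suc a))) / 16 ^ (n - Suc a))"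
  have "has_expansion_at_0 (\<lambda>\<eta>. W \<eta> ^ N) (Abs_fps (\<lambda>k. of_nat (K0_product_coeff k)) ^ N)"
    unfolding W_def by (rule has_expansion_at_0_power[OF has_expansion_gauss_transform_product])
  then obtain C where C: "\<And>\<eta>. Im \<eta> < 0 \<Longrightarrow> norm \<eta> \<le> 1 \<Longrightarrow>
      norm (W \<eta> ^ N - (\<Sum>j<2 * n + 1. of_nat (b j) * \<eta> ^ j)) \<le> C * norm \<eta> ^ (2 * n + 1)"
    unfolding has_expansion_at_0_def fps_power_of_nat_nth b_def by blast
  have odd: "b (Suc (2 * j)) = 0" for j
    unfolding b_def by (rule fps_power_odd_nth) (auto simp: K0_product_coeff_def)
  have sum_eq: "(\<Sum>j<2 * n + 1. of_nat (b j) * \<eta> ^ j) = (\<Sum>j<n. of_nat (b (2 * j)) * \<eta> ^ (2 * j)) + of_nat (b (2 * n)) * \<eta> ^ (2 * n)"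
    for \<eta> :: complex
    using sum_lessThan_double[of "\<lambda>j. of_nat (b j) * \<eta> ^ j" n] by (simp add: odd)
  have "norm (z ^ (2 * (n + m)) * bessel_product z ^ N - (\<beta> / z + (\<Sum>a<n. e a * z ^ (2 * a + 1)))) \<le>
      (norm c * C / 4 ^ (2 * n + 1)) / (norm z)\<^sup>2" if z: "Im z > 0" "norm z \<ge> 1" for z
  proof -
    define \<eta> where "\<eta> = 1 / (4 * z)"
    have z0: "z \<noteq> 0" using z by auto
    have \<eta>: "Im \<eta> < 0" "norm \<eta> \<le> 1"
      using Im_inverse_neg[OF z(1)] z(2) z0 by (auto simp: \<eta>_def norm_divide norm_mult divide_le_eq)
    have F: "z ^ (2 * (n + m)) * bessel_product z ^ N = c * (z ^ (2 * n) / z) * W \<eta> ^ N"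
    proof -
      have "bessel_product z = (\<i> * of_real pi / 2) / z * W \<eta>" by (simp add: bessel_product_def W_def \<eta>_def)
      hence "bessel_product z ^ N = c / z ^ N * W \<eta> ^ N" by (simp only: power_mult_distrib power_divide c_def)
      moreover have "z ^ (2 * (n + m)) / z ^ N = z ^ (2 * n) / z"
        using z0 by (simp add: N_def power_add field_simps)
      moreover have "u * (c / v * w) = c * (u / v) * w" for u v w by simp
      ultimately show ?thesis by (simp only:)
    qed
    have \<eta>p: "z ^ (2 * n) / z * \<eta> ^ (2 * j) = z ^ (2 * (n - j)) / z / 16 ^ j" if "j \<le> n" for j
    proof -
      have "z ^ (2 * n) = z ^ (2 * (n - j)) * z ^ (2 * j)"
      proof -
        have "2 * n = 2 * (n - j) + 2 * j" using that by simp
        thus ?thesis by (metis power_add)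
      qed
      moreover have "\<eta> ^ (2 * j) = 1 / (16 ^ j * z ^ (2 * j))"
        by (simp add: \<eta>_def power_divide power_mult_distrib power_mult)
      ultimately show ?thesis using z0 by simp
    qed
    have lead: "c * (z ^ (2 * n) / z) * (of_nat (b (2 * n)) * \<eta> ^ (2 * n)) = \<beta> / z"
    proof -
      have "\<beta> = c * of_nat (b (2 * n)) / 16 ^ n" by (simp only: \<beta>_def B_def b_def c_def N_def)
      moreover have "z ^ (2 * n) / z * \<eta> ^ (2 * n) = 1 / z / 16 ^ n" using \<eta>p[of n] by simp
      moreover have "c * (z ^ (2 * n) / z) * (of_nat (b (2 * n)) * \<eta> ^ (2 * n)) =
          c * of_nat (b (2 * n)) * (z ^ (2 * n) / z * \<eta> ^ (2 * n))" by (simp only: mult_ac)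
      ultimately show ?thesis by simp
    qed
    have rest: "c * (z ^ (2 * n) / z) * (\<Sum>j<n. of_nat (b (2 * j)) * \<eta> ^ (2 * j)) = (\<Sum>a<n. e a * z ^ (2 * a + 1))"
    proof -
      have "c * (z ^ (2 * n) / z) * (\<Sum>j<n. of_nat (b (2 * j)) * \<eta> ^ (2 * j)) =
          (\<Sum>a<n. c * (z ^ (2 * n) / z) * (of_nat (b (2 * (n - Suc a))) * \<eta> ^ (2 * (n - Suc a))))"
        unfolding sum_distrib_left by (rule sum.nat_diff_reindex[symmetric])
      also have "\<dots> = (\<Sum>a<n. e a * z ^ (2 * a + 1))"
      proof (intro sum.cong refl)
        fix a assume "a \<in> {..<n}"
        hence "n - (n - Suc a) = Suc a" by auto
        hence "z ^ (2 * n) / z * \<eta> ^ (2 * (n - Suc a)) = z ^ (2 * a + 1) / 16 ^ (n - Suc a)"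
          using \<eta>p[of "n - Suc a"] z0 by simp
        hence "c * of_nat (b (2 * (n - Suc a))) * (z ^ (2 * n) / z * \<eta> ^ (2 * (n - Suc a))) =
           c * of_nat (b (2 * (n - Suc a))) * (z ^ (2 * a + 1) / 16 ^ (n - Suc a))" by (simp only:)
        thus "c * (z ^ (2 * n) / z) * (of_nat (b (2 * (n - Suc a))) * \<eta> ^ (2 * (n - Suc a))) = e a * z ^ (2 * a + 1)"
          unfolding e_def by (simp only: mult_ac times_divide_eq_right times_divide_eq_left)
      qed
      finally show ?thesis .
    qed
    have "z ^ (2 * (n + m)) * bessel_product z ^ N - (\<beta> / z + (\<Sum>a<n. e a * z ^ (2 * a + 1))) =
        c * (z ^ (2 * n) / z) * (W \<eta> ^ N - (\<Sum>j<2 * n + 1. of_nat (b j) * \<eta> ^ j))"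
    proof -
      have "x * w - (x * u + x * v) = x * (w - (v + u))" for x w u v :: complex by (simp add: algebra_simps)
      thus ?thesis unfolding F sum_eq lead[symmetric] rest[symmetric] .
    qed
    also have "norm \<dots> \<le> norm c * (norm z ^ (2 * n) / norm z) * (C * norm \<eta> ^ (2 * n + 1))"
      unfolding norm_mult norm_divide norm_power by (intro mult_left_mono C[OF \<eta>]) auto
    also have "\<dots> = (norm c * C / 4 ^ (2 * n + 1)) / (norm z)\<^sup>2"
    proof -
      have "norm \<eta> ^ (2 * n + 1) = 1 / (4 ^ (2 * n + 1) * (norm z ^ (2 * n) * norm z))"
        by (simp add: \<eta>_def norm_divide norm_mult power_divide power_mult_distrib)
      moreover have "u * (P / r) * (v * (1 / (Q * (P * r)))) = u * v / Q / r\<^sup>2" if "P \<noteq> 0" "r \<noteq> 0" "Q \<noteq> 0" for u v P Q r :: real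
        using that by (simp add: field_simps power2_eq_square)
      ultimately show ?thesis using z0 by (simp add: power2_eq_square)
    qed
    finally show ?thesis .
  qed
  from this[unfolded N_def] show ?thesis by (rule that)
qed

text \<open>Here m and n are one less than in the theorem, so the power of the product is 2m + 1 and
  the power of t is 2(n + m).\<close>

lemma bessel_product_moment:
  fixes m n :: nat
  defines "B \<equiv> fps_nth (Abs_fps K0_product_coeff ^ (2 * m + 1)) (2 * n)"
  defines "F0 \<equiv> \<lambda>t. of_real (t ^ (2 * (n + m))) *
     (of_real (bessel_K0 t) * (of_real (bessel_K0 t) + \<i> * of_real (pi * bessel_I0 t))) ^ (2 * m + 1) :: complex"
  assumes int: "set_integrable lborel {0<..} (\<lambda>t. Re (F0 t))"
  shows "(LINT t:{0<..}|lborel. Re (F0 t)) = (- 1) ^ m * (pi / 2) ^ (2 * m + 2) * real B / 16 ^ n"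
proof -
  define \<beta> :: complex where "\<beta> = (\<i> * of_real pi / 2) ^ (2 * m + 1) * of_nat B / 16 ^ n"
  obtain C e where exp: "\<And>z. Im z > 0 \<Longrightarrow> norm z \<ge> 1 \<Longrightarrow>
    norm (z ^ (2 * (n + m)) * bessel_product z ^ (2 * m + 1) - (\<beta> / z + (\<Sum>a<n. e a * z ^ (2 * a + 1)))) \<le> C / (norm z)\<^sup>2"
    unfolding \<beta>_def B_def using bessel_product_power_expansion[of n m] by blast
  have "(LINT t:{0<..}|lborel. Re (F0 t)) = pi / 2 * Im \<beta>"
  proof (rule boundary_value_integral[OF _ _ exp _ _ int])
    show "(\<lambda>z. z ^ (2 * (n + m)) * bessel_product z ^ (2 * m + 1)) holomorphic_on {z. Im z > 0}"
      by (intro holomorphic_intros holomorphic_on_bessel_product)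
    show "(- cnj z) ^ (2 * (n + m)) * bessel_product (- cnj z) ^ (2 * m + 1) = cnj (z ^ (2 * (n + m)) * bessel_product z ^ (2 * m + 1))"
      if "Im z > 0" for z
      unfolding bessel_product_cnj[OF that] by simp
    show "(\<lambda>k. Complex t (1 / (real k + 2)) ^ (2 * (n + m)) * bessel_product (Complex t (1 / (real k + 2))) ^ (2 * m + 1)) \<longlonglongrightarrow> F0 t"
      if "t > 0" for t
      unfolding F0_def of_real_power
      by (intro tendsto_mult tendsto_power tendsto_Complex_boundary bessel_product_boundary_limit that)
    fix R :: real
    obtain D where D: "D \<ge> 0" "\<And>z. Im z > 0 \<Longrightarrow> norm (bessel_product z) \<le> D / sqrt (norm z)"
      using norm_bessel_product_le by metis
    \<comment> \<open>The product contributes |z|^(-m - 1/2). The power of z absorbs |z|^(-m), so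
      only an inverse square root remains at the origin, and |z| >= t replaces it by
      t^(-1/2).\<close>
    have "norm (Complex t \<delta> ^ (2 * (n + m)) * bessel_product (Complex t \<delta>) ^ (2 * m + 1)) \<le> (D ^ (2 * m + 1) * (R + 1) ^ (2 * n + m)) * t powr (- 1 / 2)"
      if t: "0 < t" "t \<le> R" and \<delta>: "0 < \<delta>" "\<delta> < 1" for t \<delta>
    proof -
      define r where "r = norm (Complex t \<delta>)"
      have tr: "t \<le> r" using complex_Re_le_cmod[of "Complex t \<delta>"] by (simp add: r_def)
      have rR: "r \<le> R + 1" using cmod_le[of "Complex t \<delta>"] t \<delta> by (simp add: r_def)
      have r: "r > 0" using t tr by simp
      have "norm (Complex t \<delta> ^ (2 * (n + m)) * bessel_product (Complex t \<delta>) ^ (2 * m + 1)) \<le> r ^ (2 * (n + m)) * (D / sqrt r) ^ (2 * m + 1)"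
        unfolding norm_mult norm_power r_def
        by (intro mult_left_mono power_mono D(2)) (use \<delta> in auto)
      also have "(D / sqrt r) ^ (2 * m + 1) = D ^ (2 * m + 1) / (r ^ m * sqrt r)"
      proof -
        have "sqrt r ^ (2 * m) = r ^ m" unfolding power_mult using r by simp
        thus ?thesis by (simp add: power_divide mult.commute)
      qed
      also have "r ^ (2 * (n + m)) * (D ^ (2 * m + 1) / (r ^ m * sqrt r)) = D ^ (2 * m + 1) * r ^ (2 * n + m) * (1 / sqrt r)"
      proof -
        have "r ^ (2 * (n + m)) = r ^ (2 * n + m) * r ^ m"
        proof -
          have "2 * (n + m) = 2 * n + m + m" by simp
          thus ?thesis by (metis power_add)
        qed
        thus ?thesis using r by simp
      qed
      also have "\<dots> \<le> D ^ (2 * m + 1) * (R + 1) ^ (2 * n + m) * (1 / sqrt t)"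
        using r rR tr t D(1) by (intro mult_mono power_mono frac_le mult_nonneg_nonneg) auto
      also have "1 / sqrt t = t powr (- 1 / 2)"
        using t by (simp add: powr_minus_divide powr_half_sqrt)
      finally show ?thesis .
    qed
    thus "\<exists>B. \<forall>t \<delta>. 0 < t \<longrightarrow> t \<le> R \<longrightarrow> 0 < \<delta> \<longrightarrow> \<delta> < 1 \<longrightarrow>
        norm (Complex t \<delta> ^ (2 * (n + m)) * bessel_product (Complex t \<delta>) ^ (2 * m + 1)) \<le> B * t powr (- 1 / 2)"
      by blast
  qed
  \<comment> \<open>An odd power of i makes \<open>\<beta>\<close> purely imaginary, so its
    imaginary part carries everything, with sign (-1)^m.\<close>
  also have "\<beta> = \<i> * of_real ((- 1) ^ m * (pi / 2) ^ (2 * m + 1) * real B / 16 ^ n)"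
  proof -
    have "(\<i> * of_real pi / 2) ^ (2 * m + 1) = (\<i> :: complex) ^ (2 * m + 1) * of_real ((pi / 2) ^ (2 * m + 1))"
      by (simp only: power_mult_distrib times_divide_eq_right[symmetric]) simp
    also have "(\<i> :: complex) ^ (2 * m + 1) = \<i> * of_real ((- 1) ^ m)" by (simp add: power_mult)
    finally show ?thesis unfolding \<beta>_def by (simp only: mult.assoc) simp
  qed
  finally show ?thesis by simp
qed

theorem mainTheorem5:
  fixes m n :: nat
  assumes "m > 0" and "n > 0"
  shows "\<exists>k::nat. k > 0 \<and>
    4 ^ n / pi ^ (2 * m) *
      (\<Sum>l = 1..m. (- 1) ^ (l - 1) * real ((2 * m - 1) choose (2 * l - 1)) *
        (LINT t:{0<..}|lborel.
           (pi * bessel_I0 t) ^ (2 * (m - l)) * bessel_K0 t ^ (2 * (m + l - 1)) *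
           (2 * t) ^ (2 * (n + m - 2)))) = real k"
proof -
  obtain p where p: "m = Suc p" using \<open>m > 0\<close> by (cases m) auto
  obtain q where q: "n = Suc q" using \<open>n > 0\<close> by (cases n) auto
  define B where "B = fps_nth (Abs_fps K0_product_coeff ^ (2 * p + 1)) (2 * q)"
  define h where "h = (\<lambda>l t. (pi * bessel_I0 t) ^ (2 * (m - l)) * bessel_K0 t ^ (2 * (m + l - 1)) * (2 * t) ^ (2 * (n + m - 2)))"
  define a where "a = (\<lambda>l. (- 1) ^ (l - 1) * real ((2 * m - 1) choose (2 * l - 1)))"
  define F0 :: "real \<Rightarrow> complex" where "F0 = (\<lambda>t. of_real (t ^ (2 * (q + p))) *
     (of_real (bessel_K0 t) * (of_real (bessel_K0 t) + \<i> * of_real (pi * bessel_I0 t))) ^ (2 * p + 1))"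
  have hi: "set_integrable lborel {0<..} (h l)" if "l \<in> {1..m}" for l
    unfolding h_def by (rule set_integrable_bessel_moment[OF that \<open>n > 0\<close>])
  have ahi: "set_integrable lborel {0<..} (\<lambda>t. a l * h l t)" if "l \<in> {1..m}" for l
    by (intro set_integrable_mult_right hi that)
  have sumi: "set_integrable lborel {0<..} (\<lambda>t. \<Sum>l = 1..m. a l * h l t)"
    using ahi unfolding set_integrable_def scaleR_sum_right by (intro Bochner_Integration.integrable_sum)
  have S: "(\<Sum>l = 1..m. a l * h l t) = (- 1) ^ p * 4 ^ (q + p) * Re (F0 t)" for t
  proof -
    have "(2 * t) ^ (2 * (n + m - 2)) = 4 ^ (q + p) * t ^ (2 * (q + p))"
    proof -
      have "n + m - 2 = q + p" by (simp add: p q)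
      moreover have "(2 :: real) ^ (2 * (q + p)) = 4 ^ (q + p)" unfolding power_mult by simp
      ultimately show ?thesis by (simp only: power_mult_distrib)
    qed
    hence "(\<Sum>l = 1..m. a l * h l t) = (- 1) ^ p * Re (of_real (4 ^ (q + p) * t ^ (2 * (q + p))) *
        (of_real (bessel_K0 t) * (of_real (bessel_K0 t) + \<i> * of_real (pi * bessel_I0 t))) ^ (2 * p + 1))"
      unfolding a_def h_def using alternating_bessel_sum[of p "pi * bessel_I0 t" "bessel_K0 t"] by (simp only: p)
    also have "of_real (4 ^ (q + p) * t ^ (2 * (q + p))) *
        (of_real (bessel_K0 t) * (of_real (bessel_K0 t) + \<i> * of_real (pi * bessel_I0 t))) ^ (2 * p + 1) = of_real (4 ^ (q + p)) * F0 t"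
      unfolding F0_def by (simp only: of_real_mult mult.assoc)
    also have "Re (of_real (4 ^ (q + p)) * F0 t) = 4 ^ (q + p) * Re (F0 t)" by (simp only: times_complex.sel Re_complex_of_real Im_complex_of_real)
    finally show ?thesis by simp
  qed
  \<comment> \<open>Solving \<open>S\<close> for the real part transfers integrability from the
    individual Bessel moments to it, the hypothesis of the contour argument.\<close>
  have "Re (F0 t) = (- 1) ^ p / 4 ^ (q + p) * (\<Sum>l = 1..m. a l * h l t)" for t
    unfolding S by (simp flip: power_mult_distrib mult.assoc)
  hence "set_integrable lborel {0<..} (\<lambda>t. Re (F0 t))"
    using set_integrable_mult_right[OF sumi] by simp
  hence M: "(LINT t:{0<..}|lborel. Re (F0 t)) = (- 1) ^ p * (pi / 2) ^ (2 * p + 2) * real B / 16 ^ q"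
    unfolding F0_def B_def by (rule bessel_product_moment)
  have "(\<Sum>l = 1..m. a l * (LINT t:{0<..}|lborel. h l t)) = (LINT t:{0<..}|lborel. \<Sum>l = 1..m. a l * h l t)"
  proof -
    have "(LINT t:{0<..}|lborel. \<Sum>l = 1..m. a l * h l t) = (\<Sum>l = 1..m. LINT t:{0<..}|lborel. a l * h l t)"
      unfolding set_lebesgue_integral_def scaleR_sum_right
      by (rule Bochner_Integration.integral_sum) (use ahi in \<open>simp add: set_integrable_def\<close>)
    thus ?thesis by simp
  qed
  also have "\<dots> = (- 1) ^ p * 4 ^ (q + p) * ((- 1) ^ p * (pi / 2) ^ (2 * p + 2) * real B / 16 ^ q)"
    unfolding S M[symmetric] by (rule set_integral_mult_right)
  also have "\<dots> = 4 ^ (q + p) * (pi / 2) ^ (2 * p + 2) * real B / 16 ^ q"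
    by (simp flip: power_mult_distrib mult.assoc)
  finally have "4 ^ n / pi ^ (2 * m) * (\<Sum>l = 1..m. a l * (LINT t:{0<..}|lborel. h l t)) =
      4 ^ n / pi ^ (2 * m) * (4 ^ (q + p) * (pi / 2) ^ (2 * p + 2) * real B / 16 ^ q)" by (simp only:)
  also have "\<dots> = real B"
  proof -
    \<comment> \<open>All constants cancel: pi^(2m) goes, and the exponents of 4 add up to n + (q +
      p) - m - 2q = 0.\<close>
    have "(pi / 2) ^ (2 * p + 2) = pi ^ (2 * m) / 4 ^ m" unfolding p by (simp add: power_divide power_mult)
    moreover have "(16 :: real) ^ q = 4 ^ q * 4 ^ q" by (simp flip: power_mult_distrib)
    ultimately show ?thesis by (simp add: p q power_add)
  qed
  finally have "4 ^ n / pi ^ (2 * m) * (\<Sum>l = 1..m. a l * (LINT t:{0<..}|lborel. h l t)) = real B" .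
  moreover have "B > 0"
    unfolding B_def by (rule fps_power_even_nth_pos) (auto simp: K0_product_coeff_pos)
  ultimately show ?thesis unfolding a_def h_def by blast
qed

end
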